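(* Let $\nu$ be a partition of $n$ with at most $N$ parts. The rational function $Z_\nu(u)=(\mathrm{tr}^{\otimes n}\otimes\mathrm{id})(F_T(u))$ with values in $U(\mathfrak g)$ does not depend on the choice of the standard tableau $T$ of shape $\nu$.
   Context: $M=\lfloor N/2\rfloor$. Index set $I=\{-M,\dots,-1,1,\dots,M\}$ if $N=2M$, $I=\{-M,\dots,-1,0,1,\dots,M\}$ if $N=2M+1$; $e_i$ basis of $\mathbb C^N$, $E_{ij}$ matrix units. $G=O_N$ preserves $\langle e_i,e_j\rangle=\delta_{i,-j}$, $G=Sp_N$ ($N$ even) preserves $\langle e_i,e_j\rangle=\delta_{i,-j}\operatorname{sgn}i$; $\mathfrak g\subset\mathfrak{gl}_N$ its Lie algebra. $\varepsilon_{ij}=\operatorname{sgn}i\operatorname{sgn}j$ for $Sp_N$, $1$ for $O_N$; $F_{ij}=E_{ij}-\varepsilon_{ij}E_{-j,-i}$; $\eta=\frac12$ for $\mathfrak{so}_N$, $-\frac12$ for $\mathfrak{sp}_N$. $F(u)=-u-\eta+\sum_{i,j}E_{ij}\otimes F_{ji}$; $\iota_p(X)=1^{\otimes(p-1)}\otimes X\otimes1^{\otimes(n-p)}$; $F_p(u)=(\iota_p\otimes\mathrm{id})F(u)$; $Q=\sum_{i,j}\varepsilon_{ij}E_{ij}\otimes E_{-i,-j}$, $Q_{pq}=(\iota_p\otimes\iota_q)(Q)$. A standard tableau $T$ of shape $\nu$ is a filling of the Young diagram by $1,\dots,n$ increasing along rows and down columns; $c_p=k-l$ if $p$ is in column $k$,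 row $l$. $\Phi_T=\frac{\dim W_\nu}{n!}\sum_{\sigma\in S_n}\langle w_T,\sigma w_T\rangle\sigma$, where $w_T$ is the unit Young basis vector of the irreducible $S_n$-module $W_\nu$ (invariant inner product) associated with $T$ via the chain $S_1\subset\dots\subset S_n$; $Y_T$ is the image of $\Phi_T$ in $\mathrm{End}(\mathbb C^N)^{\otimes n}$ under permutation of tensor factors. $F_T(u)=(Y_T\otimes1)\prod_{p=1}^n\big(1+\frac{(Q_{1p}+\dots+Q_{p-1,p})\otimes1}{2u+c_p}\big)F_p(u+c_p)$, ordered left to right; $\mathrm{tr}$ is the matrix trace. *)

theory Defs
  imports Complex_Main "HOL-Combinatorics.Combinatorics"
begin

datatype grp = Orth | Sympl

definition Mhalf :: "nat \<Rightarrow> int" where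
  "Mhalf N = int (N div 2)"

definition Iset :: "nat \<Rightarrow> int set" where
  "Iset N = {- Mhalf N .. Mhalf N} - (if even N then {0} else {})"

definition eps :: "grp \<Rightarrow> int \<Rightarrow> int \<Rightarrow> complex" where
  "eps G i j = (if G = Sympl then of_int (sgn i * sgn j) else 1)"

definition eta :: "grp \<Rightarrow> complex" where
  "eta G = (if G = Orth then 1/2 else - 1/2)"

text \<open>Matrix entries (a,b) of F_ij = E_ij - eps_ij E_{-j,-i} in gl_N.\<close>
definition Fmat :: "grp \<Rightarrow> int \<Rightarrow> int \<Rightarrow> int \<Rightarrow> int \<Rightarrow> complex" where
  "Fmat G i j a b = (if a = i \<and> b = j then 1 else 0)
                    - eps G i j * (if a = - j \<and> b = - i then 1 else 0)"

text \<open>Elements of the free associative algebra over C on generators indexed by int \<times> int: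
  coefficient functions on words.  Generator (i,j) stands for F_ij.\<close>
type_synonym fa = "(int \<times> int) list \<Rightarrow> complex"

definition fa_mult :: "fa \<Rightarrow> fa \<Rightarrow> fa" where
  "fa_mult x y = (\<lambda>w. \<Sum>k\<in>{0..length w}. x (take k w) * y (drop k w))"

definition fa_const :: "complex \<Rightarrow> fa" where
  "fa_const c = (\<lambda>w. if w = [] then c else 0)"

definition fa_gen :: "int \<times> int \<Rightarrow> fa" where
  "fa_gen g = (\<lambda>w. if w = [g] then 1 else 0)"

definition fa_fin :: "fa \<Rightarrow> bool" where
  "fa_fin x \<longleftrightarrow> finite {w. x w \<noteq> 0}"

definition lincomb :: "nat \<Rightarrow> (int \<times> int \<Rightarrow> complex) \<Rightarrow> fa" where
  "lincomb N c = (\<lambda>w. \<Sum>g\<in>Iset N \<times> Iset N. c g * fa_gen g w)"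

definition gmat_of :: "grp \<Rightarrow> nat \<Rightarrow> (int \<times> int \<Rightarrow> complex) \<Rightarrow> int \<Rightarrow> int \<Rightarrow> complex" where
  "gmat_of G N c a b = (\<Sum>g\<in>Iset N \<times> Iset N. c g * Fmat G (fst g) (snd g) a b)"

definition gbracket :: "grp \<Rightarrow> nat \<Rightarrow> int \<times> int \<Rightarrow> int \<times> int \<Rightarrow> int \<Rightarrow> int \<Rightarrow> complex" where
  "gbracket G N \<alpha> \<beta> a b = (\<Sum>d\<in>Iset N.
      Fmat G (fst \<alpha>) (snd \<alpha>) a d * Fmat G (fst \<beta>) (snd \<beta>) d b
    - Fmat G (fst \<beta>) (snd \<beta>) a d * Fmat G (fst \<alpha>) (snd \<alpha>) d b)"

text \<open>Two-sided ideal of the free algebra whose quotient is U(g):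
  generators outside I\<times>I are killed, linear relations among the F_ij hold,
  and commutators of generators are the Lie brackets.\<close>
inductive_set Uideal :: "grp \<Rightarrow> nat \<Rightarrow> fa set" for G N where
  rel0: "g \<notin> Iset N \<times> Iset N \<Longrightarrow> fa_gen g \<in> Uideal G N"
| rel1: "(\<forall>a\<in>Iset N. \<forall>b\<in>Iset N. gmat_of G N c a b = 0) \<Longrightarrow> lincomb N c \<in> Uideal G N"
| rel2: "\<alpha> \<in> Iset N \<times> Iset N \<Longrightarrow> \<beta> \<in> Iset N \<times> Iset N \<Longrightarrow>
         (\<forall>a\<in>Iset N. \<forall>b\<in>Iset N. gmat_of G N c a b = gbracket G N \<alpha> \<beta> a b) \<Longrightarrow>
         (\<lambda>w. fa_mult (fa_gen \<alpha>) (fa_gen \<beta>) w - fa_mult (fa_gen \<beta>) (fa_gen \<alpha>) w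
              - lincomb N c w) \<in> Uideal G N"
| zero: "(\<lambda>w. 0) \<in> Uideal G N"
| add: "x \<in> Uideal G N \<Longrightarrow> y \<in> Uideal G N \<Longrightarrow> (\<lambda>w. x w + y w) \<in> Uideal G N"
| lmul: "x \<in> Uideal G N \<Longrightarrow> fa_fin y \<Longrightarrow> fa_mult y x \<in> Uideal G N"
| rmul: "x \<in> Uideal G N \<Longrightarrow> fa_fin y \<Longrightarrow> fa_mult x y \<in> Uideal G N"

definition U_eq :: "grp \<Rightarrow> nat \<Rightarrow> fa \<Rightarrow> fa \<Rightarrow> bool" where
  "U_eq G N x y \<longleftrightarrow> (\<lambda>w. x w - y w) \<in> Uideal G N"

definition is_partition :: "nat list \<Rightarrow> nat \<Rightarrow> bool" where
  "is_partition \<nu> n \<longleftrightarrow> sorted (rev \<nu>) \<and> 0 \<notin> set \<nu> \<and> sum_list \<nu> = n"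

text \<open>Cells (row, column), 0-based.\<close>
definition cells :: "nat list \<Rightarrow> (nat \<times> nat) set" where
  "cells \<nu> = {(l, k). l < length \<nu> \<and> k < \<nu> ! l}"

type_synonym tableau = "nat \<Rightarrow> nat \<times> nat"

definition std_tableau :: "nat \<Rightarrow> nat list \<Rightarrow> tableau \<Rightarrow> bool" where
  "std_tableau n \<nu> T \<longleftrightarrow> bij_betw T {1..n} (cells \<nu>)
     \<and> (\<forall>p. p \<notin> {1..n} \<longrightarrow> T p = (0, 0))
     \<and> (\<forall>p\<in>{1..n}. \<forall>q\<in>{1..n}. p \<noteq> q \<and> fst (T p) \<le> fst (T q) \<and> snd (T p) \<le> snd (T q)
          \<longrightarrow> p < q)"

definition std_tableaux :: "nat \<Rightarrow> nat list \<Rightarrow> tableau set" where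
  "std_tableaux n \<nu> = {T. std_tableau n \<nu> T}"

definition content :: "tableau \<Rightarrow> nat \<Rightarrow> int" where
  "content T p = int (snd (T p)) - int (fst (T p))"

text \<open>Matrix of the adjacent transposition s_k = (k, k+1) in the orthonormal Young
  basis {w_S} (S standard of shape nu), entry (S, S').\<close>
definition yorth :: "nat \<Rightarrow> tableau \<Rightarrow> tableau \<Rightarrow> real" where
  "yorth k S S' = (let r = 1 / real_of_int (content S (k + 1) - content S k) in
     if S' = S then r
     else if S' = S \<circ> transpose k (k + 1) then sqrt (1 - r ^ 2) else 0)"

definition ymul :: "nat \<Rightarrow> nat list \<Rightarrow> (tableau \<Rightarrow> tableau \<Rightarrow> real)
                      \<Rightarrow> (tableau \<Rightarrow> tableau \<Rightarrow> real) \<Rightarrow> tableau \<Rightarrow> tableau \<Rightarrow> real" where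
  "ymul n \<nu> A B S S' = (\<Sum>R\<in>std_tableaux n \<nu>. A S R * B R S')"

fun yword :: "nat \<Rightarrow> nat list \<Rightarrow> nat list \<Rightarrow> tableau \<Rightarrow> tableau \<Rightarrow> real" where
  "yword n \<nu> [] = (\<lambda>S S'. if S = S' then 1 else 0)"
| "yword n \<nu> (k # ks) = ymul n \<nu> (yorth k) (yword n \<nu> ks)"

fun perm_word :: "nat list \<Rightarrow> nat \<Rightarrow> nat" where
  "perm_word [] = id"
| "perm_word (k # ks) = transpose k (k + 1) \<circ> perm_word ks"

definition yrho :: "nat \<Rightarrow> nat list \<Rightarrow> (nat \<Rightarrow> nat) \<Rightarrow> tableau \<Rightarrow> tableau \<Rightarrow> real" where
  "yrho n \<nu> \<sigma> = yword n \<nu> (SOME ks. set ks \<subseteq> {1..<n} \<and> perm_word ks = \<sigma>)"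

text \<open>Multi-indices i = (i_1..i_n) \<in> I^n as lists; position p (1-based) is i ! (p-1).
  An operator is given by its matrix entries, valued in the free algebra.\<close>
type_synonym opr = "int list \<Rightarrow> int list \<Rightarrow> fa"

definition midx :: "nat \<Rightarrow> nat \<Rightarrow> int list set" where
  "midx N n = {a. length a = n \<and> set a \<subseteq> Iset N}"

definition omul :: "nat \<Rightarrow> nat \<Rightarrow> opr \<Rightarrow> opr \<Rightarrow> opr" where
  "omul N n A B = (\<lambda>a c w. \<Sum>b\<in>midx N n. fa_mult (A a b) (B b c) w)"

definition oid :: opr where
  "oid = (\<lambda>a c. fa_const (if a = c then 1 else 0))"

fun oprod :: "nat \<Rightarrow> nat \<Rightarrow> opr list \<Rightarrow> opr" where
  "oprod N n [] = oid"
| "oprod N n (A # As) = omul N n A (oprod N n As)"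

text \<open>F_p(u) = -u-eta + sum_{i,j} E_ij (in factor p) \<otimes> F_ji.\<close>
definition Fp :: "grp \<Rightarrow> nat \<Rightarrow> nat \<Rightarrow> complex \<Rightarrow> opr" where
  "Fp G n p u = (\<lambda>a b w.
      (if a = b then fa_const (- u - eta G) w else 0)
    + (if (\<forall>q<n. q \<noteq> p - 1 \<longrightarrow> a ! q = b ! q) then fa_gen (b ! (p - 1), a ! (p - 1)) w else 0))"

text \<open>Q_pq = sum_{i,j} eps_ij E_ij (factor p) \<otimes> E_{-i,-j} (factor q), scalar entries.\<close>
definition Qpq :: "grp \<Rightarrow> nat \<Rightarrow> nat \<Rightarrow> nat \<Rightarrow> int list \<Rightarrow> int list \<Rightarrow> complex" where
  "Qpq G n p q a b = (if (\<forall>r<n. r \<noteq> p - 1 \<and> r \<noteq> q - 1 \<longrightarrow> a ! r = b ! r)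
        \<and> a ! (q - 1) = - (a ! (p - 1)) \<and> b ! (q - 1) = - (b ! (p - 1))
      then eps G (a ! (p - 1)) (b ! (p - 1)) else 0)"

definition factorT :: "grp \<Rightarrow> nat \<Rightarrow> nat \<Rightarrow> tableau \<Rightarrow> complex \<Rightarrow> nat \<Rightarrow> opr" where
  "factorT G N n T u p = omul N n
     (\<lambda>a b. fa_const ((if a = b then 1 else 0)
        + (\<Sum>q\<in>{1..<p}. Qpq G n q p a b) / (2 * u + of_int (content T p))))
     (Fp G n p (u + of_int (content T p)))"

text \<open>Y_T: image of Phi_T = dim W_nu / n! sum_sigma <w_T, sigma w_T> sigma,
  sigma acting by permutation of tensor factors.\<close>
definition YT :: "nat \<Rightarrow> nat list \<Rightarrow> tableau \<Rightarrow> opr" where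
  "YT n \<nu> T = (\<lambda>a b. fa_const
     (of_nat (card (std_tableaux n \<nu>)) / of_nat (fact n) *
      (\<Sum>\<sigma>\<in>{\<sigma>. \<sigma> permutes {1..n}}.
         of_real (yrho n \<nu> \<sigma> T T) *
         (if \<forall>p\<in>{1..n}. a ! (p - 1) = b ! (\<sigma> p - 1) then 1 else 0))))"

definition FT :: "grp \<Rightarrow> nat \<Rightarrow> nat \<Rightarrow> nat list \<Rightarrow> tableau \<Rightarrow> complex \<Rightarrow> opr" where
  "FT G N n \<nu> T u = omul N n (YT n \<nu> T) (oprod N n (map (factorT G N n T u) [1..<n+1]))"

definition ZT :: "grp \<Rightarrow> nat \<Rightarrow> nat \<Rightarrow> nat list \<Rightarrow> tableau \<Rightarrow> complex \<Rightarrow> fa" where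
  "ZT G N n \<nu> T u = (\<lambda>w. \<Sum>a\<in>midx N n. FT G N n \<nu> T u a a w)"

end

(*
  Let E_ST be the matrix units of the group algebra of S_n in Young's orthogonal form, acting on
  tensor space, and m_ST = E_ST * prod_p (2u + c_p + J_p) (F_p - u - c_p - eta), where
  J_p = Q_1p + ... + Q_{p-1,p} and c_p are the contents of T; Z_nu(u) is the trace of m_TT up to a
  factor depending only on nu.

  The key point is that m_ST s_j = r m_ST + q m_ST' for T' = T s_j, with the same coefficients r, q
  as for E_ST. It is proved by induction on the number of factors: J_{k,k+1} Q_{k,k+1} equals the
  Jucys-Murphy element X_k times Q_{k,k+1}, and X_k acts on the first k factors by c_k, so the
  factors at k and k+1 can be rewritten in the symmetric form
  (2u + a + J_k) (2u + b + J_{k,k+1}) F_k(a) (2u + a + b + Q) F_{k+1}(b), a = c_k, b = c_{k+1},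
  where J_{k,k+1} = Q_{1,k+1} + ... + Q_{k-1,k+1}. The reflection equation then lets s_k - 1/(b - a)
  pass through, exchanging a and b. This step divides by 2u + a + b; since everything is polynomial
  in u, it suffices to treat 2u outside the integers.

  By cyclicity of the trace against X_j, tr m_ST = 0 when S = T s_j. Evaluating
  tr (m_{T'T} s_j) = tr (s_j m_{T'T}) then gives q tr m_{T'T'} = q tr m_TT with q nonzero, and any two
  standard tableaux of the same shape are connected by such steps.
*)
theory Submission
  imports Defs
begin

section \<open>The enveloping algebra as a quotient ring\<close>

text \<open>Entries in U(g) do not commute, so the trace is not cyclic in general; only permutation
  operators, whose entries are scalars, may be moved around it. This is why the argument needs the
  off-diagonal products m_ST: left multiplication by the group algebra sees S, right multiplication
  sees T, and the trace only compares these two actions. The factors at k and k+1 cannot be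
  exchanged as they stand, since Q_{k,k+1} sits inside J_{k+1} and not between the two F. Moving it
  there costs a term that becomes a scalar multiple only behind a product on which X_k has a known
  eigenvalue, so the exchange property of shorter products feeds the next step. Clearing the
  denominators 2u + c_p changes the product by a scalar that runs over the cells and is the same for
  every T. The denominator 2u + a + b is an artefact of the exchange and may vanish at admissible u,
  whence the detour through polynomial dependence. The matrices of Young's form are defined through
  a chosen word for each permutation; that the choice is immaterial requires the Coxeter
  presentation of the symmetric group.\<close>

lemma fa_mult_Nil [simp]: "fa_mult x y [] = x [] * y []"
  by (simp add: fa_mult_def)

text \<open>Peeling off the first letter turns the convolution into a recursion, so that
  associativity and multiplication by constants follow by induction on the word.\<close>

lemma fa_mult_Cons: "fa_mult x y (g # w) = x [] * y (g # w) + fa_mult (\<lambda>v. x (g # v)) y w"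
proof -
  have "fa_mult x y (g # w) = (\<Sum>k\<in>{0..Suc (length w)}. x (take k (g # w)) * y (drop k (g # w)))"
    by (simp add: fa_mult_def)
  also have "\<dots> = x [] * y (g # w) + (\<Sum>k\<in>{0..length w}. x (g # take k w) * y (drop k w))"
    by (subst sum.atLeast0_atMost_Suc_shift) (simp add: atLeast0AtMost)
  finally show ?thesis by (simp add: fa_mult_def)
qed

lemma fa_mult_add_left: "fa_mult (\<lambda>w. x w + y w) z = (\<lambda>w. fa_mult x z w + fa_mult y z w)"
  by (simp add: fa_mult_def sum.distrib distrib_right)

lemma fa_mult_add_right: "fa_mult z (\<lambda>w. x w + y w) = (\<lambda>w. fa_mult z x w + fa_mult z y w)"
  by (simp add: fa_mult_def sum.distrib distrib_left)

lemma fa_mult_diff_left: "fa_mult (\<lambda>w. x w - y w) z = (\<lambda>w. fa_mult x z w - fa_mult y z w)"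
  by (simp add: fa_mult_def sum_subtractf left_diff_distrib)

lemma fa_mult_diff_right: "fa_mult z (\<lambda>w. x w - y w) = (\<lambda>w. fa_mult z x w - fa_mult z y w)"
  by (simp add: fa_mult_def sum_subtractf right_diff_distrib)

lemma fa_mult_scale_left: "fa_mult (\<lambda>w. c * x w) y = (\<lambda>w. c * fa_mult x y w)"
  by (simp add: fa_mult_def sum_distrib_left mult.assoc)

lemma fa_mult_assoc: "fa_mult (fa_mult x y) z = fa_mult x (fa_mult y z)"
proof
  show "fa_mult (fa_mult x y) z w = fa_mult x (fa_mult y z) w" for w
  proof (induction w arbitrary: x y z)
    case (Cons g w)
    then show ?case
      by (simp add: fa_mult_Cons fa_mult_add_left fa_mult_scale_left algebra_simps)
  qed simp
qed

lemma fa_mult_const_left: "fa_mult (fa_const c) x = (\<lambda>w. c * x w)"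
proof
  fix w
  have "fa_mult (\<lambda>v. 0) x v = 0" for v by (simp add: fa_mult_def)
  then show "fa_mult (fa_const c) x w = c * x w"
    by (cases w) (simp_all add: fa_mult_Cons fa_const_def)
qed

lemma fa_mult_const_right: "fa_mult x (fa_const c) = (\<lambda>w. c * x w)"
proof
  show "fa_mult x (fa_const c) w = c * x w" for w
    by (induction w arbitrary: x) (simp_all add: fa_mult_Cons fa_const_def)
qed

lemma fa_mult_const: "fa_mult (fa_const a) (fa_const b) = fa_const (a * b)"
  unfolding fa_mult_const_left by (auto simp: fa_const_def)

lemma fa_fin_const [simp]: "fa_fin (fa_const c)"
  unfolding fa_fin_def by (rule finite_subset[of _ "{[]}"]) (auto simp: fa_const_def)

lemma fa_fin_gen [simp]: "fa_fin (fa_gen g)"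
  unfolding fa_fin_def by (rule finite_subset[of _ "{[g]}"]) (auto simp: fa_gen_def)

lemma fa_fin_zero [simp]: "fa_fin (\<lambda>w. 0)"
  by (simp add: fa_fin_def)

lemma fa_fin_add [simp]: "fa_fin x \<Longrightarrow> fa_fin y \<Longrightarrow> fa_fin (\<lambda>w. x w + y w)"
  unfolding fa_fin_def
  by (rule finite_subset[of _ "{w. x w \<noteq> 0} \<union> {w. y w \<noteq> 0}"]) auto

lemma fa_fin_diff [simp]: "fa_fin x \<Longrightarrow> fa_fin y \<Longrightarrow> fa_fin (\<lambda>w. x w - y w)"
  unfolding fa_fin_def
  by (rule finite_subset[of _ "{w. x w \<noteq> 0} \<union> {w. y w \<noteq> 0}"]) auto

lemma fa_fin_scale [simp]: "fa_fin x \<Longrightarrow> fa_fin (\<lambda>w. c * x w)"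
  unfolding fa_fin_def by (rule finite_subset[of _ "{w. x w \<noteq> 0}"]) auto

lemma fa_fin_uminus [simp]: "fa_fin x \<Longrightarrow> fa_fin (\<lambda>w. - x w)"
  by (simp add: fa_fin_def)

lemma fa_fin_sum [simp]: "(\<And>i. i \<in> A \<Longrightarrow> fa_fin (x i)) \<Longrightarrow> fa_fin (\<lambda>w. \<Sum>i\<in>A. x i w)"
  by (induction A rule: infinite_finite_induct) auto

lemma fa_fin_mult [simp]: "fa_fin x \<Longrightarrow> fa_fin y \<Longrightarrow> fa_fin (fa_mult x y)"
  unfolding fa_fin_def
proof (rule finite_subset[of _ "(\<lambda>(v, w). v @ w) ` ({w. x w \<noteq> 0} \<times> {w. y w \<noteq> 0})"])
  show "{w. fa_mult x y w \<noteq> 0} \<subseteq> (\<lambda>(v, w). v @ w) ` ({w. x w \<noteq> 0} \<times> {w. y w \<noteq> 0})"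
  proof
    fix w assume "w \<in> {w. fa_mult x y w \<noteq> 0}"
    then have "(\<Sum>k\<in>{0..length w}. x (take k w) * y (drop k w)) \<noteq> 0"
      by (simp add: fa_mult_def)
    then obtain k where "x (take k w) * y (drop k w) \<noteq> 0"
      by (meson sum.not_neutral_contains_not_neutral)
    then show "w \<in> (\<lambda>(v, w). v @ w) ` ({w. x w \<noteq> 0} \<times> {w. y w \<noteq> 0})"
      by (intro image_eqI[of _ _ "(take k w, drop k w)"]) auto
  qed
qed auto

lemma lincomb_Nil [simp]: "lincomb N c [] = 0"
  by (simp add: lincomb_def fa_gen_def)

lemma finite_Iset [simp]: "finite (Iset N)"
  by (simp add: Iset_def)

lemma fa_fin_lincomb [simp]: "fa_fin (lincomb N c)"
  unfolding lincomb_def by (intro fa_fin_sum fa_fin_scale) simp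

text \<open>All relations lie in the augmentation ideal. Hence \<open>1\<close> survives in the
  quotient, and \<open>Ucls\<close> may put the augmentation into the other components.\<close>

lemma Uideal_Nil: "x \<in> Uideal G N \<Longrightarrow> x [] = 0"
  by (induction rule: Uideal.induct) (simp_all add: fa_gen_def)

lemma Uideal_scale: "x \<in> Uideal G N \<Longrightarrow> (\<lambda>w. c * x w) \<in> Uideal G N"
  using Uideal.lmul[of x G N "fa_const c"] by (simp add: fa_mult_const_left)

lemma U_eq_refl: "U_eq G N x x"
  by (simp add: U_eq_def Uideal.zero)

lemma U_eq_sym: "U_eq G N x y \<Longrightarrow> U_eq G N y x"
  using Uideal_scale[of "\<lambda>w. x w - y w" G N "-1"] by (simp add: U_eq_def)

lemma U_eq_trans: "U_eq G N x y \<Longrightarrow> U_eq G N y z \<Longrightarrow> U_eq G N x z"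
  using Uideal.add[of "\<lambda>w. x w - y w" G N "\<lambda>w. y w - z w"] by (simp add: U_eq_def)

lemma U_eq_add:
  "U_eq G N x y \<Longrightarrow> U_eq G N x' y' \<Longrightarrow> U_eq G N (\<lambda>w. x w + x' w) (\<lambda>w. y w + y' w)"
  using Uideal.add[of "\<lambda>w. x w - y w" G N "\<lambda>w. x' w - y' w"]
  by (simp add: U_eq_def algebra_simps)

lemma U_eq_scale: "U_eq G N x y \<Longrightarrow> U_eq G N (\<lambda>w. c * x w) (\<lambda>w. c * y w)"
  using Uideal_scale[of "\<lambda>w. x w - y w" G N c] by (simp add: U_eq_def algebra_simps)

lemma U_eq_mult:
  assumes "U_eq G N x y" "U_eq G N x' y'" "fa_fin x'" "fa_fin y"
  shows "U_eq G N (fa_mult x x') (fa_mult y y')"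
proof -
  \<comment> \<open>The telescoping x x' - y y' = (x - y) x' + y (x' - y') has only
    \<open>x'\<close> and \<open>y\<close> as outer multipliers, and the ideal absorbs multipliers
    of finite support.\<close>
  have "fa_mult (\<lambda>w. x w - y w) x' \<in> Uideal G N" "fa_mult y (\<lambda>w. x' w - y' w) \<in> Uideal G N"
    using assms by (auto simp: U_eq_def intro: Uideal.lmul Uideal.rmul)
  from Uideal.add[OF this] show ?thesis
    by (simp add: U_eq_def fa_mult_diff_left fa_mult_diff_right)
qed

definition urel :: "(grp \<times> nat \<Rightarrow> fa) \<Rightarrow> (grp \<times> nat \<Rightarrow> fa) \<Rightarrow> bool" where
  "urel x y \<longleftrightarrow> (\<forall>G N. fa_fin (x (G, N)) \<and> fa_fin (y (G, N)) \<and> U_eq G N (x (G, N)) (y (G, N)))"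

text \<open>Types cannot depend on \<open>G\<close> and \<open>N\<close>, so this is the product of the algebras
  \<open>U(\<gg>)\<close> over all \<open>G\<close> and \<open>N\<close>.\<close>
quotient_type uea = "grp \<times> nat \<Rightarrow> fa" / partial: urel
proof (rule part_equivpI)
  show "\<exists>x. urel x x"
    by (rule exI[of _ "\<lambda>_ _. 0"]) (simp add: urel_def U_eq_refl)
  show "symp urel" by (auto simp: symp_def urel_def intro: U_eq_sym)
  show "transp urel" unfolding transp_def urel_def by (blast intro: U_eq_trans)
qed

instantiation uea :: ring_1
begin

lift_definition zero_uea :: uea is "\<lambda>_ _. 0"
  by (simp add: urel_def U_eq_refl)
lift_definition one_uea :: uea is "\<lambda>_. fa_const 1"
  by (simp add: urel_def U_eq_refl)
lift_definition plus_uea :: "uea \<Rightarrow> uea \<Rightarrow> uea" is "\<lambda>x y p w. x p w + y p w"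
  by (simp add: urel_def U_eq_add)
lift_definition uminus_uea :: "uea \<Rightarrow> uea" is "\<lambda>x p w. - x p w"
  using U_eq_scale[of _ _ _ _ "-1"] by (simp add: urel_def)
lift_definition minus_uea :: "uea \<Rightarrow> uea \<Rightarrow> uea" is "\<lambda>x y p w. x p w - y p w"
  using U_eq_add[OF _ U_eq_scale[of _ _ _ _ "-1"]] by (simp add: urel_def)
lift_definition times_uea :: "uea \<Rightarrow> uea \<Rightarrow> uea" is "\<lambda>x y p. fa_mult (x p) (y p)"
  by (simp add: urel_def U_eq_mult)

instance
proof
  show "(0::uea) \<noteq> 1"
  proof transfer
    show "\<not> urel (\<lambda>_ _. 0) (\<lambda>_. fa_const 1)"
    proof
      assume "urel (\<lambda>_ _. 0) (\<lambda>_. fa_const 1)"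
      then have "(\<lambda>w. 0 - fa_const 1 w) \<in> Uideal Orth 0"
        unfolding urel_def U_eq_def by blast
      from Uideal_Nil[OF this] show False by (simp add: fa_const_def)
    qed
  qed
qed (transfer, simp add: urel_def U_eq_refl fa_mult_assoc fa_mult_const_left fa_mult_const_right
       fa_mult_add_left fa_mult_add_right algebra_simps)+

end

lift_definition uc :: "complex \<Rightarrow> uea" is "\<lambda>c _. fa_const c"
  by (simp add: urel_def U_eq_refl)

lemma fa_const_add: "fa_const (a + b) = (\<lambda>w. fa_const a w + fa_const b w)"
  by (auto simp: fa_const_def)

lemma uc_add: "uc (a + b) = uc a + uc b"
  by transfer (simp add: urel_def U_eq_refl fa_const_add)

lemma uc_mult: "uc (a * b) = uc a * uc b"
  by transfer (simp add: urel_def U_eq_refl fa_mult_const)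

lemma uc_0 [simp]: "uc 0 = 0"
  using uc_add[of 0 0] by simp

lemma uc_1 [simp]: "uc 1 = 1"
  by transfer (simp add: urel_def U_eq_refl)

lemma uc_minus: "uc (- a) = - uc a"
  using uc_add[of a "-a"] by (simp add: eq_neg_iff_add_eq_0 add.commute)

lemma uc_comm: "x * uc c = uc c * x"
  by transfer (simp add: urel_def U_eq_refl fa_mult_const_left fa_mult_const_right)

text \<open>The components other than \<open>(G, N)\<close> carry the augmentation, so that
  \<open>Ucls G N\<close> is a unital homomorphism.\<close>
definition Ucls :: "grp \<Rightarrow> nat \<Rightarrow> fa \<Rightarrow> uea" where
  "Ucls G N x = abs_uea (\<lambda>p. if p = (G, N) then x else fa_const (x []))"

lemma Ucls_rel: "fa_fin x \<Longrightarrow>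
    urel (\<lambda>p. if p = (G, N) then x else fa_const (x [])) (\<lambda>p. if p = (G, N) then x else fa_const (x []))"
  by (simp add: urel_def U_eq_refl)

lemma Ucls_eqD:
  assumes "fa_fin x" "fa_fin y" "Ucls G N x = Ucls G N y"
  shows "U_eq G N x y"
proof -
  have "urel (\<lambda>p. if p = (G, N) then x else fa_const (x [])) (\<lambda>p. if p = (G, N) then y else fa_const (y []))"
    using assms Quotient_rel[OF Quotient_uea] Ucls_rel unfolding Ucls_def by blast
  then show ?thesis unfolding urel_def by (elim allE[of _ G] allE[of _ N]) simp
qed

lemma Ucls_eqI:
  assumes "fa_fin x" "fa_fin y" "U_eq G N x y"
  shows "Ucls G N x = Ucls G N y"
proof -
  have "x [] = y []" using assms(3) Uideal_Nil unfolding U_eq_def by fastforce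
  then show ?thesis
    unfolding Ucls_def using assms Quotient_rel_abs[OF Quotient_uea] by (simp add: urel_def U_eq_refl)
qed

lemma Ucls_const: "Ucls G N (fa_const c) = uc c"
proof -
  have "uc c = abs_uea (\<lambda>_. fa_const c)" by (simp add: uc.abs_eq)
  then show ?thesis
    unfolding Ucls_def by (auto intro!: arg_cong[of _ _ abs_uea] simp: fa_const_def)
qed

lemma Ucls_add: "fa_fin x \<Longrightarrow> fa_fin y \<Longrightarrow> Ucls G N (\<lambda>w. x w + y w) = Ucls G N x + Ucls G N y"
  unfolding Ucls_def
  by (subst plus_uea.abs_eq) (auto intro!: arg_cong[of _ _ abs_uea] Ucls_rel simp: fa_const_add)

lemma Ucls_mult: "fa_fin x \<Longrightarrow> fa_fin y \<Longrightarrow> Ucls G N (fa_mult x y) = Ucls G N x * Ucls G N y"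
  unfolding Ucls_def
  by (subst times_uea.abs_eq)
     (auto intro!: arg_cong[of _ _ abs_uea] Ucls_rel simp: fa_mult_const fun_eq_iff)

lemma Ucls_zero [simp]: "Ucls G N (\<lambda>w. 0) = 0"
  using Ucls_const[of G N 0] by (simp add: fa_const_def)

lemma Ucls_scale: "fa_fin x \<Longrightarrow> Ucls G N (\<lambda>w. c * x w) = uc c * Ucls G N x"
  using Ucls_mult[of "fa_const c" x] by (simp add: Ucls_const fa_mult_const_left)

lemma Ucls_diff:
  assumes "fa_fin x" "fa_fin y"
  shows "Ucls G N (\<lambda>w. x w - y w) = Ucls G N x - Ucls G N y"
  using Ucls_add[of "\<lambda>w. x w - y w" y G N] assms by (simp add: eq_diff_eq)

lemma Ucls_sum: "(\<And>i. i \<in> A \<Longrightarrow> fa_fin (x i)) \<Longrightarrow> Ucls G N (\<lambda>w. \<Sum>i\<in>A. x i w) = (\<Sum>i\<in>A. Ucls G N (x i))"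
  by (induction A rule: infinite_finite_induct) (auto simp: Ucls_add)

lemma Ucls_Uideal: "x \<in> Uideal G N \<Longrightarrow> fa_fin x \<Longrightarrow> Ucls G N x = 0"
  using Ucls_eqI[of x "\<lambda>_. 0" G N] by (simp add: U_eq_def)

section \<open>The generators F_ij and their relations in U(g)\<close>

text \<open>The symmetry sign of the bilinear form: \<open>1\<close> in the orthogonal and
  \<open>-1\<close> in the symplectic case. It is also the scalar by which a transposition acts on
  \<open>Q\<close>.\<close>

definition kap :: "grp \<Rightarrow> complex" where
  "kap G = 2 * eta G"

lemma Iset_uminus [simp]: "- i \<in> Iset N \<longleftrightarrow> i \<in> Iset N"
  by (auto simp: Iset_def)

lemma kap_sq [simp]: "kap G * kap G = 1"
  by (simp add: kap_def eta_def)

lemma Iset_nonzero: "even N \<Longrightarrow> i \<in> Iset N \<Longrightarrow> i \<noteq> 0"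
  by (simp add: Iset_def)

lemma eps_comm: "eps G i j = eps G j i"
  by (simp add: eps_def mult.commute)

lemma eps_uminus:
  assumes "G = Sympl \<Longrightarrow> i \<noteq> 0"
  shows "eps G (- i) j = kap G * eps G i j" "eps G j (- i) = kap G * eps G j i"
  using assms by (cases G; auto simp: eps_def kap_def eta_def sgn_if)+

lemma eps_trans:
  assumes "G = Sympl \<Longrightarrow> j \<noteq> 0"
  shows "eps G i j * eps G j k = eps G i k"
  using assms by (auto simp: eps_def sgn_if)

lemma lincomb_add: "lincomb N (\<lambda>g. c g + d g) = (\<lambda>w. lincomb N c w + lincomb N d w)"
  by (simp add: lincomb_def sum.distrib distrib_right)

lemma lincomb_scale: "lincomb N (\<lambda>g. k * c g) = (\<lambda>w. k * lincomb N c w)"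
  by (simp add: lincomb_def sum_distrib_left mult.assoc)

lemma lincomb_delta:
  "h \<in> Iset N \<times> Iset N \<Longrightarrow> lincomb N (\<lambda>g. if g = h then 1 else 0) = fa_gen h"
  by (simp add: lincomb_def if_distrib[of "\<lambda>x. x * _"] cong: if_cong)

lemma gmat_of_add: "gmat_of G N (\<lambda>g. c g + d g) a b = gmat_of G N c a b + gmat_of G N d a b"
  by (simp add: gmat_of_def sum.distrib distrib_right)

lemma gmat_of_scale: "gmat_of G N (\<lambda>g. k * c g) a b = k * gmat_of G N c a b"
  by (simp add: gmat_of_def sum_distrib_left mult.assoc)

lemma gmat_of_delta:
  "h \<in> Iset N \<times> Iset N \<Longrightarrow> gmat_of G N (\<lambda>g. if g = h then 1 else 0) a b = Fmat G (fst h) (snd h) a b"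
  by (simp add: gmat_of_def if_distrib[of "\<lambda>x. x * _"] cong: if_cong)

definition Ugen :: "grp \<Rightarrow> nat \<Rightarrow> int \<Rightarrow> int \<Rightarrow> uea" where
  "Ugen G N i j = Ucls G N (fa_gen (i, j))"

text \<open>The matrix of F_ij + eps_ij F_{-j,-i} is zero, so this is an instance of the linear
  relations \<open>rel1\<close>.\<close>

lemma Ugen_flip:
  assumes G: "G = Sympl \<Longrightarrow> even N" and ij: "i \<in> Iset N" "j \<in> Iset N"
  shows "Ugen G N i j = - (uc (eps G i j) * Ugen G N (- j) (- i))"
proof -
  define c where "c = (\<lambda>g. (if g = (i, j) then 1 else 0) + eps G i j * (if g = (- j, - i) then 1 else 0))"
  have nz: "G = Sympl \<Longrightarrow> i \<noteq> 0" "G = Sympl \<Longrightarrow> j \<noteq> 0"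
    using G ij Iset_nonzero by blast+
  have "eps G i j * eps G (- j) (- i) = 1"
    using nz by (cases G) (auto simp: eps_def sgn_if)
  then have "gmat_of G N c a b = 0" for a b
    unfolding c_def using ij
    by (simp only: gmat_of_add gmat_of_scale gmat_of_delta mem_Sigma_iff Iset_uminus)
       (simp add: Fmat_def algebra_simps)
  then have "lincomb N c \<in> Uideal G N" by (simp add: Uideal.rel1)
  then have "Ucls G N (lincomb N c) = 0" by (rule Ucls_Uideal) simp
  moreover have "lincomb N c = (\<lambda>w. fa_gen (i, j) w + eps G i j * fa_gen (- j, - i) w)"
    unfolding c_def using ij by (simp only: lincomb_add lincomb_scale lincomb_delta mem_Sigma_iff Iset_uminus)
  ultimately show ?thesis
    by (simp add: Ugen_def Ucls_add Ucls_scale eq_neg_iff_add_eq_0)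
qed

text \<open>With the index conditions as \<open>of_bool\<close> factors, the bracket identity below
  is polynomial algebra and needs no case split over coinciding indices.\<close>

lemma Fmat_of_bool: "Fmat G i j a b = of_bool (a = i) * of_bool (b = j)
    - eps G i j * (of_bool (a = - j) * of_bool (b = - i))"
proof -
  have "(if P \<and> Q then 1 else 0) = of_bool P * (of_bool Q :: complex)" for P Q by simp
  then show ?thesis unfolding Fmat_def by presburger
qed

lemma if_of_bool: "(if P then x else 0) = of_bool P * (x :: complex)"
  by simp

text \<open>A row of \<open>Fmat\<close> has at most two nonzero entries, so the sum over the middle
  index collapses.\<close>

lemma gbracket_eq:
  assumes "i \<in> Iset N" "j \<in> Iset N" "k \<in> Iset N" "l \<in> Iset N"
  shows "gbracket G N (i, j) (k, l) a b =
    (if a = i then Fmat G k l j b else 0) - eps G i j * (if a = - j then Fmat G k l (- i) b else 0)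
    - ((if a = k then Fmat G i j l b else 0) - eps G k l * (if a = - l then Fmat G i j (- k) b else 0))"
proof -
  have *: "(\<Sum>d\<in>Iset N. Fmat G i j a d * h d)
      = (if a = i then h j else 0) - eps G i j * (if a = - j then h (- i) else 0)"
    if "i \<in> Iset N" "j \<in> Iset N" for i j and h :: "int \<Rightarrow> complex"
  proof -
    have "Fmat G i j a d * h d = (if d = j then if a = i then h j else 0 else 0)
      - eps G i j * (if d = - i then if a = - j then h (- i) else 0 else 0)" for d
      by (auto simp: Fmat_def algebra_simps)
    then show ?thesis
      using that by (simp add: sum_subtractf sum_distrib_left[symmetric])
  qed
  show ?thesis using assms by (simp add: gbracket_def sum_subtractf *)
qed

lemma Ugen_commutator:
  assumes G: "G = Sympl \<Longrightarrow> even N"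
    and I: "i \<in> Iset N" "j \<in> Iset N" "k \<in> Iset N" "l \<in> Iset N"
  shows "Ugen G N i j * Ugen G N k l - Ugen G N k l * Ugen G N i j =
    (if k = j then Ugen G N i l else 0) - (if i = l then Ugen G N k j else 0)
    - uc (eps G i j) * (if k = - i then Ugen G N (- j) l else 0)
    + uc (eps G i j) * (if l = - j then Ugen G N k (- i) else 0)"
proof -
  \<comment> \<open>The structure constants of the bracket [F_ij, F_kl], one for each of the four
    possible index coincidences.\<close>
  define c1 c2 c3 c4 :: complex where "c1 = (if k = j then 1 else 0)" and "c2 = (if i = l then -1 else 0)"
    and "c3 = (if k = - i then - eps G i j else 0)" and "c4 = (if l = - j then eps G i j else 0)"
  define c where "c = (\<lambda>g. ((c1 * (if g = (i, l) then 1 else 0) + c2 * (if g = (k, j) then 1 else 0))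
    + c3 * (if g = (- j, l) then 1 else 0)) + c4 * (if g = (k, - i) then 1 else 0))"
  have nz: "G = Sympl \<Longrightarrow> i \<noteq> 0" "G = Sympl \<Longrightarrow> j \<noteq> 0" "G = Sympl \<Longrightarrow> k \<noteq> 0" "G = Sympl \<Longrightarrow> l \<noteq> 0"
    using G I Iset_nonzero by blast+
  have gm: "gmat_of G N c a b = c1 * Fmat G i l a b + c2 * Fmat G k j a b
      + c3 * Fmat G (- j) l a b + c4 * Fmat G k (- i) a b" for a b
    unfolding c_def using I
    by (simp only: gmat_of_add gmat_of_scale gmat_of_delta mem_Sigma_iff Iset_uminus fst_conv snd_conv)
  have "gmat_of G N c a b = gbracket G N (i, j) (k, l) a b" for a b
  proof -
    have 1: "(if a = i then Fmat G k l j b else 0) = of_bool (j = k) * of_bool (a = i) * of_bool (b = l)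
       - eps G k l * of_bool (l = - j) * of_bool (a = i) * of_bool (b = - k)"
    proof -
      have *: "(j = - l) = (l = - j)" by auto
      show ?thesis unfolding if_of_bool Fmat_of_bool * by (simp only: algebra_simps)
    qed
    have 2: "eps G i j * (if a = - j then Fmat G k l (- i) b else 0)
       = eps G i j * of_bool (k = - i) * of_bool (a = - j) * of_bool (b = l)
       - eps G i j * eps G k l * of_bool (i = l) * of_bool (a = - j) * of_bool (b = - k)"
    proof -
      have *: "(- i = k) = (k = - i)" "(- i = - l) = (i = l)" by auto
      show ?thesis unfolding if_of_bool Fmat_of_bool * by (simp only: algebra_simps)
    qed
    have 3: "(if a = k then Fmat G i j l b else 0) = of_bool (i = l) * of_bool (a = k) * of_bool (b = j)
       - eps G i j * of_bool (l = - j) * of_bool (a = k) * of_bool (b = - i)"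
    proof -
      have *: "(l = i) = (i = l)" by auto
      show ?thesis unfolding if_of_bool Fmat_of_bool * by (simp only: algebra_simps)
    qed
    have 4: "eps G k l * (if a = - l then Fmat G i j (- k) b else 0)
       = eps G k l * of_bool (k = - i) * of_bool (a = - l) * of_bool (b = j)
       - eps G k l * eps G i j * of_bool (j = k) * of_bool (a = - l) * of_bool (b = - i)"
    proof -
      have *: "(- k = i) = (k = - i)" "(- k = - j) = (j = k)" by auto
      show ?thesis unfolding if_of_bool Fmat_of_bool * by (simp only: algebra_simps)
    qed
    \<comment> \<open>Both sides consist of eight matrix units. The four coming from the first
      halves of the \<open>Fmat\<close> agree directly; the other four carry products of signs,
      which merge by \<open>eps_trans\<close> under the respective index condition.\<close>
    have e1: "eps G k l * eps G i j * of_bool (j = k) = eps G i l * of_bool (j = k)"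
      using eps_trans[of G j i l] nz(2) by (cases "j = k") (simp_all add: mult.commute)
    have e2: "eps G i j * eps G k l * of_bool (i = l) = eps G k j * of_bool (i = l)"
      using eps_trans[of G i k j] nz(1) by (cases "i = l") (simp_all add: mult.commute)
    have e3: "eps G i j * eps G (- j) l * of_bool (k = - i) = eps G k l * of_bool (k = - i)"
    proof -
      have "eps G i j * eps G (- j) l = kap G * (eps G i j * eps G j l)" using nz by (simp add: eps_uminus)
      also have "\<dots> = eps G (- i) l" using nz by (simp add: eps_trans eps_uminus)
      finally show ?thesis by auto
    qed
    have e4: "eps G i j * eps G k (- i) * of_bool (l = - j) = eps G k l * of_bool (l = - j)"
    proof -
      have "eps G i j * eps G k (- i) = kap G * (eps G k i * eps G i j)" using nz by (simp add: eps_uminus)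
      also have "\<dots> = eps G k (- j)" using nz by (simp add: eps_trans eps_uminus)
      finally show ?thesis by auto
    qed
    have "c1 * Fmat G i l a b = of_bool (j = k) * of_bool (a = i) * of_bool (b = l)
       - (eps G i l * of_bool (j = k)) * of_bool (a = - l) * of_bool (b = - i)"
      by (simp add: c1_def Fmat_of_bool algebra_simps)
    moreover have "c2 * Fmat G k j a b = - (of_bool (i = l) * of_bool (a = k) * of_bool (b = j))
       + (eps G k j * of_bool (i = l)) * of_bool (a = - j) * of_bool (b = - k)"
      by (simp add: c2_def Fmat_of_bool algebra_simps)
    moreover have "c3 * Fmat G (- j) l a b = - (eps G i j * of_bool (k = - i) * of_bool (a = - j) * of_bool (b = l))
       + (eps G i j * eps G (- j) l * of_bool (k = - i)) * of_bool (a = - l) * of_bool (b = j)"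
      by (simp add: c3_def Fmat_of_bool algebra_simps)
    moreover have "c4 * Fmat G k (- i) a b = eps G i j * of_bool (l = - j) * of_bool (a = k) * of_bool (b = - i)
       - (eps G i j * eps G k (- i) * of_bool (l = - j)) * of_bool (a = i) * of_bool (b = - k)"
      by (simp add: c4_def Fmat_of_bool algebra_simps)
    ultimately show ?thesis
      unfolding gm gbracket_eq[OF I] 1 2 3 4 e1 e2 e3 e4 by simp
  qed
  then have "(\<lambda>w. fa_mult (fa_gen (i, j)) (fa_gen (k, l)) w - fa_mult (fa_gen (k, l)) (fa_gen (i, j)) w
      - lincomb N c w) \<in> Uideal G N"
    using I by (intro Uideal.rel2) auto
  from Ucls_Uideal[OF this]
  have "Ugen G N i j * Ugen G N k l - Ugen G N k l * Ugen G N i j = Ucls G N (lincomb N c)"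
    by (simp add: Ugen_def Ucls_diff Ucls_mult)
  also have "lincomb N c = (\<lambda>w. c1 * fa_gen (i, l) w + c2 * fa_gen (k, j) w
      + c3 * fa_gen (- j, l) w + c4 * fa_gen (k, - i) w)"
    unfolding c_def using I
    by (simp only: lincomb_add lincomb_scale lincomb_delta mem_Sigma_iff Iset_uminus)
  also have "Ucls G N \<dots> = uc c1 * Ugen G N i l + uc c2 * Ugen G N k j
      + uc c3 * Ugen G N (- j) l + uc c4 * Ugen G N k (- i)"
    by (simp add: Ucls_add Ucls_scale Ugen_def)
  also have "\<dots> = (if k = j then Ugen G N i l else 0) - (if i = l then Ugen G N k j else 0)
    - uc (eps G i j) * (if k = - i then Ugen G N (- j) l else 0)
    + uc (eps G i j) * (if l = - j then Ugen G N k (- i) else 0)"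
    by (simp add: c1_def c2_def c3_def c4_def uc_minus)
  finally show ?thesis .
qed

section \<open>Operators on tensor space\<close>

text \<open>Only linearity over complex constants is imposed, because matrix entries act by left
  multiplication in a noncommutative ring. Composition then models the product of End tensor U(g),
  and the ring laws hold in a type that depends on neither \<open>N\<close> nor
  \<open>n\<close>.\<close>

typedef oper = "{f :: ((nat \<Rightarrow> int) \<Rightarrow> uea) \<Rightarrow> (nat \<Rightarrow> int) \<Rightarrow> uea.
    (\<forall>v w. f (\<lambda>a. v a + w a) = (\<lambda>a. f v a + f w a)) \<and> (\<forall>c v. f (\<lambda>a. uc c * v a) = (\<lambda>a. uc c * f v a))}"
  morphisms app Oper
  by (rule exI[of _ "\<lambda>v. v"]) simp

setup_lifting type_definition_oper

lemma app_scale: "app A (\<lambda>a. uc c * v a) = (\<lambda>a. uc c * app A v a)"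
  using app[of A] by blast

lemma oper_eqI: "(\<And>v a. app A v a = app B v a) \<Longrightarrow> A = B"
  by (metis app_inject ext)

instantiation oper :: ring_1
begin

lift_definition zero_oper :: oper is "\<lambda>v a. 0" by simp
lift_definition one_oper :: oper is "\<lambda>v. v" by simp
lift_definition plus_oper :: "oper \<Rightarrow> oper \<Rightarrow> oper" is "\<lambda>f g v a. f v a + g v a"
  by (simp add: algebra_simps)
lift_definition uminus_oper :: "oper \<Rightarrow> oper" is "\<lambda>f v a. - f v a"
  by (simp add: algebra_simps)
lift_definition minus_oper :: "oper \<Rightarrow> oper \<Rightarrow> oper" is "\<lambda>f g v a. f v a - g v a"
  by (simp add: algebra_simps)
lift_definition times_oper :: "oper \<Rightarrow> oper \<Rightarrow> oper" is "\<lambda>f g v. f (g v)"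
  by simp

instance
proof
  show "(0::oper) \<noteq> 1"
    by transfer (auto simp: fun_eq_iff intro!: exI[of _ "\<lambda>_. 1"])
qed (transfer; auto simp: fun_eq_iff algebra_simps)+

end

lemma app_zero [simp]: "app 0 v a = 0" by (simp add: zero_oper.rep_eq)
lemma app_one [simp]: "app 1 v = v" by (simp add: one_oper.rep_eq)
lemma app_plus [simp]: "app (A + B) v a = app A v a + app B v a" by (simp add: plus_oper.rep_eq)
lemma app_uminus [simp]: "app (- A) v a = - app A v a" by (simp add: uminus_oper.rep_eq)
lemma app_minus [simp]: "app (A - B) v a = app A v a - app B v a" by (simp add: minus_oper.rep_eq)
lemma app_times [simp]: "app (A * B) v = app A (app B v)" by (simp add: times_oper.rep_eq)

lemma app_sum: "app (\<Sum>i\<in>S. A i) v a = (\<Sum>i\<in>S. app (A i) v a)"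
  by (induction S rule: infinite_finite_induct) auto

lift_definition sc :: "complex \<Rightarrow> oper" is "\<lambda>c v a. uc c * v a"
  by (auto simp: distrib_left mult.assoc[symmetric] uc_mult[symmetric] mult.commute)

lemma app_sc [simp]: "app (sc c) v a = uc c * v a" by (simp add: sc.rep_eq)

lemma sc_add: "sc (a + b) = sc a + sc b"
  by (rule oper_eqI) (simp add: uc_add distrib_right)
lemma sc_mult: "sc (a * b) = sc a * sc b"
  by (rule oper_eqI) (simp add: uc_mult mult.assoc)
lemma sc_0 [simp]: "sc 0 = 0" by (rule oper_eqI) simp
lemma sc_1 [simp]: "sc 1 = 1" by (rule oper_eqI) simp
lemma sc_minus: "sc (- a) = - sc a" by (rule oper_eqI) (simp add: uc_minus)
lemma sc_diff: "sc (a - b) = sc a - sc b" using sc_add[of a "-b"] by (simp add: sc_minus)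

lemma sc_comm: "A * sc c = sc c * A"
proof (rule oper_eqI)
  fix v a
  have "app (sc c) v = (\<lambda>a. uc c * v a)" by auto
  then show "app (A * sc c) v a = app (sc c * A) v a" by (simp add: app_scale)
qed

text \<open>Multi-indices as functions with default value 0 off \<open>{1..n}\<close>: replacing one
  tensor index is a function update, and permuting the factors is composition.\<close>

definition Adx :: "nat \<Rightarrow> nat \<Rightarrow> (nat \<Rightarrow> int) set" where
  "Adx N n = {a. (\<forall>p\<in>{1..n}. a p \<in> Iset N) \<and> (\<forall>p. p \<notin> {1..n} \<longrightarrow> a p = 0)}"

lemma Adx_Iset: "a \<in> Adx N n \<Longrightarrow> p \<in> {1..n} \<Longrightarrow> a p \<in> Iset N"
  by (simp add: Adx_def)

lemma Adx_upd: "a \<in> Adx N n \<Longrightarrow> p \<in> {1..n} \<Longrightarrow> b \<in> Iset N \<Longrightarrow> a(p := b) \<in> Adx N n"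
  by (auto simp: Adx_def)

lemma Adx_perm:
  assumes "\<sigma> permutes {1..n}"
  shows "a \<circ> \<sigma> \<in> Adx N n \<longleftrightarrow> a \<in> Adx N n"
proof -
  have *: "a \<circ> \<tau> \<in> Adx N n" if "\<tau> permutes {1..n}" "a \<in> Adx N n" for \<tau> a
    using that by (auto simp: Adx_def permutes_in_image simp del: atLeastAtMost_iff)
  have "a = a \<circ> \<sigma> \<circ> inv \<sigma>" using permutes_inv_o(1)[OF assms] by (simp add: comp_assoc)
  then show ?thesis using * assms permutes_inv[OF assms] by metis
qed

declare Adx_upd [simp]

text \<open>Not cut down to \<open>Adx N n\<close>, so that \<open>Pm id\<close> is the unit of the
  ring; \<open>fm\<close> and \<open>Qm\<close> below vanish off \<open>Adx N n\<close> instead, and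
  \<open>Adx_perm\<close> makes the two conventions compatible.\<close>

lift_definition Pm :: "(nat \<Rightarrow> nat) \<Rightarrow> oper" is "\<lambda>\<sigma> v a. v (a \<circ> \<sigma>)" by simp

text \<open>The index order in \<open>Ugen G N b (a p)\<close> is that of the sum of E_ij tensor
  F_ji: the entry in row a and column b is F_ba.\<close>

lift_definition fm :: "grp \<Rightarrow> nat \<Rightarrow> nat \<Rightarrow> nat \<Rightarrow> oper" is
  "\<lambda>G N n p v a. if a \<in> Adx N n then \<Sum>b\<in>Iset N. Ugen G N b (a p) * v (a(p := b)) else 0"
  by (auto simp: fun_eq_iff distrib_left sum.distrib sum_distrib_left mult.assoc[symmetric] uc_comm)

lift_definition Qm :: "grp \<Rightarrow> nat \<Rightarrow> nat \<Rightarrow> nat \<Rightarrow> nat \<Rightarrow> oper" is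
  "\<lambda>G N n p q v a. if a \<in> Adx N n \<and> a q = - a p
     then \<Sum>b\<in>Iset N. uc (eps G (a p) b) * v (a(p := b, q := - b)) else 0"
  by (auto simp: fun_eq_iff distrib_left sum.distrib sum_distrib_left mult.assoc[symmetric] uc_mult[symmetric] mult.commute)

lemma app_Pm [simp]: "app (Pm \<sigma>) v a = v (a \<circ> \<sigma>)" by (simp add: Pm.rep_eq)

lemma Pm_mult: "Pm \<sigma> * Pm \<tau> = Pm (\<sigma> \<circ> \<tau>)"
  by (rule oper_eqI) (simp add: comp_assoc)

lemma Pm_id [simp]: "Pm id = 1" by (rule oper_eqI) simp

lemma sum_Iset_uminus: "(\<Sum>b\<in>Iset N. h (- b)) = (\<Sum>b\<in>Iset N. h b)"
  by (rule sum.reindex_bij_witness[of _ uminus uminus]) auto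

section \<open>Relations between F, Q and the permutation operators\<close>

locale tensor_space =
  fixes G :: grp and N n :: nat
  assumes even_N: "G = Sympl \<Longrightarrow> even N"
begin

abbreviation F :: "nat \<Rightarrow> oper" where "F \<equiv> fm G N n"
abbreviation Q :: "nat \<Rightarrow> nat \<Rightarrow> oper" where "Q \<equiv> Qm G N n"

lemma app_F: "a \<in> Adx N n \<Longrightarrow> app (F p) v a = (\<Sum>b\<in>Iset N. Ugen G N b (a p) * v (a(p := b)))"
  "a \<notin> Adx N n \<Longrightarrow> app (F p) v a = 0"
  by (simp_all add: fm.rep_eq)

lemma app_Q: "a \<in> Adx N n \<Longrightarrow> app (Q p q) v a =
    (if a q = - a p then \<Sum>b\<in>Iset N. uc (eps G (a p) b) * v (a(p := b, q := - b)) else 0)"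
  "a \<notin> Adx N n \<Longrightarrow> app (Q p q) v a = 0"
  by (simp_all add: Qm.rep_eq)

lemma oper_eqI_Adx:
  assumes "\<And>v a. a \<in> Adx N n \<Longrightarrow> app A v a = app B v a" "\<And>v a. a \<notin> Adx N n \<Longrightarrow> app A v a = app B v a"
  shows "A = B"
  using assms by (intro oper_eqI) blast

lemma Iset_nz: "b \<in> Iset N \<Longrightarrow> G = Sympl \<Longrightarrow> b \<noteq> 0"
  using even_N Iset_nonzero by blast

lemma P_F:
  assumes "\<sigma> permutes {1..n}"
  shows "Pm \<sigma> * F p = F (\<sigma> p) * Pm \<sigma>"
proof (rule oper_eqI_Adx)
  fix v a assume a: "a \<in> Adx N n"
  have "a(\<sigma> p := b) \<circ> \<sigma> = (a \<circ> \<sigma>)(p := b)" for b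
    using permutes_inj[OF assms] by (auto simp: fun_eq_iff inj_eq)
  then show "app (Pm \<sigma> * F p) v a = app (F (\<sigma> p) * Pm \<sigma>) v a"
    using a by (simp add: app_F Adx_perm[OF assms])
qed (simp add: app_F Adx_perm[OF assms])

lemma P_Q:
  assumes "\<sigma> permutes {1..n}"
  shows "Pm \<sigma> * Q p q = Q (\<sigma> p) (\<sigma> q) * Pm \<sigma>"
proof (rule oper_eqI_Adx)
  fix v a assume a: "a \<in> Adx N n"
  have "a(\<sigma> p := b, \<sigma> q := - b) \<circ> \<sigma> = (a \<circ> \<sigma>)(p := b, q := - b)" for b
    using permutes_inj[OF assms] by (auto simp: fun_eq_iff inj_eq)
  then show "app (Pm \<sigma> * Q p q) v a = app (Q (\<sigma> p) (\<sigma> q) * Pm \<sigma>) v a"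
    using a by (simp add: app_Q Adx_perm[OF assms])
qed (simp add: app_Q Adx_perm[OF assms])

lemma Q_sym:
  assumes "p \<in> {1..n}" "q \<in> {1..n}" "p \<noteq> q"
  shows "Q q p = Q p q"
proof (rule oper_eqI_Adx)
  fix v a assume a: "a \<in> Adx N n"
  have "(\<Sum>b\<in>Iset N. uc (eps G (a q) b) * v (a(q := b, p := - b)))
      = (\<Sum>b\<in>Iset N. uc (eps G (a p) b) * v (a(p := b, q := - b)))" if "a q = - a p"
  proof -
    have "(\<Sum>b\<in>Iset N. uc (eps G (a q) b) * v (a(q := b, p := - b)))
        = (\<Sum>b\<in>Iset N. uc (eps G (a q) (- b)) * v (a(q := - b, p := b)))"
      using sum_Iset_uminus[of "\<lambda>b. uc (eps G (a q) b) * v (a(q := b, p := - b))" N] by simp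
    also have "\<dots> = (\<Sum>b\<in>Iset N. uc (eps G (a p) b) * v (a(p := b, q := - b)))"
    proof (rule sum.cong[OF refl])
      fix b assume b: "b \<in> Iset N"
      have "eps G (- a p) (- b) = kap G * (kap G * eps G (a p) b)"
        using Adx_Iset[OF a, of p] assms b by (simp add: eps_uminus Iset_nz)
      also have "\<dots> = eps G (a p) b" by (simp only: mult.assoc[symmetric] kap_sq mult_1)
      finally show "uc (eps G (a q) (- b)) * v (a(q := - b, p := b)) = uc (eps G (a p) b) * v (a(p := b, q := - b))"
        using assms by (simp add: that fun_upd_twist)
    qed
    finally show ?thesis .
  qed
  then show "app (Q q p) v a = app (Q p q) v a"
    using a by (simp add: app_Q equation_minus_iff[of "a p" "a q"])
qed (simp add: app_Q)

lemma transpose_permutes: "p \<in> {1..n} \<Longrightarrow> q \<in> {1..n} \<Longrightarrow> transpose p q permutes {1..n}"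
  by (simp add: permutes_swap_id)

text \<open>Swapping the two contracted factors negates the summation index, which costs one sign
  \<open>kap G\<close>. In \<open>Q_sym\<close> the row index is negated as well, and the two signs
  cancel.\<close>

lemma Q_P:
  assumes "p \<in> {1..n}" "q \<in> {1..n}" "p \<noteq> q"
  shows "Q p q * Pm (transpose p q) = sc (kap G) * Q p q"
proof (rule oper_eqI_Adx)
  fix v a assume a: "a \<in> Adx N n"
  have "(\<Sum>b\<in>Iset N. uc (eps G (a p) b) * v (a(p := b, q := - b) \<circ> transpose p q))
      = (\<Sum>b\<in>Iset N. uc (eps G (a p) (- b)) * v (a(p := - b, q := b) \<circ> transpose p q))"
    using sum_Iset_uminus[of "\<lambda>b. uc (eps G (a p) b) * v (a(p := b, q := - b) \<circ> transpose p q)" N] by simp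
  also have "\<dots> = (\<Sum>b\<in>Iset N. uc (kap G) * (uc (eps G (a p) b) * v (a(p := b, q := - b))))"
  proof (rule sum.cong[OF refl])
    fix b assume b: "b \<in> Iset N"
    have "a(p := - b, q := b) \<circ> transpose p q = a(p := b, q := - b)"
      using assms by (auto simp: fun_eq_iff transpose_def)
    then show "uc (eps G (a p) (- b)) * v (a(p := - b, q := b) \<circ> transpose p q)
        = uc (kap G) * (uc (eps G (a p) b) * v (a(p := b, q := - b)))"
      using Adx_Iset[OF a, of p] assms b by (simp add: eps_uminus Iset_nz uc_mult mult.assoc)
  qed
  finally show "app (Q p q * Pm (transpose p q)) v a = app (sc (kap G) * Q p q) v a"
    using a by (simp add: app_Q sum_distrib_left)
qed (simp add: app_Q)

lemma P_Q_same:
  assumes "p \<in> {1..n}" "q \<in> {1..n}" "p \<noteq> q"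
  shows "Pm (transpose p q) * Q p q = sc (kap G) * Q p q"
  using P_Q[OF transpose_permutes[OF assms(1,2)], of p q] Q_P[OF assms] Q_sym[OF assms] by simp

lemma app_Fq_Q:
  assumes "p \<in> {1..n}" "q \<in> {1..n}" "p \<noteq> q" "a \<in> Adx N n"
  shows "app (F q * Q p q) v a = (\<Sum>c\<in>Iset N. uc (eps G (a p) c) * (Ugen G N (- a p) (a q) * v (a(p := c, q := - c))))"
proof -
  have "app (F q * Q p q) v a = (\<Sum>b\<in>Iset N. if b = - a p then
     Ugen G N (- a p) (a q) * (\<Sum>c\<in>Iset N. uc (eps G (a p) c) * v (a(p := c, q := - c))) else 0)"
    unfolding app_times app_F(1)[OF assms(4)]
    by (rule sum.cong[OF refl]) (use assms in \<open>auto simp: app_Q fun_upd_twist[of q p]\<close>)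
  also have "\<dots> = Ugen G N (- a p) (a q) * (\<Sum>c\<in>Iset N. uc (eps G (a p) c) * v (a(p := c, q := - c)))"
    using assms Adx_Iset[of a N n p] by simp
  finally show ?thesis by (simp add: sum_distrib_left mult.assoc[symmetric] uc_comm)
qed

lemma app_Fp_Q:
  assumes "p \<in> {1..n}" "q \<in> {1..n}" "p \<noteq> q" "a \<in> Adx N n"
  shows "app (F p * Q p q) v a = (\<Sum>c\<in>Iset N. uc (eps G (- a q) c) * (Ugen G N (- a q) (a p) * v (a(p := c, q := - c))))"
proof -
  have "app (F p * Q p q) v a = (\<Sum>b\<in>Iset N. if b = - a q then
     Ugen G N (- a q) (a p) * (\<Sum>c\<in>Iset N. uc (eps G (- a q) c) * v (a(p := c, q := - c))) else 0)"
    unfolding app_times app_F(1)[OF assms(4)]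
    by (rule sum.cong[OF refl]) (use assms in \<open>auto simp: app_Q equation_minus_iff[of "a q"]\<close>)
  also have "\<dots> = Ugen G N (- a q) (a p) * (\<Sum>c\<in>Iset N. uc (eps G (- a q) c) * v (a(p := c, q := - c)))"
    using assms Adx_Iset[of a N n q] by simp
  finally show ?thesis by (simp add: sum_distrib_left mult.assoc[symmetric] uc_comm)
qed

text \<open>Tensor form of \<open>Ugen_flip\<close>: \<open>Q\<close> is the contraction with the
  invariant form, and through it F passes to the other factor as minus itself. \<open>Q_F\<close> is
  the mirror image.\<close>

lemma F_Q:
  assumes "p \<in> {1..n}" "q \<in> {1..n}" "p \<noteq> q"
  shows "F q * Q p q = - (F p * Q p q)"
proof (rule oper_eqI_Adx)
  fix v a assume a: "a \<in> Adx N n"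
  have ap: "a p \<in> Iset N" "a q \<in> Iset N" using Adx_Iset[OF a] assms by blast+
  have "uc (eps G (a p) c) * (Ugen G N (- a p) (a q) * x)
      = - (uc (eps G (- a q) c) * (Ugen G N (- a q) (a p) * x))" for c x
  proof -
    have "Ugen G N (- a q) (a p) = - (uc (eps G (- a q) (a p)) * Ugen G N (- a p) (a q))"
      using Ugen_flip[of G N "- a q" "a p"] even_N ap by simp
    moreover have "eps G (- a q) c * eps G (- a q) (a p) = eps G (a p) c"
      using eps_trans[of G "- a q" "a p" c] ap Iset_nz by (simp add: eps_comm mult.commute)
    ultimately show ?thesis by (simp add: mult.assoc[symmetric] uc_mult[symmetric])
  qed
  then show "app (F q * Q p q) v a = app (- (F p * Q p q)) v a"
    unfolding app_uminus app_Fp_Q[OF assms a] app_Fq_Q[OF assms a] sum_negf[symmetric] by simp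
qed (simp add: app_F)

lemma app_Q_Fq:
  assumes "p \<in> {1..n}" "q \<in> {1..n}" "p \<noteq> q" "a \<in> Adx N n"
  shows "app (Q p q * F q) v a = (if a q = - a p then
    \<Sum>b\<in>Iset N. \<Sum>c\<in>Iset N. uc (eps G (a p) b) * (Ugen G N c (- b) * v (a(p := b, q := c))) else 0)"
  using assms by (auto simp: app_F app_Q sum_distrib_left intro!: sum.cong)

lemma app_Q_Fp:
  assumes "p \<in> {1..n}" "q \<in> {1..n}" "p \<noteq> q" "a \<in> Adx N n"
  shows "app (Q p q * F p) v a = (if a q = - a p then
    \<Sum>b\<in>Iset N. \<Sum>c\<in>Iset N. uc (eps G (a p) b) * (Ugen G N c b * v (a(p := c, q := - b))) else 0)"
  using assms by (auto simp: app_F app_Q sum_distrib_left fun_upd_twist[of q p] intro!: sum.cong)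

lemma Q_F:
  assumes "p \<in> {1..n}" "q \<in> {1..n}" "p \<noteq> q"
  shows "Q p q * F q = - (Q p q * F p)"
proof (rule oper_eqI_Adx)
  fix v a assume a: "a \<in> Adx N n"
  have ap: "a p \<in> Iset N" using Adx_Iset[OF a] assms by blast
  have *: "uc (eps G (a p) b) * (Ugen G N c (- b) * x) = - (uc (eps G (a p) (- c)) * (Ugen G N b (- c) * x))"
    if "b \<in> Iset N" "c \<in> Iset N" for b c x
  proof -
    have "Ugen G N c (- b) = - (uc (eps G c (- b)) * Ugen G N b (- c))"
      using Ugen_flip[of G N c "- b"] even_N that by simp
    moreover have "eps G (a p) b * eps G c (- b) = eps G (a p) (- c)"
      using eps_trans[of G b "a p" c] that Iset_nz by (simp add: eps_uminus eps_comm[of G c b])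
    ultimately show ?thesis by (simp add: mult.assoc[symmetric] uc_mult[symmetric])
  qed
  have "(\<Sum>b\<in>Iset N. \<Sum>c\<in>Iset N. uc (eps G (a p) b) * (Ugen G N c (- b) * v (a(p := b, q := c))))
    = - (\<Sum>b\<in>Iset N. \<Sum>c\<in>Iset N. uc (eps G (a p) (- c)) * (Ugen G N b (- c) * v (a(p := b, q := c))))"
    by (simp add: * sum_negf[symmetric])
  also have "\<dots> = - (\<Sum>c\<in>Iset N. \<Sum>b\<in>Iset N. uc (eps G (a p) (- c)) * (Ugen G N b (- c) * v (a(p := b, q := - (- c)))))"
    using sum.swap by simp
  also have "\<dots> = - (\<Sum>c\<in>Iset N. \<Sum>b\<in>Iset N. uc (eps G (a p) c) * (Ugen G N b c * v (a(p := b, q := - c))))"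
    using sum_Iset_uminus[of "\<lambda>c. \<Sum>b\<in>Iset N. uc (eps G (a p) c) * (Ugen G N b c * v (a(p := b, q := - c)))" N]
    by simp
  finally show "app (Q p q * F q) v a = app (- (Q p q * F p)) v a"
    unfolding app_uminus app_Q_Fp[OF assms a] app_Q_Fq[OF assms a] by simp
qed (simp add: app_Q)

text \<open>The four terms of \<open>Ugen_commutator\<close> become, in order, P F_p, F_p P, F_q Q
  and Q F_q; the last two are then rewritten in terms of F_p by \<open>F_Q\<close> and
  \<open>Q_F\<close>.\<close>

lemma F_commutator:
  assumes "p \<in> {1..n}" "q \<in> {1..n}" "p \<noteq> q"
  shows "F p * F q - F q * F p = Pm (transpose p q) * F p - F p * Pm (transpose p q) + F p * Q p q - Q p q * F p"
proof -
  have "F p * F q - F q * F p = Pm (transpose p q) * F p - F p * Pm (transpose p q) - F q * Q p q + Q p q * F q"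
  proof (rule oper_eqI_Adx)
    fix v :: "(nat \<Rightarrow> int) \<Rightarrow> uea" and a assume a: "a \<in> Adx N n"
    let ?v = "\<lambda>b c. v (a(p := b, q := c))"
    have ap: "a p \<in> Iset N" "a q \<in> Iset N" using Adx_Iset[OF a] assms by blast+
    have "app (F p * F q) v a = (\<Sum>b\<in>Iset N. \<Sum>c\<in>Iset N. Ugen G N b (a p) * Ugen G N c (a q) * ?v b c)"
      using assms a by (simp add: app_F sum_distrib_left mult.assoc)
    moreover have "app (F q * F p) v a = (\<Sum>b\<in>Iset N. \<Sum>c\<in>Iset N. Ugen G N c (a q) * Ugen G N b (a p) * ?v b c)"
      using assms a by (subst sum.swap) (simp add: app_F sum_distrib_left mult.assoc fun_upd_twist[of q p])
    ultimately have "app (F p * F q - F q * F p) v a = (\<Sum>b\<in>Iset N. \<Sum>c\<in>Iset N.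
        (Ugen G N b (a p) * Ugen G N c (a q) - Ugen G N c (a q) * Ugen G N b (a p)) * ?v b c)"
      by (simp add: sum_subtractf left_diff_distrib)
    also have "\<dots> = (\<Sum>b\<in>Iset N. \<Sum>c\<in>Iset N.
        (if c = a p then Ugen G N b (a q) * ?v b c else 0) - (if b = a q then Ugen G N c (a p) * ?v b c else 0)
        - (if c = - b then uc (eps G b (a p)) * (Ugen G N (- a p) (a q) * ?v b c) else 0)
        + (if a q = - a p then uc (eps G b (a p)) * (Ugen G N c (- b) * ?v b c) else 0))"
      using ap by (intro sum.cong refl) (simp add: Ugen_commutator[OF even_N] algebra_simps)
    also have "\<dots> = (\<Sum>b\<in>Iset N. Ugen G N b (a q) * ?v b (a p)) - (\<Sum>c\<in>Iset N. Ugen G N c (a p) * ?v (a q) c)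
       - (\<Sum>b\<in>Iset N. uc (eps G (a p) b) * (Ugen G N (- a p) (a q) * ?v b (- b)))
       + (if a q = - a p then \<Sum>b\<in>Iset N. \<Sum>c\<in>Iset N. uc (eps G (a p) b) * (Ugen G N c (- b) * ?v b c) else 0)"
    proof -
      have "(\<Sum>b\<in>Iset N. \<Sum>c\<in>Iset N. if b = a q then Ugen G N c (a p) * ?v b c else 0)
          = (\<Sum>c\<in>Iset N. Ugen G N c (a p) * ?v (a q) c)"
        using ap by (subst sum.swap) simp
      then show ?thesis
        using ap by (simp add: sum.distrib sum_subtractf eps_comm[of G _ "a p"])
    qed
    also have "(\<Sum>b\<in>Iset N. Ugen G N b (a q) * ?v b (a p)) = app (Pm (transpose p q) * F p) v a"
    proof -
      have "(a \<circ> transpose p q)(p := b) = a(p := b, q := a p)" for b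
        using assms by (auto simp: fun_eq_iff transpose_def)
      then show ?thesis using a by (simp add: app_F Adx_perm[OF transpose_permutes[OF assms(1,2)]])
    qed
    also have "(\<Sum>c\<in>Iset N. Ugen G N c (a p) * ?v (a q) c) = app (F p * Pm (transpose p q)) v a"
    proof -
      have "a(p := c) \<circ> transpose p q = a(p := a q, q := c)" for c
        using assms by (auto simp: fun_eq_iff transpose_def)
      then show ?thesis using a by (simp add: app_F)
    qed
    finally show "app (F p * F q - F q * F p) v a
      = app (Pm (transpose p q) * F p - F p * Pm (transpose p q) - F q * Q p q + Q p q * F q) v a"
      unfolding app_plus app_minus app_Fq_Q[OF assms a] app_Q_Fq[OF assms a] .
  qed (use assms in \<open>simp add: app_F app_Q Adx_perm[OF transpose_permutes[OF assms(1,2)]]\<close>)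
  then show ?thesis by (simp add: F_Q[OF assms] Q_F[OF assms])
qed

text \<open>A product of Brauer diagrams: two contractions sharing the factor q join into one arc,
  and the index left over at r is handed to p.\<close>

lemma Q_Q:
  assumes "p \<in> {1..n}" "q \<in> {1..n}" "r \<in> {1..n}" "p \<noteq> q" "r \<noteq> q" "p \<noteq> r"
  shows "Q r q * Q p q = Pm (transpose r p) * Q p q"
proof (rule oper_eqI_Adx)
  fix v :: "(nat \<Rightarrow> int) \<Rightarrow> uea" and a assume a: "a \<in> Adx N n"
  have ap: "a p \<in> Iset N" using Adx_Iset[OF a] assms by blast
  let ?w = "\<lambda>c. v (a(r := a p, p := c, q := - c))"
  have "app (Q r q * Q p q) v a = (if a q = - a r then \<Sum>b\<in>Iset N. if b = a p then
      uc (eps G (a r) (a p)) * (\<Sum>c\<in>Iset N. uc (eps G (a p) c) * ?w c) else 0 else 0)"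
  proof -
    have "uc (eps G (a r) b) * app (Q p q) v (a(r := b, q := - b))
        = (if b = a p then uc (eps G (a r) (a p)) * (\<Sum>c\<in>Iset N. uc (eps G (a p) c) * ?w c) else 0)"
      if "b \<in> Iset N" for b
      using assms a that by (auto simp: app_Q fun_upd_twist[of q p])
    then show ?thesis by (simp add: app_Q(1)[OF a] cong: sum.cong)
  qed
  also have "\<dots> = (if a q = - a r then \<Sum>c\<in>Iset N. uc (eps G (a r) c) * ?w c else 0)"
    using ap Iset_nz[OF ap]
    by (auto simp: sum_distrib_left mult.assoc[symmetric] uc_mult[symmetric] eps_trans)
  also have "\<dots> = app (Pm (transpose r p) * Q p q) v a"
  proof -
    have "(a \<circ> transpose r p)(p := c, q := - c) = a(r := a p, p := c, q := - c)" for c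
      using assms by (auto simp: fun_eq_iff transpose_def)
    moreover have "(a \<circ> transpose r p) q = a q" using assms by (simp add: transpose_def)
    ultimately show ?thesis using a assms by (simp add: app_Q Adx_perm[OF transpose_permutes[OF assms(3,1)]])
  qed
  finally show "app (Q r q * Q p q) v a = app (Pm (transpose r p) * Q p q) v a" .
qed (use assms in \<open>simp add: app_Q Adx_perm[OF transpose_permutes[OF assms(3,1)]]\<close>)

lemma Q_Q_comm:
  assumes "{p, q, r, s} \<subseteq> {1..n}" "{p, q} \<inter> {r, s} = {}" "p \<noteq> q" "r \<noteq> s"
  shows "Q p q * Q r s = Q r s * Q p q"
proof (rule oper_eqI_Adx)
  fix v :: "(nat \<Rightarrow> int) \<Rightarrow> uea" and a assume a: "a \<in> Adx N n"
  have tw: "a(p := b, q := - b, r := c, s := - c) = a(r := c, s := - c, p := b, q := - b)" for b c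
    using assms by (auto simp: fun_eq_iff)
  show "app (Q p q * Q r s) v a = app (Q r s * Q p q) v a"
    using assms a
    by (auto simp: app_Q sum_distrib_left tw mult.assoc[symmetric] uc_mult[symmetric] mult.commute
        intro: sum.swap)
qed (simp add: app_Q)

lemma Q_F_comm:
  assumes "{p, q, r} \<subseteq> {1..n}" "r \<notin> {p, q}" "p \<noteq> q"
  shows "Q p q * F r = F r * Q p q"
proof (rule oper_eqI_Adx)
  fix v :: "(nat \<Rightarrow> int) \<Rightarrow> uea" and a assume a: "a \<in> Adx N n"
  have tw: "a(p := b, q := - b, r := c) = a(r := c, p := b, q := - b)" for b c
    using assms by (auto simp: fun_eq_iff)
  show "app (Q p q * F r) v a = app (F r * Q p q) v a"
    using assms a
    by (auto simp: app_Q app_F sum_distrib_left tw mult.assoc[symmetric] uc_comm intro: sum.swap)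
qed (simp add: app_Q app_F)

end

section \<open>Exchange identities\<close>

lemma assoc_rule: "A * B = C \<Longrightarrow> A * (B * w) = C * (w :: 'a::semigroup_mult)"
  by (simp add: mult.assoc[symmetric])

text \<open>Formal counterpart of \<open>F_exchange\<close> for the scalar factors: the commutator
  of \<open>J1\<close> and \<open>J2\<close> is just what makes the parameters change
  places.\<close>

lemma J_exchange:
  fixes s J1 J2 :: "'a::ring_1"
  assumes central: "\<And>z. z * \<alpha> = \<alpha> * z" "\<And>z. z * \<beta> = \<beta> * z"
    and rel: "s * J1 = J2 * s" "s * J2 = J1 * s" "s * s = 1" "J2 * J1 = J1 * J2 - J1 * s + J2 * s"
  shows "(\<alpha> + J1) * (\<beta> + J2) * ((\<beta> - \<alpha>) * s - 1) = ((\<beta> - \<alpha>) * s - 1) * ((\<beta> + J1) * (\<alpha> + J2))"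
proof -
  have c: "z * (\<alpha> * w) = \<alpha> * (z * w)" "z * (\<beta> * w) = \<beta> * (z * w)" for z w
    using central by (metis mult.assoc)+
  \<comment> \<open>Unrestricted centrality would loop on \<open>\<alpha> * \<beta>\<close>; these
    instances move the constants to the left in one fixed order.\<close>
  note cs = central(1)[of s] central(2)[of s] central(1)[of J1] central(2)[of J1] central(1)[of J2] central(2)[of J2]
    central(1)[of \<beta>] c(1)[of s] c(2)[of s] c(1)[of J1] c(2)[of J1] c(1)[of J2] c(2)[of J2] c(1)[of \<beta>]
  show ?thesis
    by (simp add: algebra_simps cs rel rel[THEN assoc_rule])
qed

text \<open>The reflection equation with cleared denominators. The last factor is \<open>s\<close>
  times the R-matrix \<open>(y - x) - s\<close>, as \<open>s * s = 1\<close>, and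
  \<open>x + y - k + Q\<close> is the partially transposed R-matrix.\<close>

lemma F_exchange:
  fixes s Q f1 f2 x y k :: "'a::ring_1"
  assumes central: "\<And>z. z * x = x * z" "\<And>z. z * y = y * z" "\<And>z. z * k = k * z"
    and rel: "s * f1 = f2 * s" "s * f2 = f1 * s" "s * s = 1" "s * Q = k * Q" "Q * s = k * Q" "k * k = 1"
      "f2 * Q = - (f1 * Q)" "Q * f2 = - (Q * f1)"
      "f2 * f1 = f1 * f2 - f2 * s + f1 * s - f1 * Q + Q * f1"
  shows "(f1 - x) * (x + y - k + Q) * (f2 - y) * ((y - x) * s - 1)
       = ((y - x) * s - 1) * ((f1 - y) * (x + y - k + Q) * (f2 - x))"
proof -
  have c: "z * (x * w) = x * (z * w)" "z * (y * w) = y * (z * w)" "z * (k * w) = k * (z * w)" for z w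
    using central by (metis mult.assoc)+
  note cs = central(1)[of s] central(2)[of s] central(3)[of s] central(1)[of f1] central(2)[of f1] central(3)[of f1]
    central(1)[of f2] central(2)[of f2] central(3)[of f2] central(1)[of Q] central(2)[of Q] central(3)[of Q]
    central(1)[of y] central(1)[of k] central(2)[of k]
    c(1)[of s] c(2)[of s] c(3)[of s] c(1)[of f1] c(2)[of f1] c(3)[of f1]
    c(1)[of f2] c(2)[of f2] c(3)[of f2] c(1)[of Q] c(2)[of Q] c(3)[of Q]
    c(1)[of y] c(1)[of k] c(2)[of k]
  \<comment> \<open>A critical pair of the rules oriented to move \<open>s\<close> right:
    \<open>f1 * s = s * f2\<close>, after which \<open>Q\<close> absorbs \<open>s\<close>.\<close>
  have "Q * (f1 * s) = - (k * (Q * f1))"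
    using rel(2)[symmetric] rel(5)[THEN assoc_rule, of f2] rel(8) by (simp add: mult.assoc)
  then show ?thesis
    by (simp add: algebra_simps cs rel rel[THEN assoc_rule])
qed

lemma sc_inverse_cancel: "z \<noteq> 0 \<Longrightarrow> sc (1 / z) * (sc z * A) = A"
  by (simp add: mult.assoc[symmetric] sc_mult[symmetric])

text \<open>Behind \<open>m\<close>, the terms \<open>b * Q\<close> and \<open>J * Q\<close> add up
  to \<open>(b + a) * Q\<close>, so the scalar \<open>b + a\<close> splits off the whole
  product.\<close>

lemma scalar_expand:
  assumes "m * (J * Q) = sc a * (m * Q)"
  shows "m * (sc b + J) * (sc (b + a) + Q) = sc (b + a) * (m * (sc b + J + Q))"
proof -
  have "m * (sc b + J) * (sc (b + a) + Q) = m * (sc b + J) * sc (b + a) + m * sc b * Q + m * (J * Q)"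
    by (simp add: distrib_left distrib_right mult.assoc)
  also have "\<dots> = sc (b + a) * (m * (sc b + J)) + (sc b * (m * Q) + sc a * (m * Q))"
    unfolding sc_comm[of m] sc_comm[of "m * (sc b + J)"] assms by (simp only: mult.assoc add.assoc)
  also have "sc b * (m * Q) + sc a * (m * Q) = sc (b + a) * (m * Q)"
    by (simp add: sc_add distrib_right)
  finally show ?thesis by (simp add: distrib_left)
qed

section \<open>Exchanging two neighbouring factors\<close>

context tensor_space
begin

abbreviation S :: "nat \<Rightarrow> oper" where "S k \<equiv> Pm (transpose k (Suc k))"

definition Jm :: "nat \<Rightarrow> oper" where
  "Jm p = (\<Sum>q\<in>{1..<p}. Q q p)"

definition Xm :: "nat \<Rightarrow> oper" where
  "Xm p = (\<Sum>q\<in>{1..<p}. Pm (transpose q p))"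

text \<open>The p-th factor of the product multiplied by its denominator \<open>2u + c\<close>,
  hence polynomial in \<open>u\<close>.\<close>

definition Fac :: "complex \<Rightarrow> complex \<Rightarrow> nat \<Rightarrow> oper" where
  "Fac u c p = (sc (2 * u + c) + Jm p) * (F p - sc (u + c + eta G))"

lemma S_S: "S k * S k = 1"
  by (simp add: Pm_mult)

context
  fixes k
  assumes k: "1 \<le> k" "k < n"
begin

lemma k_mem: "k \<in> {1..n}" "Suc k \<in> {1..n}" "k \<noteq> Suc k"
  using k by auto

lemma S_k_permutes: "transpose k (Suc k) permutes {1..n}"
  using k_mem transpose_permutes by blast

lemma pair_F:
  assumes "x + y - kap G = \<gamma>"
  shows "(F k - sc x) * (sc \<gamma> + Q k (Suc k)) * (F (Suc k) - sc y) * (sc (y - x) * S k - 1)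
    = (sc (y - x) * S k - 1) * ((F k - sc y) * (sc \<gamma> + Q k (Suc k)) * (F (Suc k) - sc x))"
proof -
  let ?s = "S k"
  have c: "F (Suc k) * F k = F k * F (Suc k) - F (Suc k) * ?s + F k * ?s - F k * Q k (Suc k) + Q k (Suc k) * F k"
    using F_commutator[OF k_mem] P_F[OF S_k_permutes, of k] by (simp add: algebra_simps)
  have "sc (kap G) * sc (kap G) = 1"
    by (simp add: sc_mult[symmetric])
  moreover have "?s * F k = F (Suc k) * ?s" "?s * F (Suc k) = F k * ?s"
    using P_F[OF S_k_permutes] by simp_all
  ultimately show ?thesis
    using F_exchange[OF sc_comm[of _ x] sc_comm[of _ y] sc_comm[of _ "kap G"], of ?s "F k" "F (Suc k)" "Q k (Suc k)"]
      Q_P[OF k_mem] P_Q_same[OF k_mem] F_Q[OF k_mem] Q_F[OF k_mem] c S_S assms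
    by (simp add: sc_diff sc_add flip: assms)
qed

definition J2 :: oper where "J2 = (\<Sum>q\<in>{1..<k}. Q q (Suc k))"

lemma Jm_Suc_k: "Jm (Suc k) = J2 + Q k (Suc k)"
  using k by (simp add: Jm_def J2_def)

lemma S_J: "S k * Jm k = J2 * S k" "S k * J2 = Jm k * S k"
  unfolding Jm_def J2_def sum_distrib_left sum_distrib_right P_Q[OF S_k_permutes]
  by (auto intro!: sum.cong simp: transpose_def)

lemma J2_F: "J2 * F k = F k * J2"
  unfolding J2_def sum_distrib_left sum_distrib_right
  using k by (intro sum.cong refl Q_F_comm) auto

text \<open>Termwise \<open>Q_Q\<close>, with \<open>Suc k\<close> as the shared factor.\<close>

lemma J2_Q: "J2 * Q k (Suc k) = Xm k * Q k (Suc k)"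
  unfolding J2_def Xm_def sum_distrib_right
  using k by (intro sum.cong refl Q_Q) auto

text \<open>Terms with different q and r act on disjoint pairs of factors and commute. For q = r
  both products are evaluated by \<open>Q_Q\<close>, which yields the two correction terms.\<close>

lemma J_J: "J2 * Jm k = Jm k * J2 - Jm k * S k + J2 * S k"
proof -
  have *: "Q q (Suc k) * Q r k = Q r k * Q q (Suc k) + (if q = r then Q q (Suc k) * S k - Q q k * S k else 0)"
    if "q \<in> {1..<k}" "r \<in> {1..<k}" for q r
  proof (cases "q = r")
    case False
    then have "Q q (Suc k) * Q r k = Q r k * Q q (Suc k)"
      using that k by (intro Q_Q_comm) auto
    then show ?thesis using False by simp
  next
    case True
    have q: "q \<in> {1..n}" "q \<noteq> k" "q \<noteq> Suc k" using that k by auto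
    have "Q q (Suc k) * Q q k = S k * Q q k"
      using Q_Q[of k q "Suc k"] q k_mem by (simp add: Q_sym transpose_commute)
    moreover have "Q q k * Q q (Suc k) = S k * Q q (Suc k)"
      using Q_Q[of "Suc k" q k] q k_mem by (simp add: Q_sym)
    moreover have "S k * Q q k = Q q (Suc k) * S k" "S k * Q q (Suc k) = Q q k * S k"
      using P_Q[OF S_k_permutes] q by (simp_all add: transpose_def)
    ultimately show ?thesis using True by simp
  qed
  have "J2 * Jm k = (\<Sum>q\<in>{1..<k}. \<Sum>r\<in>{1..<k}. Q q (Suc k) * Q r k)"
    by (simp add: J2_def Jm_def sum_product)
  also have "\<dots> = (\<Sum>q\<in>{1..<k}. \<Sum>r\<in>{1..<k}. Q r k * Q q (Suc k)) + (\<Sum>q\<in>{1..<k}. Q q (Suc k) * S k - Q q k * S k)"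
    by (simp add: * sum.distrib)
  also have "(\<Sum>q\<in>{1..<k}. \<Sum>r\<in>{1..<k}. Q r k * Q q (Suc k)) = Jm k * J2"
    by (subst sum.swap) (simp add: J2_def Jm_def sum_product)
  also have "(\<Sum>q\<in>{1..<k}. Q q (Suc k) * S k - Q q k * S k) = J2 * S k - Jm k * S k"
    by (simp add: J2_def Jm_def sum_distrib_right sum_subtractf)
  finally show ?thesis by (simp add: algebra_simps)
qed

lemma pair_J:
  "(sc \<alpha> + Jm k) * (sc \<beta> + J2) * (sc (\<beta> - \<alpha>) * S k - 1)
    = (sc (\<beta> - \<alpha>) * S k - 1) * ((sc \<beta> + Jm k) * (sc \<alpha> + J2))"
  using J_exchange[OF sc_comm[of _ \<alpha>] sc_comm[of _ \<beta>] S_J S_S J_J] by (simp add: sc_diff)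

definition Wm :: "complex \<Rightarrow> complex \<Rightarrow> complex \<Rightarrow> oper" where
  "Wm u a b = (sc (2 * u + a) + Jm k) * (sc (2 * u + b) + J2) *
     ((F k - sc (u + a + eta G)) * (sc (2 * u + a + b) + Q k (Suc k)) * (F (Suc k) - sc (u + b + eta G)))"

text \<open>\<open>pair_J\<close> and \<open>pair_F\<close> have the same exchange factor, because
  both parameter differences equal \<open>b - a\<close>. The shift \<open>eta G\<close> in F_p(u) is
  what makes the middle parameter fit: \<open>x + y - kap G = 2 * u + a + b\<close>.\<close>

lemma Wm_exchange: "Wm u a b * (sc (b - a) * S k - 1) = (sc (b - a) * S k - 1) * Wm u b a"
proof -
  let ?d = "sc (b - a) * S k - 1"
  define A C where "A = (\<lambda>a b. (sc (2 * u + a) + Jm k) * (sc (2 * u + b) + J2))"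
    and "C = (\<lambda>a b. (F k - sc (u + a + eta G)) * (sc (2 * u + a + b) + Q k (Suc k)) * (F (Suc k) - sc (u + b + eta G)))"
  have W: "Wm u a b = A a b * C a b" for a b by (simp add: Wm_def A_def C_def)
  have "A a b * ?d = ?d * A b a"
    using pair_J[of "2 * u + a" "2 * u + b"] by (simp add: A_def)
  moreover have "C a b * ?d = ?d * C b a"
    using pair_F[of "u + a + eta G" "u + b + eta G" "2 * u + a + b"]
    by (simp add: C_def kap_def add_ac)
  ultimately show ?thesis unfolding W by (metis mult.assoc)
qed

text \<open>Multiplying by \<open>2u + a + b\<close> turns the two factors at \<open>k\<close> and \<open>k + 1\<close> into \<open>Wm\<close>:
  the term \<open>J2 * Q\<close> created by \<open>Wm\<close> equals \<open>Xm k * Q\<close>, and the hypothesis evaluates \<open>Xm k\<close>.\<close>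
lemma Fac_pair:
  assumes "M * Fac u a k * Xm k = sc a * (M * Fac u a k)"
  shows "sc (2 * u + a + b) * (M * Fac u a k * Fac u b (Suc k)) = M * Wm u a b"
proof -
  let ?m = "M * Fac u a k" and ?Q = "Q k (Suc k)" and ?y = "F (Suc k) - sc (u + b + eta G)"
    and ?g = "2 * u + a + b" and ?b = "2 * u + b"
  have "M * Wm u a b = ?m * (sc ?b + J2) * (sc ?g + ?Q) * ?y"
  proof -
    have "(sc ?b + J2) * (F k - sc (u + a + eta G)) = (F k - sc (u + a + eta G)) * (sc ?b + J2)"
      by (simp add: distrib_left distrib_right left_diff_distrib right_diff_distrib J2_F sc_comm[of J2]
          sc_comm[of "F k"] sc_mult[symmetric] mult.commute)
    from assoc_rule[OF this] show ?thesis unfolding Wm_def Fac_def by (simp only: mult.assoc)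
  qed
  also have "?m * (sc ?b + J2) * (sc ?g + ?Q) = sc ?g * (?m * (sc ?b + J2 + ?Q))"
  proof -
    have mJQ: "?m * (J2 * ?Q) = sc a * (?m * ?Q)"
      using assms by (simp add: J2_Q mult.assoc[symmetric])
    have g: "?g = ?b + a" by simp
    show ?thesis using scalar_expand[OF mJQ, of ?b] unfolding g .
  qed
  also have "sc ?g * (?m * (sc ?b + J2 + ?Q)) * ?y = sc ?g * (?m * Fac u b (Suc k))"
    unfolding Fac_def[of u b] Jm_Suc_k by (simp add: mult.assoc add.assoc)
  finally show ?thesis by simp
qed

text \<open>The assumption on \<open>M\<close> says that \<open>sc (b - a) * S k - 1\<close> turns
  \<open>M\<close> into a multiple of \<open>M'\<close>, the form that passes through
  \<open>Wm\<close>. The guard \<open>q \<noteq> 0\<close> reflects that otherwise the swapped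
  tableau is not standard and \<open>Xm k\<close> has no known eigenvalue on the product with
  \<open>M'\<close>.\<close>

lemma swap_step:
  assumes ne: "b \<noteq> a" "2 * u + a + b \<noteq> 0"
    and M: "M * S k = sc (1 / (b - a)) * M + sc q * M'"
    and X: "M * Fac u a k * Xm k = sc a * (M * Fac u a k)"
    and X': "q \<noteq> 0 \<Longrightarrow> M' * Fac u b k * Xm k = sc b * (M' * Fac u b k)"
  shows "M * Fac u a k * Fac u b (Suc k) * S k
    = sc (1 / (b - a)) * (M * Fac u a k * Fac u b (Suc k)) + sc q * (M' * Fac u b k * Fac u a (Suc k))"
proof -
  let ?m = "M * Fac u a k * Fac u b (Suc k)" and ?m' = "M' * Fac u b k * Fac u a (Suc k)"
    and ?g = "2 * u + a + b" and ?d = "sc (b - a) * S k - 1"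
  have one: "sc (b - a) * sc (1 / (b - a)) = 1" using ne by (simp add: sc_mult[symmetric])
  have "M * ?d = sc (b - a) * (M * S k) - M"
    by (simp add: right_diff_distrib mult.assoc[symmetric] sc_comm[of M])
  also have "\<dots> = sc ((b - a) * q) * M'"
    by (simp add: M distrib_left mult.assoc[symmetric] one sc_mult)
  finally have Md: "M * ?d = sc ((b - a) * q) * M'" .
  have "sc ?g * (?m * ?d) = M * Wm u a b * ?d"
    using Fac_pair[OF X, of b] by (simp add: mult.assoc[symmetric])
  also have "\<dots> = M * ?d * Wm u b a"
    by (simp add: mult.assoc Wm_exchange)
  also have "\<dots> = sc ((b - a) * q) * (M' * Wm u b a)"
    by (simp add: Md mult.assoc)
  also have "\<dots> = sc ((b - a) * q) * (sc ?g * ?m')"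
  proof (cases "q = 0")
    case False
    from Fac_pair[OF X'[OF this], of a] show ?thesis by (simp add: add_ac)
  qed simp
  finally have "sc (1 / ?g) * (sc ?g * (?m * ?d)) = sc (1 / ?g) * (sc ((b - a) * q) * (sc ?g * ?m'))"
    by simp
  then have "?m * ?d = sc ((b - a) * q) * ?m'"
    using ne by (simp add: mult.assoc[symmetric] sc_mult[symmetric])
  then have "sc (1 / (b - a)) * (?m * ?d) = sc q * ?m'"
    using ne by (simp add: mult.assoc[symmetric] sc_mult[symmetric])
  moreover have "sc (1 / (b - a)) * (?m * ?d) = ?m * S k - sc (1 / (b - a)) * ?m"
  proof -
    have "?m * ?d = sc (b - a) * (?m * S k) - ?m"
      by (simp add: right_diff_distrib mult.assoc[symmetric] sc_comm[of M])
        (simp add: mult.assoc sc_comm)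
    then show ?thesis
      using ne by (simp only: right_diff_distrib sc_inverse_cancel right_minus_eq not_False_eq_True)
  qed
  ultimately show ?thesis by (simp add: algebra_simps)
qed

end

end

section \<open>Standard tableaux\<close>

lemma content_comp [simp]: "content (T \<circ> \<sigma>) p = content T (\<sigma> p)"
  by (simp add: content_def)

lemma cells_down:
  assumes "is_partition \<nu> n" "(l, k) \<in> cells \<nu>" "l' \<le> l" "k' \<le> k"
  shows "(l', k') \<in> cells \<nu>"
proof -
  have "\<nu> ! l \<le> \<nu> ! l'"
    using assms by (intro sorted_rev_nth_mono) (auto simp: is_partition_def cells_def)
  then show ?thesis using assms by (auto simp: cells_def)
qed

lemma std_less:
  "std_tableau n \<nu> T \<Longrightarrow> p \<in> {1..n} \<Longrightarrow> q \<in> {1..n} \<Longrightarrow> p \<noteq> q \<Longrightarrow>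
    fst (T p) \<le> fst (T q) \<Longrightarrow> snd (T p) \<le> snd (T q) \<Longrightarrow> p < q"
  unfolding std_tableau_def by blast

lemma std_inj: "std_tableau n \<nu> T \<Longrightarrow> p \<in> {1..n} \<Longrightarrow> q \<in> {1..n} \<Longrightarrow> T p = T q \<longleftrightarrow> p = q"
  unfolding std_tableau_def bij_betw_def by (meson inj_on_eq_iff)

text \<open>The rectangle spanned by the two cells lies in the diagram because the diagram is closed
  towards the corner; standardness then bounds its entries.\<close>

lemma std_between:
  assumes T: "std_tableau n \<nu> T" and \<nu>: "is_partition \<nu> n" and pq: "p \<in> {1..n}" "q \<in> {1..n}"
    and lk: "T p = (l, k)" "T q = (l', k')" "l \<le> i" "i \<le> l'" "k \<le> j" "j \<le> k'" "(i, j) \<notin> {T p, T q}"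
  shows "\<exists>r\<in>{p<..<q}. T r = (i, j)"
proof -
  have "T q \<in> cells \<nu>" using T pq by (auto simp: std_tableau_def bij_betw_def)
  then have "(i, j) \<in> cells \<nu>" using cells_down[OF \<nu>] lk by metis
  then obtain r where r: "r \<in> {1..n}" "T r = (i, j)"
    using T unfolding std_tableau_def bij_betw_def by (metis imageE)
  then have "p < r" "r < q"
    using std_less[OF T pq(1) r(1)] std_less[OF T r(1) pq(2)] lk by fastforce+
  then show ?thesis using r by auto
qed

text \<open>Equal contents put both cells on one diagonal, and the two neighbours
  \<open>(l, Suc k)\<close> and \<open>(Suc l, k)\<close> must be filled in between. The gap is wide
  enough for the braid relation, where contents at distance two are subtracted.\<close>

lemma content_eq_gap:
  assumes T: "std_tableau n \<nu> T" and \<nu>: "is_partition \<nu> n" and pq: "p \<in> {1..n}" "q \<in> {1..n}" "p < q"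
    and eq: "content T p = content T q"
  shows "p + 2 < q"
proof -
  obtain l k l' k' where lk: "T p = (l, k)" "T q = (l', k')" by fastforce
  have e: "int k - int l = int k' - int l'" using eq lk by (simp add: content_def)
  have "l < l'"
  proof (rule ccontr)
    assume "\<not> l < l'"
    then have "fst (T q) \<le> fst (T p)" "snd (T q) \<le> snd (T p)" using e lk by auto
    from std_less[OF T pq(2,1) _ this] show False using pq by simp
  qed
  moreover from this have "k < k'" using e by simp
  ultimately have "\<exists>r\<in>{p<..<q}. T r = (l, Suc k)" "\<exists>r\<in>{p<..<q}. T r = (Suc l, k)"
    using std_between[OF T \<nu> pq(1,2) lk, of l "Suc k"] std_between[OF T \<nu> pq(1,2) lk, of "Suc l" k] lk
    by auto
  then obtain r r' where "r \<in> {p<..<q}" "T r = (l, Suc k)" "r' \<in> {p<..<q}" "T r' = (Suc l, k)"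
    by blast
  moreover from this have "r \<noteq> r'" by auto
  ultimately show ?thesis by auto
qed

lemma content_neq:
  assumes "std_tableau n \<nu> T" "is_partition \<nu> n" "p \<in> {1..n}" "q \<in> {1..n}" "p < q" "q \<le> p + 2"
  shows "content T p \<noteq> content T q"
  using content_eq_gap[OF assms(1-5)] assms(6) by auto

definition comparable :: "nat \<times> nat \<Rightarrow> nat \<times> nat \<Rightarrow> bool" where
  "comparable x y \<longleftrightarrow> (fst x \<le> fst y \<and> snd x \<le> snd y) \<or> (fst y \<le> fst x \<and> snd y \<le> snd x)"

abbreviation swap :: "tableau \<Rightarrow> nat \<Rightarrow> tableau" where
  "swap T k \<equiv> T \<circ> transpose k (Suc k)"

lemma swap_std_iff:
  assumes T: "std_tableau n \<nu> T" and j: "1 \<le> j" "j < n"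
  shows "std_tableau n \<nu> (swap T j) \<longleftrightarrow> \<not> comparable (T j) (T (Suc j))"
proof
  assume T': "std_tableau n \<nu> (swap T j)"
  show "\<not> comparable (T j) (T (Suc j))"
    using std_less[OF T, of j "Suc j"] std_less[OF T, of "Suc j" j]
      std_less[OF T', of j "Suc j"] std_less[OF T', of "Suc j" j] j
    by (auto simp: comparable_def)
next
  assume inc: "\<not> comparable (T j) (T (Suc j))"
  let ?s = "transpose j (Suc j)"
  have s: "?s permutes {1..n}" using j by (intro permutes_swap_id) auto
  show "std_tableau n \<nu> (swap T j)"
    unfolding std_tableau_def
  proof (intro conjI ballI allI impI)
    show "bij_betw (swap T j) {1..n} (cells \<nu>)"
      using T permutes_imp_bij[OF s] unfolding std_tableau_def by (intro bij_betw_trans) auto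
    show "swap T j p = (0, 0)" if "p \<notin> {1..n}" for p
      using that T j unfolding std_tableau_def by (auto simp: transpose_def)
    fix p q
    assume pq: "p \<in> {1..n}" "q \<in> {1..n}" "p \<noteq> q \<and> fst (swap T j p) \<le> fst (swap T j q) \<and> snd (swap T j p) \<le> snd (swap T j q)"
    have "?s p \<in> {1..n}" "?s q \<in> {1..n}" "?s p \<noteq> ?s q"
      using pq permutes_in_image[OF s] by (auto simp: inj_eq)
    then have "?s p < ?s q" using std_less[OF T] pq by simp
    moreover have "\<not> (p = Suc j \<and> q = j)"
      using inc pq by (auto simp: comparable_def)
    ultimately show "p < q" using pq by (auto simp: transpose_def split: if_splits)
  qed
qed

text \<open>No entry lies strictly between \<open>j\<close> and \<open>Suc j\<close>, so by
  \<open>std_between\<close> the rectangle they span has only two cells: comparable cells are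
  adjacent.\<close>

lemma comparable_iff_content:
  assumes T: "std_tableau n \<nu> T" and \<nu>: "is_partition \<nu> n" and j: "1 \<le> j" "j < n"
  shows "comparable (T j) (T (Suc j)) \<longleftrightarrow> \<bar>content T (Suc j) - content T j\<bar> = 1"
proof -
  obtain l k l' k' where lk: "T j = (l, k)" "T (Suc j) = (l', k')" by fastforce
  have mem: "j \<in> {1..n}" "Suc j \<in> {1..n}" using j by auto
  have ne: "(l, k) \<noteq> (l', k')" using std_inj[OF T mem] lk by auto
  show ?thesis
  proof
    assume "comparable (T j) (T (Suc j))"
    then have le: "l \<le> l'" "k \<le> k'"
      using std_less[OF T mem(2,1)] lk by (auto simp: comparable_def)
    have *: "(i, m) \<in> {(l, k), (l', k')}" if "l \<le> i" "i \<le> l'" "k \<le> m" "m \<le> k'" for i m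
      using std_between[OF T \<nu> mem lk that] lk by fastforce
    have "(l' = l \<and> k' = Suc k) \<or> (l' = Suc l \<and> k' = k)"
      using *[of l "Suc k"] *[of "Suc l" k] le ne by (cases "k < k'"; cases "l < l'") auto
    then show "\<bar>content T (Suc j) - content T j\<bar> = 1"
      using lk by (auto simp: content_def)
  qed (use lk ne in \<open>auto simp: comparable_def content_def\<close>)
qed

section \<open>Coefficients of Young's form, and connectedness under swaps\<close>

definition yr :: "nat \<Rightarrow> tableau \<Rightarrow> real" where
  "yr k T = 1 / real_of_int (content T (Suc k) - content T k)"

definition yq :: "nat \<Rightarrow> tableau \<Rightarrow> real" where
  "yq k T = sqrt (1 - (yr k T)\<^sup>2)"

lemma yr_swap [simp]: "yr k (swap T k) = - yr k T"
  by (simp add: yr_def) (metis minus_diff_eq minus_divide_right of_int_diff)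

lemma yq_swap [simp]: "yq k (swap T k) = yq k T"
  by (simp add: yq_def)

lemma yr_sq_le_1: "(yr k T)\<^sup>2 \<le> 1"
proof (cases "content T (Suc k) = content T k")
  case False
  then have "\<bar>real_of_int (content T (Suc k) - content T k)\<bar> \<ge> 1" by linarith
  then have "\<bar>yr k T\<bar> \<le> 1" unfolding yr_def abs_divide by (simp add: divide_le_eq_1)
  then show ?thesis by (simp add: abs_square_le_1)
qed (simp add: yr_def)

lemma yq_sq: "(yq k T)\<^sup>2 = 1 - (yr k T)\<^sup>2"
  using yr_sq_le_1 by (simp add: yq_def)

text \<open>This keeps Young's formulas closed on standard tableaux: a swap leading out of them has
  coefficient zero.\<close>

lemma yq_nonzero_iff:
  assumes "std_tableau n \<nu> T" "is_partition \<nu> n" "1 \<le> j" "j < n"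
  shows "yq j T \<noteq> 0 \<longleftrightarrow> std_tableau n \<nu> (swap T j)"
proof -
  let ?d = "content T (Suc j) - content T j"
  have "?d \<noteq> 0" using content_neq[OF assms(1,2), of j "Suc j"] assms(3,4) by simp
  then have "yq j T = 0 \<longleftrightarrow> (real_of_int ?d)\<^sup>2 = 1"
    by (simp add: yq_def yr_def power_divide field_simps)
  also have "\<dots> \<longleftrightarrow> \<bar>?d\<bar> = 1"
    by (metis abs_1 abs_square_eq_1 of_int_abs of_int_eq_1_iff)
  finally show ?thesis
    using swap_std_iff[OF assms(1,3,4)] comparable_iff_content[OF assms] by simp
qed

text \<open>Bubble sort of the permutation \<open>\<pi> T\<close> that carries \<open>T\<close> to
  \<open>T'\<close>. A descent of \<open>\<pi> T\<close> occurs only at incomparable cells, since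
  both \<open>T\<close> and \<open>T'\<close> respect comparability, so each sorting step stays
  standard.\<close>

lemma std_connected:
  assumes \<nu>: "is_partition \<nu> n"
    and inv: "\<And>T j. std_tableau n \<nu> T \<Longrightarrow> std_tableau n \<nu> (swap T j) \<Longrightarrow> 1 \<le> j \<Longrightarrow> j < n \<Longrightarrow> f (swap T j) = f T"
    and T: "std_tableau n \<nu> T" and T': "std_tableau n \<nu> T'"
  shows "f T = f T'"
proof -
  define \<pi> :: "tableau \<Rightarrow> nat \<Rightarrow> nat" where "\<pi> = (\<lambda>T p. inv_into {1..n} T' (T p))"
  \<comment> \<open>Removing a descent strictly increases this weight, which is bounded by
    \<open>n * n * n\<close>; it serves as termination measure.\<close>
  define w where "w = (\<lambda>T. \<Sum>p\<in>{1..n}. p * \<pi> T p)"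
  have bij': "bij_betw T' {1..n} (cells \<nu>)" using T' by (simp add: std_tableau_def)
  have \<pi>: "bij_betw (\<pi> T) {1..n} {1..n}" "\<And>p. p \<in> {1..n} \<Longrightarrow> T' (\<pi> T p) = T p" if "std_tableau n \<nu> T" for T
  proof -
    have b: "bij_betw T {1..n} (cells \<nu>)" using that by (simp add: std_tableau_def)
    show "bij_betw (\<pi> T) {1..n} {1..n}"
      using bij_betw_trans[OF b bij_betw_inv_into[OF bij']] by (simp add: \<pi>_def comp_def)
    show "T' (\<pi> T p) = T p" if "p \<in> {1..n}" for p
      unfolding \<pi>_def using that b bij' by (intro f_inv_into_f) (auto simp: bij_betw_def)
  qed
  have w_le: "w T \<le> n * n * n" if "std_tableau n \<nu> T" for T
  proof -
    have "w T \<le> (\<Sum>p\<in>{1..n}. n * n)"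
      unfolding w_def using bij_betwE[OF \<pi>(1)[OF that]] by (intro sum_mono mult_mono) auto
    then show ?thesis by simp
  qed
  from T show "f T = f T'"
  proof (induction "n * n * n - w T" arbitrary: T rule: less_induct)
    case less
    show ?case
    proof (cases "\<exists>j. 1 \<le> j \<and> j < n \<and> \<pi> T (Suc j) < \<pi> T j")
      case True
      then obtain j where j: "1 \<le> j" "j < n" "\<pi> T (Suc j) < \<pi> T j" by blast
      have mem: "j \<in> {1..n}" "Suc j \<in> {1..n}" using j by auto
      have mem': "\<pi> T j \<in> {1..n}" "\<pi> T (Suc j) \<in> {1..n}"
        using mem bij_betwE[OF \<pi>(1)[OF less.prems]] by blast+
      have "\<not> comparable (T j) (T (Suc j))"
        using std_less[OF T' mem'] std_less[OF less.prems mem(2,1)] j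
          \<pi>(2)[OF less.prems] mem by (auto simp: comparable_def)
      then have std: "std_tableau n \<nu> (swap T j)"
        using swap_std_iff[OF less.prems j(1,2)] by blast
      have split: "(\<Sum>p\<in>{1..n}. h p) = (\<Sum>p\<in>{1..n} - {j, Suc j}. h p) + h j + h (Suc j)" for h :: "nat \<Rightarrow> nat"
      proof -
        have "{1..n} = insert j (insert (Suc j) ({1..n} - {j, Suc j}))" using mem by auto
        then have "(\<Sum>p\<in>{1..n}. h p) = (\<Sum>p\<in>insert j (insert (Suc j) ({1..n} - {j, Suc j})). h p)" by simp
        then show ?thesis by (simp del: insert_Diff_single Diff_insert)
      qed
      have \<pi>': "\<pi> (swap T j) p = \<pi> T (transpose j (Suc j) p)" for p by (simp add: \<pi>_def)
      have "(\<Sum>p\<in>{1..n} - {j, Suc j}. p * \<pi> (swap T j) p) = (\<Sum>p\<in>{1..n} - {j, Suc j}. p * \<pi> T p)"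
        by (intro sum.cong) (auto simp: \<pi>' transpose_def)
      then have "w T < w (swap T j)"
        using j(3) unfolding w_def split by (simp add: \<pi>' algebra_simps)
      moreover have "w (swap T j) \<le> n * n * n" using w_le[OF std] .
      ultimately have "f (swap T j) = f T'" by (intro less.hyps std) linarith
      then show ?thesis using inv[OF less.prems std j(1,2)] by simp
    next
      case False
      let ?xs = "map (\<pi> T) [1..<Suc n]"
      have "sorted ?xs"
        unfolding sorted_iff_nth_Suc
      proof (intro allI impI)
        fix i assume "Suc i < length ?xs"
        then have "Suc i < n" by (simp del: upt_Suc)
        moreover from this have "\<pi> T (Suc i) \<le> \<pi> T (Suc (Suc i))"
          using False[simplified, rule_format, of "Suc i"] by (simp add: not_less)
        ultimately show "?xs ! i \<le> ?xs ! Suc i" by (simp del: upt_Suc)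
      qed
      moreover have "distinct ?xs" "set ?xs = {1..n}"
        using \<pi>(1)[OF less.prems] by (auto simp: distinct_map bij_betw_def atLeastLessThanSuc_atLeastAtMost simp del: upt_Suc)
      ultimately have "?xs = [1..<Suc n]"
        by (intro sorted_distinct_set_unique) (auto simp: atLeastLessThanSuc_atLeastAtMost simp del: upt_Suc)
      then have "\<pi> T p = p" if "p \<in> {1..n}" for p
        using that map_idI[of "[1..<Suc n]" "\<pi> T"] map_eq_conv[of "\<pi> T" "[1..<Suc n]" id] by auto
      then have "T p = T' p" for p
        using \<pi>(2)[OF less.prems, of p] T' less.prems unfolding std_tableau_def by (cases "p \<in> {1..n}") auto
      then show ?thesis by (metis ext)
    qed
  qed
qed

section \<open>Coxeter words\<close>

declare upt_Suc [simp del]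

text \<open>Words evaluated in arbitrary maps, so that permutations and Young's operators run
  through one and the same reduction.\<close>

fun wact :: "(nat \<Rightarrow> 'x \<Rightarrow> 'x) \<Rightarrow> nat list \<Rightarrow> 'x \<Rightarrow> 'x" where
  "wact f [] = id"
| "wact f (k # ks) = f k \<circ> wact f ks"

lemma wact_append: "wact f (ks @ ls) = wact f ks \<circ> wact f ls"
  by (induction ks) (simp_all add: comp_assoc)

lemma perm_word_wact: "perm_word = wact (\<lambda>k. transpose k (Suc k))"
proof
  show "perm_word ks = wact (\<lambda>k. transpose k (Suc k)) ks" for ks by (induction ks) simp_all
qed

definition braid_rel :: "nat \<Rightarrow> (nat \<Rightarrow> 'x \<Rightarrow> 'x) \<Rightarrow> bool" where
  "braid_rel n f \<longleftrightarrow> (\<forall>i\<in>{1..<n}. f i \<circ> f i = id)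
    \<and> (\<forall>i\<in>{1..<n}. \<forall>j\<in>{1..<n}. Suc i < j \<longrightarrow> f i \<circ> f j = f j \<circ> f i)
    \<and> (\<forall>i\<in>{1..<n}. Suc i < n \<longrightarrow> f i \<circ> f (Suc i) \<circ> f i = f (Suc i) \<circ> f i \<circ> f (Suc i))"

lemma braid_relD:
  assumes "braid_rel n f"
  shows "1 \<le> i \<Longrightarrow> i < n \<Longrightarrow> f i \<circ> f i = id"
    and "1 \<le> i \<Longrightarrow> i < n \<Longrightarrow> 1 \<le> j \<Longrightarrow> j < n \<Longrightarrow> Suc i < j \<or> Suc j < i \<Longrightarrow> f i \<circ> f j = f j \<circ> f i"
    and "1 \<le> i \<Longrightarrow> Suc i < n \<Longrightarrow> f i \<circ> f (Suc i) \<circ> f i = f (Suc i) \<circ> f i \<circ> f (Suc i)"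
  using assms unfolding braid_rel_def by (auto simp: Ball_def)

lemma braid_rel_mono: "braid_rel n f \<Longrightarrow> m \<le> n \<Longrightarrow> braid_rel m f"
  unfolding braid_rel_def[of m]
  by (intro conjI ballI impI; (erule braid_relD(1) | erule braid_relD(2) | erule braid_relD(3)); auto)

lemma braid_rel_transpose: "braid_rel n (\<lambda>k. transpose k (Suc k))"
  unfolding braid_rel_def by (auto simp: fun_eq_iff transpose_def)

lemma wact_commute:
  assumes "braid_rel n f" "1 \<le> k" "k < n" "\<And>i. i \<in> set ks \<Longrightarrow> 1 \<le> i \<and> i < n \<and> (Suc k < i \<or> Suc i < k)"
  shows "f k \<circ> wact f ks = wact f ks \<circ> f k"
  using assms(4)
proof (induction ks)
  case (Cons i ks)
  then have "f k \<circ> f i = f i \<circ> f k"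
    using braid_relD(2)[OF assms(1-3), of i] by simp
  then show ?case using Cons by (simp add: fun_eq_iff)
qed simp

text \<open>\<open>f (Suc k)\<close> commutes with the letters below \<open>k\<close>, the braid
  relation turns it into \<open>f k\<close> at the letters \<open>k\<close> and
  \<open>Suc k\<close>, and \<open>f k\<close> commutes with the rest.\<close>

lemma wact_shift:
  assumes "braid_rel (Suc m) f" "1 \<le> j" "j \<le> k" "k < m"
  shows "f (Suc k) \<circ> wact f [j..<Suc m] = wact f [j..<Suc m] \<circ> f k"
proof -
  let ?A = "wact f [j..<k]" and ?B = "wact f [Suc (Suc k)..<Suc m]"
  have "[j..<Suc m] = [j..<k] @ [k, Suc k] @ [Suc (Suc k)..<Suc m]"
    using assms upt_add_eq_append[of j k "Suc m - k"] by (simp add: upt_conv_Cons)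
  then have w: "wact f [j..<Suc m] = ?A \<circ> (f k \<circ> (f (Suc k) \<circ> ?B))"
    by (simp add: wact_append)
  have A: "f (Suc k) \<circ> ?A = ?A \<circ> f (Suc k)"
    by (rule wact_commute[OF assms(1)]) (use assms in auto)
  have B: "f k \<circ> ?B = ?B \<circ> f k"
    by (rule wact_commute[OF assms(1)]) (use assms in \<open>auto\<close>)
  have AB: "f (Suc k) \<circ> (f k \<circ> f (Suc k)) = f k \<circ> (f (Suc k) \<circ> f k)"
    using braid_relD(3)[OF assms(1), of k] assms by (simp add: comp_assoc)
  show ?thesis unfolding w
    using A B AB by (simp add: fun_eq_iff)
qed

text \<open>A generator times a coset representative \<open>[j..<Suc m]\<close> either lengthens or
  shortens it, or passes through as a smaller generator. Both actions are treated at once so that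
  the same \<open>j'\<close> and \<open>ls\<close> serve them.\<close>

lemma wact_insert:
  fixes f :: "nat \<Rightarrow> 'x \<Rightarrow> 'x" and g :: "nat \<Rightarrow> 'y \<Rightarrow> 'y"
  assumes f: "braid_rel (Suc m) f" and g: "braid_rel (Suc m) g"
    and k: "k \<in> {1..<Suc m}" and j: "j \<in> {1..Suc m}"
  shows "\<exists>j'\<in>{1..Suc m}. \<exists>ls. set ls \<subseteq> {1..<m} \<and>
    f k \<circ> wact f [j..<Suc m] = wact f [j'..<Suc m] \<circ> wact f ls \<and>
    g k \<circ> wact g [j..<Suc m] = wact g [j'..<Suc m] \<circ> wact g ls"
proof -
  consider "Suc k = j" | "k = j" | "Suc k < j" | "j < k" by linarith
  then show ?thesis
  proof cases
    case 1
    then have "[k..<Suc m] = k # [j..<Suc m]" using k by (simp add: upt_conv_Cons)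
    then show ?thesis using k by (intro bexI[of _ k] exI[of _ "[]"]) auto
  next
    case 2
    then have c: "[j..<Suc m] = k # [Suc k..<Suc m]" using k by (simp add: upt_conv_Cons)
    have "f k \<circ> (f k \<circ> h) = h" for h :: "'z \<Rightarrow> 'x"
      using braid_relD(1)[OF f, of k] k by (simp add: comp_assoc[symmetric])
    moreover have "g k \<circ> (g k \<circ> h) = h" for h :: "'z \<Rightarrow> 'y"
      using braid_relD(1)[OF g, of k] k by (simp add: comp_assoc[symmetric])
    ultimately show ?thesis unfolding c
      using k by (intro bexI[of _ "Suc k"] exI[of _ "[]"]) auto
  next
    case 3
    then show ?thesis
      using k j wact_commute[OF f, of k "[j..<Suc m]"] wact_commute[OF g, of k "[j..<Suc m]"]
      by (intro bexI[of _ j] exI[of _ "[k]"]) auto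
  next
    case 4
    then show ?thesis
      using k j wact_shift[OF f, of j "k - 1"] wact_shift[OF g, of j "k - 1"]
      by (intro bexI[of _ j] exI[of _ "[k - 1]"]) auto
  qed
qed

lemma wact_normal_form:
  assumes f: "braid_rel (Suc m) f" and g: "braid_rel (Suc m) g" and "set ks \<subseteq> {1..<Suc m}"
  shows "\<exists>j\<in>{1..Suc m}. \<exists>ls. set ls \<subseteq> {1..<m} \<and>
    wact f ks = wact f [j..<Suc m] \<circ> wact f ls \<and> wact g ks = wact g [j..<Suc m] \<circ> wact g ls"
  using assms(3)
proof (induction ks)
  case Nil
  show ?case by (intro bexI[of _ "Suc m"] exI[of _ "[]"]) auto
next
  case (Cons k ks)
  then have k: "k \<in> {1..<Suc m}" and ks: "set ks \<subseteq> {1..<Suc m}" by auto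
  from Cons.IH[OF ks] obtain j ls where j: "j \<in> {1..Suc m}" and ls: "set ls \<subseteq> {1..<m}"
    and fj: "wact f ks = wact f [j..<Suc m] \<circ> wact f ls" and gj: "wact g ks = wact g [j..<Suc m] \<circ> wact g ls"
    by blast
  obtain j' ls' where j': "j' \<in> {1..Suc m}" "set ls' \<subseteq> {1..<m}"
    and *: "f k \<circ> wact f [j..<Suc m] = wact f [j'..<Suc m] \<circ> wact f ls'"
      "g k \<circ> wact g [j..<Suc m] = wact g [j'..<Suc m] \<circ> wact g ls'"
    using wact_insert[OF f g k j] by blast
  have "f k \<circ> (wact f [j..<Suc m] \<circ> wact f ls) = wact f [j'..<Suc m] \<circ> wact f (ls' @ ls)"
    "g k \<circ> (wact g [j..<Suc m] \<circ> wact g ls) = wact g [j'..<Suc m] \<circ> wact g (ls' @ ls)"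
    unfolding wact_append comp_assoc[symmetric] * by (simp_all only: comp_assoc)
  then show ?case
    using j' ls fj gj by (intro bexI[of _ j'] exI[of _ "ls' @ ls"]) (simp_all del: o_apply)
qed

lemma perm_word_append: "perm_word (ks @ ls) = perm_word ks \<circ> perm_word ls"
  by (simp add: perm_word_wact wact_append)

lemma perm_word_permutes: "set ks \<subseteq> {1..<n} \<Longrightarrow> perm_word ks permutes {1..n}"
  by (induction ks) (auto intro!: permutes_compose permutes_swap_id simp: permutes_id[unfolded id_def[symmetric]])

lemma perm_word_upt: "j \<le> m \<Longrightarrow> perm_word [j..<m] m = j"
  by (induction "m - j" arbitrary: j) (simp_all add: upt_conv_Cons)

text \<open>The words \<open>[j..m] @ ls\<close> with \<open>ls\<close> in the generators below \<open>m\<close> are normal forms,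
  so the Coxeter relations present the symmetric group.\<close>
lemma wact_eqI:
  assumes "braid_rel n f" "set ks \<subseteq> {1..<n}" "set ks' \<subseteq> {1..<n}" "perm_word ks = perm_word ks'"
  shows "wact f ks = wact f ks'"
  using assms
proof (induction n arbitrary: ks ks')
  case (Suc m)
  note nf = wact_normal_form[OF Suc.prems(1) braid_rel_transpose, folded perm_word_wact]
  obtain j ls where j: "j \<in> {1..Suc m}" "set ls \<subseteq> {1..<m}" "wact f ks = wact f [j..<Suc m] \<circ> wact f ls"
    "perm_word ks = perm_word [j..<Suc m] \<circ> perm_word ls"
    using nf[OF Suc.prems(2)] by blast
  obtain j' ls' where j': "j' \<in> {1..Suc m}" "set ls' \<subseteq> {1..<m}" "wact f ks' = wact f [j'..<Suc m] \<circ> wact f ls'"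
    "perm_word ks' = perm_word [j'..<Suc m] \<circ> perm_word ls'"
    using nf[OF Suc.prems(3)] by blast
  have fix_m: "perm_word ls (Suc m) = Suc m" if "set ls \<subseteq> {1..<m}" for ls
    using perm_word_permutes[OF that] by (auto simp: permutes_def)
  \<comment> \<open>The image of the last point reads off the representative: \<open>ls\<close>
    fixes \<open>Suc m\<close>, and \<open>[j..<Suc m]\<close> sends it to \<open>j\<close>.\<close>
  have "perm_word ks (Suc m) = j" "perm_word ks' (Suc m) = j'"
    using j j' fix_m by (simp_all add: perm_word_upt)
  then have jj: "j = j'" using Suc.prems(4) by simp
  have "inj (perm_word [j..<Suc m])"
    using j perm_word_permutes[of "[j..<Suc m]" "Suc m"] by (intro permutes_inj) auto
  moreover have "perm_word [j..<Suc m] \<circ> perm_word ls = perm_word [j..<Suc m] \<circ> perm_word ls'"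
    using Suc.prems(4) j(4) j'(4) jj by metis
  ultimately have "perm_word ls = perm_word ls'"
    by (simp add: fun_eq_iff inj_eq)
  then have "wact f ls = wact f ls'"
    using Suc.IH[OF braid_rel_mono[OF Suc.prems(1)] j(2) j'(2)] by simp
  then show ?case using j j' jj by simp
qed simp

lemma perm_word_exists:
  "\<sigma> permutes {1..n} \<Longrightarrow> \<exists>ks. set ks \<subseteq> {1..<n} \<and> perm_word ks = \<sigma>"
proof (induction n arbitrary: \<sigma>)
  case 0
  then show ?case by (intro exI[of _ "[]"]) simp
next
  case (Suc m)
  define j where "j = \<sigma> (Suc m)"
  let ?w = "perm_word [j..<Suc m]"
  have j: "j \<in> {1..Suc m}"
    unfolding j_def using permutes_in_image[OF Suc.prems, of "Suc m"] by simp
  then have w: "?w permutes {1..Suc m}"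
    by (intro perm_word_permutes) auto
  have "inv ?w \<circ> \<sigma> permutes {1..Suc m}"
    by (rule permutes_compose[OF Suc.prems permutes_inv[OF w]])
  moreover have "(inv ?w \<circ> \<sigma>) (Suc m) = Suc m"
    using j perm_word_upt[of j "Suc m"] permutes_inv_eq[OF w] by (simp add: j_def)
  moreover have "\<tau> permutes {1..m}" if "\<tau> permutes {1..Suc m}" "\<tau> (Suc m) = Suc m" for \<tau>
  proof -
    have "\<tau> x = x" if "x \<notin> {1..m}" for x
      using that \<open>\<tau> permutes {1..Suc m}\<close> \<open>\<tau> (Suc m) = Suc m\<close>
      by (cases "x = Suc m") (auto simp: permutes_def)
    then show ?thesis using that(1) unfolding permutes_def by blast
  qed
  ultimately have "inv ?w \<circ> \<sigma> permutes {1..m}" by blast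
  then obtain ks where ks: "set ks \<subseteq> {1..<m}" "perm_word ks = inv ?w \<circ> \<sigma>"
    using Suc.IH by blast
  have "perm_word ([j..<Suc m] @ ks) = \<sigma>"
    unfolding perm_word_append ks(2) comp_assoc[symmetric] permutes_inv_o(1)[OF w] by simp
  then show ?case
    using ks j by (intro exI[of _ "[j..<Suc m] @ ks"]) auto
qed

section \<open>Young's orthogonal form\<close>

definition yraw :: "nat \<Rightarrow> (tableau \<Rightarrow> real) \<Rightarrow> tableau \<Rightarrow> real" where
  "yraw k x S = yr k S * x S + yq k S * x (swap S k)"

text \<open>Acting as the identity off the standard tableaux makes the Coxeter relations true for
  all functions on the type \<open>tableau\<close>.\<close>

definition yop :: "nat \<Rightarrow> nat list \<Rightarrow> nat \<Rightarrow> (tableau \<Rightarrow> real) \<Rightarrow> tableau \<Rightarrow> real" where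
  "yop n \<nu> k x S = (if std_tableau n \<nu> S then yraw k x S else x S)"

lemma swap_swap [simp]: "swap (swap S k) k = S"
  by (simp add: comp_assoc)

text \<open>If \<open>swap S k\<close> is not standard its coefficient is zero, so agreement on
  standard tableaux suffices. Composites of \<open>yop\<close> thereby reduce to composites of the
  unconditional \<open>yraw\<close>.\<close>

lemma yop_eq_yraw:
  assumes "is_partition \<nu> n" "1 \<le> k" "k < n" "std_tableau n \<nu> S"
    and "\<And>S'. std_tableau n \<nu> S' \<Longrightarrow> x S' = y S'"
  shows "yop n \<nu> k x S = yraw k y S"
  using assms yq_nonzero_iff[OF assms(4,1,2,3)] by (cases "yq k S = 0") (auto simp: yop_def yraw_def)

lemma yraw_yraw_same: "yraw k (yraw k x) S = x S"
proof -
  have "yraw k (yraw k x) S = ((yr k S)\<^sup>2 + (yq k S)\<^sup>2) * x S"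
    by (simp add: yraw_def algebra_simps power2_eq_square)
  then show ?thesis by (simp add: yq_sq)
qed

lemma yraw_commute:
  assumes "Suc i < j"
  shows "yraw i (yraw j x) S = yraw j (yraw i x) S"
proof -
  have t: "transpose i (Suc i) j = j" "transpose i (Suc i) (Suc j) = Suc j"
    "transpose j (Suc j) i = i" "transpose j (Suc j) (Suc i) = Suc i"
    using assms by (auto simp: transpose_def)
  have "swap (swap S i) j = swap (swap S j) i"
    using assms by (auto simp: fun_eq_iff transpose_def)
  then show ?thesis
    by (simp add: yraw_def yq_def yr_def t algebra_simps)
qed

text \<open>Both sides are expanded over the six tableaux in the orbit of \<open>S\<close> and
  compared coefficientwise.\<close>

lemma yraw_braid:
  assumes "content S i \<noteq> content S (Suc i)" "content S (Suc i) \<noteq> content S (Suc (Suc i))"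
    "content S i \<noteq> content S (Suc (Suc i))"
  shows "yraw i (yraw (Suc i) (yraw i x)) S = yraw (Suc i) (yraw i (yraw (Suc i) x)) S"
proof -
  let ?s = "transpose i (Suc i)" and ?t = "transpose (Suc i) (Suc (Suc i))"
  define a b c where "a = 1 / real_of_int (content S (Suc i) - content S i)"
    and "b = 1 / real_of_int (content S (Suc (Suc i)) - content S (Suc i))"
    and "c = 1 / real_of_int (content S (Suc (Suc i)) - content S i)"
  define qa qb qc where "qa = sqrt (1 - a\<^sup>2)" and "qb = sqrt (1 - b\<^sup>2)" and "qc = sqrt (1 - c\<^sup>2)"
  \<comment> \<open>The content differences are the reciprocals and they add up: 1/c = 1/a +
    1/b.\<close>
  have key: "a * b = c * a + c * b"
    using assms by (simp add: a_def b_def c_def divide_simps)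
  have qa: "qa * qa = 1 - a * a"
    using yq_sq[of i S] by (simp add: yq_def yr_def qa_def a_def power2_eq_square)
  have qb: "qb * qb = 1 - b * b"
    using yq_sq[of "Suc i" S] by (simp add: yq_def yr_def qb_def b_def power2_eq_square)
  have t: "?s i = Suc i" "?s (Suc i) = i" "?s (Suc (Suc i)) = Suc (Suc i)"
    "?t i = i" "?t (Suc i) = Suc (Suc i)" "?t (Suc (Suc i)) = Suc i"
    by (simp_all add: transpose_def)
  have neg: "1 / real_of_int (content S i - content S (Suc i)) = - a"
    "1 / real_of_int (content S (Suc i) - content S (Suc (Suc i))) = - b"
    unfolding a_def b_def by (metis minus_diff_eq minus_divide_right of_int_minus)+
  have sts: "S \<circ> ?t \<circ> ?s \<circ> ?t = S \<circ> ?s \<circ> ?t \<circ> ?s"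
    by (auto simp: fun_eq_iff transpose_def)
  define X1 Xs Xt Xst Xts Xw where "X1 = x S" and "Xs = x (S \<circ> ?s)" and "Xt = x (S \<circ> ?t)"
    and "Xst = x (S \<circ> ?s \<circ> ?t)" and "Xts = x (S \<circ> ?t \<circ> ?s)" and "Xw = x (S \<circ> ?s \<circ> ?t \<circ> ?s)"
  have L: "yraw i (yraw (Suc i) (yraw i x)) S =
     a * (b * (a * X1 + qa * Xs) + qb * (c * Xt + qc * Xts)) + qa * (c * (- a * Xs + qa * X1) + qc * (b * Xst + qb * Xw))"
    unfolding yraw_def yq_def yr_def content_comp t swap_swap neg a_def[symmetric] b_def[symmetric] c_def[symmetric]
      power2_minus qa_def[symmetric] qb_def[symmetric] qc_def[symmetric]
    by (simp add: X1_def Xs_def Xt_def Xst_def Xts_def Xw_def)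
  have R: "yraw (Suc i) (yraw i (yraw (Suc i) x)) S =
     b * (a * (b * X1 + qb * Xt) + qa * (c * Xs + qc * Xst)) + qb * (c * (- b * Xt + qb * X1) + qc * (a * Xts + qa * Xw))"
    unfolding yraw_def yq_def yr_def content_comp t swap_swap neg a_def[symmetric] b_def[symmetric] c_def[symmetric]
      power2_minus qa_def[symmetric] qb_def[symmetric] qc_def[symmetric] sts
    by (simp add: X1_def Xs_def Xt_def Xst_def Xts_def Xw_def)
  have "a * b * a + (1 - a * a) * c = b * a * b + (1 - b * b) * c"
    using key by algebra
  then have "(a * b * a + qa * qa * c) * X1 = (b * a * b + qb * qb * c) * X1"
    by (simp add: qa qb)
  moreover have "(a * b * qa - qa * c * a) * Xs = b * qa * c * Xs" "a * qb * c * Xt = (b * a * qb - qb * c * b) * Xt"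
    using key by algebra+
  ultimately show ?thesis unfolding L R by (simp add: algebra_simps)
qed

lemma braid_rel_yop:
  assumes \<nu>: "is_partition \<nu> n"
  shows "braid_rel n (yop n \<nu>)"
proof -
  note raw = yop_eq_yraw[OF \<nu>]
  have non: "yop n \<nu> k x S = x S" if "\<not> std_tableau n \<nu> S" for k x S
    using that by (simp add: yop_def)
  show ?thesis
    unfolding braid_rel_def
  proof (intro conjI ballI impI)
    fix i assume i: "i \<in> {1..<n}"
    have "yop n \<nu> i (yop n \<nu> i x) S = x S" for x S
    proof (cases "std_tableau n \<nu> S")
      case True
      have "yop n \<nu> i (yop n \<nu> i x) S = yraw i (yraw i x) S"
        using i by (intro raw True) auto
      then show ?thesis by (simp add: yraw_yraw_same)
    qed (simp add: non)
    then show "yop n \<nu> i \<circ> yop n \<nu> i = id" by (simp add: fun_eq_iff)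
    show "yop n \<nu> i \<circ> yop n \<nu> j = yop n \<nu> j \<circ> yop n \<nu> i" if j: "j \<in> {1..<n}" "Suc i < j" for j
    proof -
      have "yop n \<nu> i (yop n \<nu> j x) S = yop n \<nu> j (yop n \<nu> i x) S" for x S
      proof (cases "std_tableau n \<nu> S")
        case True
        have "yop n \<nu> i (yop n \<nu> j x) S = yraw i (yraw j x) S" "yop n \<nu> j (yop n \<nu> i x) S = yraw j (yraw i x) S"
          using i j by (auto intro!: raw True)
        then show ?thesis using yraw_commute[OF j(2)] by simp
      qed (simp add: non)
      then show ?thesis by (simp add: fun_eq_iff)
    qed
    show "yop n \<nu> i \<circ> yop n \<nu> (Suc i) \<circ> yop n \<nu> i = yop n \<nu> (Suc i) \<circ> yop n \<nu> i \<circ> yop n \<nu> (Suc i)"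
      if "Suc i < n"
    proof -
      have "yop n \<nu> i (yop n \<nu> (Suc i) (yop n \<nu> i x)) S = yop n \<nu> (Suc i) (yop n \<nu> i (yop n \<nu> (Suc i) x)) S" for x S
      proof (cases "std_tableau n \<nu> S")
        case True
        have "yop n \<nu> i (yop n \<nu> (Suc i) (yop n \<nu> i x)) S = yraw i (yraw (Suc i) (yraw i x)) S"
          "yop n \<nu> (Suc i) (yop n \<nu> i (yop n \<nu> (Suc i) x)) S = yraw (Suc i) (yraw i (yraw (Suc i) x)) S"
          using i that by (auto intro!: raw True)
        then show ?thesis
          using i that content_neq[OF True \<nu>] by (simp add: yraw_braid)
      qed (simp add: non)
      then show ?thesis by (simp add: fun_eq_iff)
    qed
  qed
qed

lemma finite_std_tableaux [simp]: "finite (std_tableaux n \<nu>)"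
proof -
  have "cells \<nu> \<subseteq> (SIGMA l:{..<length \<nu>}. {..<\<nu> ! l})" by (auto simp: cells_def)
  then have "finite (cells \<nu>)" by (rule finite_subset) simp
  then have "finite {T :: tableau. \<forall>p. (p \<in> {1..n} \<longrightarrow> T p \<in> cells \<nu>) \<and> (p \<notin> {1..n} \<longrightarrow> T p = (0, 0))}"
    by (intro finite_set_of_finite_funs) auto
  then show ?thesis
    by (rule rev_finite_subset) (auto simp: std_tableaux_def std_tableau_def dest: bij_betwE)
qed

definition ydelta :: "tableau \<Rightarrow> tableau \<Rightarrow> real" where
  "ydelta S' S = (if S = S' then 1 else 0)"

text \<open>Column \<open>S'\<close> of a matrix product is the image of a basis vector, which
  trades sums over standard tableaux for the operators \<open>yop\<close>.\<close>

lemma yword_wact: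
  assumes \<nu>: "is_partition \<nu> n" and "set ks \<subseteq> {1..<n}" "std_tableau n \<nu> S"
  shows "yword n \<nu> ks S S' = wact (yop n \<nu>) ks (ydelta S') S"
  using assms(2,3)
proof (induction ks arbitrary: S)
  case Nil
  then show ?case by (simp add: ydelta_def)
next
  case (Cons k ks)
  then have k: "1 \<le> k" "k < n" and ks: "set ks \<subseteq> {1..<n}" by auto
  have ne: "swap S k \<noteq> S"
  proof
    assume "swap S k = S"
    then have "T k = T (Suc k)" if "T = S" for T using that by (metis comp_apply transpose_apply_first)
    then show False using std_inj[OF Cons.prems(2), of k "Suc k"] k by simp
  qed
  have "yword n \<nu> (k # ks) S S' = (\<Sum>R\<in>std_tableaux n \<nu>. yorth k S R * yword n \<nu> ks R S')"
    by (simp add: ymul_def)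
  also have "\<dots> = (\<Sum>R\<in>std_tableaux n \<nu>. (if R = S then yr k S * yword n \<nu> ks S S' else 0)
      + (if R = swap S k then yq k S * yword n \<nu> ks (swap S k) S' else 0))"
    using ne by (intro sum.cong refl) (auto simp: yorth_def yr_def yq_def Let_def)
  also have "\<dots> = yraw k (\<lambda>R. yword n \<nu> ks R S') S"
    using Cons.prems(2) yq_nonzero_iff[OF Cons.prems(2) \<nu> k]
    by (auto simp: sum.distrib std_tableaux_def[symmetric] yraw_def) (auto simp: std_tableaux_def)
  also have "\<dots> = yop n \<nu> k (wact (yop n \<nu>) ks (ydelta S')) S"
    by (rule yop_eq_yraw[symmetric, OF \<nu> k Cons.prems(2)]) (simp add: Cons.IH[OF ks])
  finally show ?case by simp
qed

text \<open>The word picked by \<open>SOME\<close> can be replaced by any word for the same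
  permutation, because \<open>yop\<close> satisfies the Coxeter relations.\<close>

lemma yrho_wact:
  assumes \<nu>: "is_partition \<nu> n" and "set ks \<subseteq> {1..<n}" "std_tableau n \<nu> S"
  shows "yrho n \<nu> (perm_word ks) S S' = wact (yop n \<nu>) ks (ydelta S') S"
proof -
  let ?ls = "SOME ls. set ls \<subseteq> {1..<n} \<and> perm_word ls = perm_word ks"
  have ls: "set ?ls \<subseteq> {1..<n}" "perm_word ?ls = perm_word ks"
    using someI_ex[OF perm_word_exists[OF perm_word_permutes[OF assms(2)]]] by auto
  show ?thesis
    unfolding yrho_def yword_wact[OF \<nu> ls(1) assms(3)] wact_eqI[OF braid_rel_yop[OF \<nu>] ls(1) assms(2) ls(2)] ..
qed

lemma yrho_left:
  assumes \<nu>: "is_partition \<nu> n" and \<sigma>: "\<sigma> permutes {1..n}" and k: "1 \<le> k" "k < n" and T: "std_tableau n \<nu> T"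
  shows "yrho n \<nu> (transpose k (Suc k) \<circ> \<sigma>) T S = yr k T * yrho n \<nu> \<sigma> T S + yq k T * yrho n \<nu> \<sigma> (swap T k) S"
proof -
  obtain ks where ks: "set ks \<subseteq> {1..<n}" "perm_word ks = \<sigma>" using perm_word_exists[OF \<sigma>] by blast
  have "yrho n \<nu> (transpose k (Suc k) \<circ> \<sigma>) T S = yop n \<nu> k (wact (yop n \<nu>) ks (ydelta S)) T"
    using yrho_wact[OF \<nu>, of "k # ks" T S] ks k T by simp
  also have "\<dots> = yraw k (\<lambda>R. yrho n \<nu> \<sigma> R S) T"
    by (rule yop_eq_yraw[OF \<nu> k T]) (simp add: yrho_wact[OF \<nu> ks(1)] ks(2)[symmetric])
  finally show ?thesis by (simp add: yraw_def)
qed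

lemma yop_linear:
  "yop n \<nu> k (\<lambda>R. a * x R + b * y R) S = a * yop n \<nu> k x S + b * yop n \<nu> k y S"
  by (simp add: yop_def yraw_def algebra_simps)

lemma wact_yop_linear:
  "wact (yop n \<nu>) ks (\<lambda>R. a * x R + b * y R) S = a * wact (yop n \<nu>) ks x S + b * wact (yop n \<nu>) ks y S"
proof (induction ks arbitrary: S)
  case (Cons k ks)
  have "wact (yop n \<nu>) ks (\<lambda>R. a * x R + b * y R) = (\<lambda>S. a * wact (yop n \<nu>) ks x S + b * wact (yop n \<nu>) ks y S)"
    using Cons.IH by blast
  then show ?case by (simp add: yop_linear)
qed simp

lemma yrho_right:
  assumes \<nu>: "is_partition \<nu> n" and \<sigma>: "\<sigma> permutes {1..n}" and k: "1 \<le> k" "k < n"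
    and T: "std_tableau n \<nu> T" and S: "std_tableau n \<nu> S"
  shows "yrho n \<nu> (\<sigma> \<circ> transpose k (Suc k)) T S = yr k S * yrho n \<nu> \<sigma> T S + yq k S * yrho n \<nu> \<sigma> T (swap S k)"
proof -
  obtain ks where ks: "set ks \<subseteq> {1..<n}" "perm_word ks = \<sigma>" using perm_word_exists[OF \<sigma>] by blast
  \<comment> \<open>Symmetry of the orthogonal form: \<open>yq\<close> takes the same value at
    \<open>S\<close> and at \<open>swap S k\<close>, so a column of the matrix equals the
    corresponding row.\<close>
  have "yop n \<nu> k (ydelta S) R = yr k S * ydelta S R + yq k S * ydelta (swap S k) R" for R
  proof (cases "std_tableau n \<nu> R")
    case True
    have "yq k R * ydelta S (swap R k) = yq k S * ydelta (swap S k) R"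
    proof (cases "R = swap S k")
      case False
      then have "swap R k \<noteq> S" by auto
      then show ?thesis using False by (simp add: ydelta_def)
    qed (simp add: ydelta_def)
    moreover have "yr k R * ydelta S R = yr k S * ydelta S R" by (simp add: ydelta_def)
    ultimately show ?thesis using True by (simp add: yop_def yraw_def)
  next
    case False
    then show ?thesis
      using S yq_nonzero_iff[OF S \<nu> k] by (auto simp: yop_def ydelta_def)
  qed
  then have *: "yop n \<nu> k (ydelta S) = (\<lambda>R. yr k S * ydelta S R + yq k S * ydelta (swap S k) R)" by blast
  have "yrho n \<nu> (\<sigma> \<circ> transpose k (Suc k)) T S = wact (yop n \<nu>) ks (yop n \<nu> k (ydelta S)) T"
    using yrho_wact[OF \<nu>, of "ks @ [k]" T S] ks k T by (simp add: perm_word_append wact_append)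
  also have "\<dots> = yr k S * wact (yop n \<nu>) ks (ydelta S) T + yq k S * wact (yop n \<nu>) ks (ydelta (swap S k)) T"
    unfolding * by (rule wact_yop_linear)
  finally show ?thesis by (simp add: yrho_wact[OF \<nu> ks(1) T] ks(2)[symmetric])
qed

abbreviation scr :: "real \<Rightarrow> oper" where "scr x \<equiv> sc (of_real x)"

text \<open>The matrix units of the group algebra up to normalisation; \<open>Em n \<nu> T T\<close> is proportional to \<open>Y\<^sub>T\<close>.\<close>
definition Em :: "nat \<Rightarrow> nat list \<Rightarrow> tableau \<Rightarrow> tableau \<Rightarrow> oper" where
  "Em n \<nu> S T = (\<Sum>\<sigma> | \<sigma> permutes {1..n}. scr (yrho n \<nu> \<sigma> T S) * Pm (inv \<sigma>))"

text \<open>Reindexing the sum by left multiplication with the transposition moves it into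
  \<open>yrho\<close>, where \<open>yrho_left\<close> acts on the first index; this works because
  \<open>Em\<close> pairs \<open>yrho\<close> with the inverse permutation.\<close>

lemma Em_right:
  assumes \<nu>: "is_partition \<nu> n" and k: "1 \<le> k" "k < n" and T: "std_tableau n \<nu> T"
  shows "Em n \<nu> S T * Pm (transpose k (Suc k)) = scr (yr k T) * Em n \<nu> S T + scr (yq k T) * Em n \<nu> S (swap T k)"
proof -
  let ?s = "transpose k (Suc k)"
  have s: "?s permutes {1..n}" using k by (intro permutes_swap_id) auto
  have "Em n \<nu> S T * Pm ?s = (\<Sum>\<sigma> | \<sigma> permutes {1..n}. scr (yrho n \<nu> \<sigma> T S) * Pm (inv \<sigma> \<circ> ?s))"
    by (simp add: Em_def sum_distrib_right mult.assoc Pm_mult)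
  also have "\<dots> = (\<Sum>\<sigma> | \<sigma> permutes {1..n}. scr (yrho n \<nu> (?s \<circ> \<sigma>) T S) * Pm (inv (?s \<circ> \<sigma>) \<circ> ?s))"
    by (rule setum_permutations_compose_left[OF s])
  also have "\<dots> = (\<Sum>\<sigma> | \<sigma> permutes {1..n}. scr (yr k T) * (scr (yrho n \<nu> \<sigma> T S) * Pm (inv \<sigma>))
      + scr (yq k T) * (scr (yrho n \<nu> \<sigma> (swap T k) S) * Pm (inv \<sigma>)))"
  proof (rule sum.cong[OF refl])
    fix \<sigma> assume "\<sigma> \<in> {\<sigma>. \<sigma> permutes {1..n}}"
    then have \<sigma>: "\<sigma> permutes {1..n}" by simp
    have "inv (?s \<circ> \<sigma>) \<circ> ?s = inv \<sigma>"
      using permutes_bij[OF \<sigma>] by (simp add: o_inv_distrib comp_assoc)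
    then show "scr (yrho n \<nu> (?s \<circ> \<sigma>) T S) * Pm (inv (?s \<circ> \<sigma>) \<circ> ?s)
      = scr (yr k T) * (scr (yrho n \<nu> \<sigma> T S) * Pm (inv \<sigma>))
      + scr (yq k T) * (scr (yrho n \<nu> \<sigma> (swap T k) S) * Pm (inv \<sigma>))"
      by (simp add: yrho_left[OF \<nu> \<sigma> k T] sc_add sc_mult distrib_right mult.assoc)
  qed
  finally show ?thesis by (simp add: Em_def sum.distrib sum_distrib_left)
qed

lemma Em_left:
  assumes \<nu>: "is_partition \<nu> n" and k: "1 \<le> k" "k < n" and T: "std_tableau n \<nu> T" and S: "std_tableau n \<nu> S"
  shows "Pm (transpose k (Suc k)) * Em n \<nu> S T = scr (yr k S) * Em n \<nu> S T + scr (yq k S) * Em n \<nu> (swap S k) T"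
proof -
  let ?s = "transpose k (Suc k)"
  have s: "?s permutes {1..n}" using k by (intro permutes_swap_id) auto
  have "Pm ?s * Em n \<nu> S T = (\<Sum>\<sigma> | \<sigma> permutes {1..n}. scr (yrho n \<nu> \<sigma> T S) * Pm (?s \<circ> inv \<sigma>))"
    by (simp add: Em_def sum_distrib_left mult.assoc[symmetric] sc_comm[of "Pm ?s"])
       (simp add: mult.assoc Pm_mult)
  also have "\<dots> = (\<Sum>\<sigma> | \<sigma> permutes {1..n}. scr (yrho n \<nu> (\<sigma> \<circ> ?s) T S) * Pm (?s \<circ> inv (\<sigma> \<circ> ?s)))"
    by (rule sum_permutations_compose_right[OF s])
  also have "\<dots> = (\<Sum>\<sigma> | \<sigma> permutes {1..n}. scr (yr k S) * (scr (yrho n \<nu> \<sigma> T S) * Pm (inv \<sigma>))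
      + scr (yq k S) * (scr (yrho n \<nu> \<sigma> T (swap S k)) * Pm (inv \<sigma>)))"
  proof (rule sum.cong[OF refl])
    fix \<sigma> assume "\<sigma> \<in> {\<sigma>. \<sigma> permutes {1..n}}"
    then have \<sigma>: "\<sigma> permutes {1..n}" by simp
    have "?s \<circ> inv (\<sigma> \<circ> ?s) = inv \<sigma>"
      using permutes_bij[OF \<sigma>] by (simp add: o_inv_distrib comp_assoc[symmetric])
    then show "scr (yrho n \<nu> (\<sigma> \<circ> ?s) T S) * Pm (?s \<circ> inv (\<sigma> \<circ> ?s))
      = scr (yr k S) * (scr (yrho n \<nu> \<sigma> T S) * Pm (inv \<sigma>))
      + scr (yq k S) * (scr (yrho n \<nu> \<sigma> T (swap S k)) * Pm (inv \<sigma>))"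
      by (simp add: yrho_right[OF \<nu> \<sigma> k T S] sc_add sc_mult distrib_right mult.assoc)
  qed
  finally show ?thesis by (simp add: Em_def sum.distrib sum_distrib_left)
qed

section \<open>The exchange property of the fused products\<close>

lemma content_1:
  assumes T: "std_tableau n \<nu> T" and \<nu>: "is_partition \<nu> n" and n: "1 \<le> n"
  shows "content T 1 = 0"
proof -
  obtain l k where lk: "T 1 = (l, k)" by fastforce
  have "T 1 \<in> cells \<nu>" using T n by (auto simp: std_tableau_def bij_betw_def)
  then have "(0, 0) \<in> cells \<nu>" using cells_down[OF \<nu>] lk by (metis le0)
  then obtain r where r: "r \<in> {1..n}" "T r = (0, 0)"
    using T unfolding std_tableau_def bij_betw_def by (metis imageE)
  have "r = 1" using std_less[OF T r(1), of 1] r n by fastforce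
  then show ?thesis using r by (simp add: content_def)
qed

abbreviation cont :: "tableau \<Rightarrow> nat \<Rightarrow> complex" where
  "cont T p \<equiv> of_int (content T p)"

text \<open>\<open>L j\<close> and \<open>X j\<close> stand for the left or right action of the adjacent transposition \<open>s\<^sub>j\<close> and of
  the Jucys-Murphy element \<open>(1 j) + \<dots> + (j-1 j)\<close>.\<close>
lemma jucys_murphy:
  fixes L X :: "nat \<Rightarrow> oper \<Rightarrow> oper"
  assumes \<nu>: "is_partition \<nu> n" and K: "K \<le> n"
    and L_lin: "\<And>j x y a b. L j (sc a * x + sc b * y) = sc a * L j x + sc b * L j y"
    and X_lin: "\<And>j x y a b. X j (sc a * x + sc b * y) = sc a * X j x + sc b * X j y"
    and X1: "\<And>x. X 1 x = 0"
    and XS: "\<And>j x. 1 \<le> j \<Longrightarrow> X (Suc j) x = L j (X j (L j x)) + L j x"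
    and v: "\<And>T j. std_tableau n \<nu> T \<Longrightarrow> 1 \<le> j \<Longrightarrow> j < K \<Longrightarrow>
      L j (v T) = scr (yr j T) * v T + scr (yq j T) * v (swap T j)"
    and T: "std_tableau n \<nu> T" and j: "1 \<le> j" "j \<le> K"
  shows "X j (v T) = sc (cont T j) * v T"
  using j T
proof (induction j arbitrary: T rule: dec_induct)
  case base
  then show ?case using content_1[OF _ \<nu>] K j by (simp add: X1[simplified])
next
  case (step j)
  let ?T = "swap T j" and ?c = "cont T j" and ?d = "cont T (Suc j)"
  define r q :: complex where "r = of_real (yr j T)" and "q = of_real (yq j T)"
  have jn: "1 \<le> j" "j < n" "j < K" using step K by auto
  have q: "q \<noteq> 0 \<Longrightarrow> std_tableau n \<nu> ?T"
    using yq_nonzero_iff[OF step.prems(2) \<nu> jn(1,2)] by (simp add: q_def)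
  have vT: "L j (v T) = sc r * v T + sc q * v ?T"
    using v[OF step.prems(2) jn(1,3)] by (simp add: r_def q_def)
  \<comment> \<open>For \<open>q = 0\<close> the swapped tableau is not standard and the induction
    hypothesis does not apply, but both sides vanish.\<close>
  have qX: "sc q * X j (v ?T) = sc q * (sc ?d * v ?T)"
  proof (cases "q = 0")
    case False
    have "X j (v ?T) = sc (cont ?T j) * v ?T"
      by (rule step.IH[OF _ q[OF False]]) (use jn in simp)
    then show ?thesis by (simp only: content_comp transpose_apply_first)
  qed simp
  have qL: "sc z * (sc q * L j (v ?T)) = sc z * (sc q * (sc (- r) * v ?T + sc q * v T))" for z
  proof (cases "q = 0")
    case False
    have "L j (v ?T) = scr (yr j ?T) * v ?T + scr (yq j ?T) * v (swap ?T j)"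
      by (rule v[OF q[OF False] jn(1,3)])
    then show ?thesis by (simp only: r_def q_def yr_swap yq_swap swap_swap of_real_minus)
  qed simp
  have "cont T (Suc j) - cont T j \<noteq> 0"
    using content_neq[OF step.prems(2) \<nu>, of j "Suc j"] jn by simp
  then have rd: "r * (?d - ?c) = 1"
    by (simp add: r_def yr_def)
  have qq: "q * q = 1 - r * r"
    unfolding q_def r_def using yq_sq[of j T] by (metis of_real_1 of_real_diff of_real_mult power2_eq_square)
  have "X j (L j (v T)) = sc (r * ?c) * v T + sc (?d * q) * v ?T"
    using qX step.IH[OF _ step.prems(2)] jn
    by (simp add: vT X_lin sc_mult mult.assoc mult.commute[of ?d])
  then have "X (Suc j) (v T) = sc (r * ?c) * L j (v T) + sc ?d * (sc q * L j (v ?T)) + L j (v T)"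
    using XS[OF jn(1)] L_lin[of j _ _ 0 0] by (simp add: L_lin sc_mult[of ?d] mult.assoc)
  also have "\<dots> = (sc (r * ?c) * sc r + sc ?d * sc q * sc q + sc r) * v T
      + (sc (r * ?c) * sc q + sc ?d * sc q * sc (- r) + sc q) * v ?T"
    unfolding qL vT by (simp add: algebra_simps)
  also have "\<dots> = sc (r * ?c * r + ?d * (q * q) + r) * v T + sc (q * (1 - r * (?d - ?c))) * v ?T"
    by (simp only: sc_mult[symmetric] sc_add[symmetric] algebra_simps) (simp add: algebra_simps)
  \<comment> \<open>From \<open>r * (?d - ?c) = 1\<close> and q^2 = 1 - r^2; the same relation kills
    the coefficient of the swapped vector.\<close>
  also have "r * ?c * r + ?d * (q * q) + r = ?d"
    using rd unfolding qq by algebra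
  finally show ?case by (simp add: rd)
qed

context tensor_space
begin

lemma Xm_Suc: "1 \<le> j \<Longrightarrow> Xm (Suc j) = S j * Xm j * S j + S j"
proof -
  assume j: "1 \<le> j"
  have "S j * Pm (transpose q j) * S j = Pm (transpose q (Suc j))" if "q \<in> {1..<j}" for q
    unfolding Pm_mult using that by (intro arg_cong[of _ _ Pm]) (auto simp: fun_eq_iff transpose_def)
  then have "S j * Xm j * S j = (\<Sum>q\<in>{1..<j}. Pm (transpose q (Suc j)))"
    by (simp add: Xm_def sum_distrib_left sum_distrib_right)
  then show ?thesis using j by (simp add: Xm_def)
qed

text \<open>\<open>K\<close> bounds the range of known exchanges: a product of \<open>K\<close>
  factors is only known to exchange for \<open>j < K\<close>, which still evaluates every
  \<open>Xm j\<close> with \<open>j \<le> K\<close>.\<close>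

lemma Xm_right:
  assumes "is_partition \<nu> n" "K \<le> n"
    and "\<And>T j. std_tableau n \<nu> T \<Longrightarrow> 1 \<le> j \<Longrightarrow> j < K \<Longrightarrow>
      v T * S j = scr (yr j T) * v T + scr (yq j T) * v (swap T j)"
    and "std_tableau n \<nu> T" "1 \<le> j" "j \<le> K"
  shows "v T * Xm j = sc (cont T j) * v T"
  by (rule jucys_murphy[where L = "\<lambda>j x. x * S j" and X = "\<lambda>j x. x * Xm j", OF assms(1,2) _ _ _ _ assms(3-6)])
     (auto simp: Xm_Suc Xm_def[of "Suc 0"] distrib_left distrib_right mult.assoc)

lemma Xm_left:
  assumes "is_partition \<nu> n" "K \<le> n"
    and "\<And>T j. std_tableau n \<nu> T \<Longrightarrow> 1 \<le> j \<Longrightarrow> j < K \<Longrightarrow>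
      S j * v T = scr (yr j T) * v T + scr (yq j T) * v (swap T j)"
    and "std_tableau n \<nu> T" "1 \<le> j" "j \<le> K"
  shows "Xm j * v T = sc (cont T j) * v T"
  by (rule jucys_murphy[where L = "\<lambda>j x. S j * x" and X = "\<lambda>j x. Xm j * x", OF assms(1,2) _ _ _ _ assms(3-6)])
     (auto simp: Xm_Suc Xm_def[of "Suc 0"] distrib_left distrib_right mult.assoc sc_comm[THEN assoc_rule])

text \<open>Both \<open>j\<close> and \<open>Suc j\<close> lie on the same side of \<open>p\<close>,
  so the transposition fixes \<open>p\<close> and permutes the summands of
  \<open>Jm p\<close>.\<close>

lemma Fac_commute:
  assumes "1 \<le> j" "j < n" "p \<in> {1..n}" "j \<noteq> p" "Suc j \<noteq> p"
  shows "Fac u c p * S j = S j * Fac u c p"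
proof -
  let ?s = "transpose j (Suc j)"
  have s: "?s permutes {1..n}" using assms by (intro permutes_swap_id) auto
  have p: "?s p = p" using assms by (simp add: transpose_def)
  have F: "S j * F p = F p * S j" using P_F[OF s, of p] p by simp
  have "S j * Jm p = (\<Sum>q\<in>{1..<p}. Q (?s q) p * S j)"
    using P_Q[OF s] p by (simp add: Jm_def sum_distrib_left)
  also have "\<dots> = (\<Sum>q\<in>{1..<p}. Q q p * S j)"
    by (rule sum.reindex_bij_witness[of _ ?s ?s]) (use assms in \<open>auto simp: transpose_def split: if_splits\<close>)
  finally have J: "S j * Jm p = Jm p * S j"
    by (simp add: Jm_def sum_distrib_right)
  have "S j * (sc x + Jm p) = (sc x + Jm p) * S j" "S j * (F p - sc x) = (F p - sc x) * S j" for x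
    by (simp_all add: distrib_left distrib_right left_diff_distrib right_diff_distrib J F sc_comm[of "S j"])
  then show ?thesis unfolding Fac_def by (metis mult.assoc)
qed

text \<open>The product m_RT cut off after \<open>k\<close> factors; the contents are those of
  \<open>T\<close>, the index on which right multiplication acts.\<close>

primrec mk :: "complex \<Rightarrow> nat list \<Rightarrow> tableau \<Rightarrow> tableau \<Rightarrow> nat \<Rightarrow> oper" where
  "mk u \<nu> R T 0 = Em n \<nu> R T"
| "mk u \<nu> R T (Suc k) = mk u \<nu> R T k * Fac u (cont T (Suc k)) (Suc k)"

text \<open>The case \<open>j = k\<close> is excluded because \<open>S k\<close> also involves the
  factor \<open>k + 1\<close>, still missing there. For \<open>j = k - 1\<close> the last two
  factors are exchanged together: the claim for \<open>k - 2\<close> supplies the relation for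
  \<open>M\<close>, and the claim for \<open>k - 1\<close> evaluates \<open>Xm\<close>. For other
  \<open>j\<close> the last factor commutes with \<open>S j\<close>.\<close>

lemma mk_swap:
  assumes \<nu>: "is_partition \<nu> n" and u: "\<And>z :: int. 2 * u \<noteq> of_int z"
    and "std_tableau n \<nu> T" "1 \<le> j" "j < n" "j \<noteq> k" "k \<le> n"
  shows "mk u \<nu> R T k * S j = scr (yr j T) * mk u \<nu> R T k + scr (yq j T) * mk u \<nu> R (swap T j) k"
  using assms(3-)
proof (induction k arbitrary: T j rule: less_induct)
  case (less k)
  show ?case
  proof (cases k)
    case 0
    then show ?thesis using Em_right[OF \<nu> less.prems(2,3,1)] by (simp del: o_apply)
  next
    case (Suc p)
    show ?thesis
    proof (cases "j = p")
      case False
      let ?X = "Fac u (cont T k) k"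
      have c: "content (swap T j) (Suc p) = content T (Suc p)"
        using False less.prems Suc by (simp add: transpose_def)
      have "mk u \<nu> R T k * S j = mk u \<nu> R T p * S j * ?X"
        using Fac_commute[OF less.prems(2,3), of k] less.prems False Suc by (simp add: mult.assoc)
      also have "\<dots> = scr (yr j T) * (mk u \<nu> R T p * ?X) + scr (yq j T) * (mk u \<nu> R (swap T j) p * ?X)"
        using less.IH[of p T j] less.prems False Suc by (simp add: distrib_right mult.assoc del: o_apply)
      finally show ?thesis using Suc c by (simp del: o_apply)
    next
      case True
      then obtain m where m: "p = Suc m" using less.prems(2) by (cases p) auto
      define a b where "a = cont T p" and "b = cont T (Suc p)"
      have p: "1 \<le> p" "p < n" using less.prems True by auto
      have ab: "b \<noteq> a" using content_neq[OF less.prems(1) \<nu>, of p "Suc p"] p by (auto simp: a_def b_def)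
      have g: "2 * u + a + b \<noteq> 0"
      proof
        assume "2 * u + a + b = 0"
        then have "2 * u = - (a + b)" by algebra
        then show False using u[of "- (content T p + content T (Suc p))"] by (simp add: a_def b_def)
      qed
      have r: "scr (yr p T) = sc (1 / (b - a))" by (simp add: yr_def a_def b_def)
      have X: "mk u \<nu> R T' p * Xm p = sc (cont T' p) * mk u \<nu> R T' p" if "std_tableau n \<nu> T'" for T'
        by (rule Xm_right[OF \<nu>, of p]) (use that p less.IH[of p] Suc in auto)
      have M: "mk u \<nu> R T m * S p = sc (1 / (b - a)) * mk u \<nu> R T m + scr (yq p T) * mk u \<nu> R (swap T p) m"
        using less.IH[of m T p] less.prems(1) p Suc m r by (simp del: o_apply)
      have "mk u \<nu> R T m * Fac u a p * Fac u b (Suc p) * S p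
        = sc (1 / (b - a)) * (mk u \<nu> R T m * Fac u a p * Fac u b (Suc p))
        + scr (yq p T) * (mk u \<nu> R (swap T p) m * Fac u b p * Fac u a (Suc p))"
      proof (rule swap_step[OF p ab g M])
        show "mk u \<nu> R T m * Fac u a p * Xm p = sc a * (mk u \<nu> R T m * Fac u a p)"
          using X[OF less.prems(1)] by (simp add: m a_def)
        assume "complex_of_real (yq p T) \<noteq> 0"
        then have "std_tableau n \<nu> (swap T p)"
          using yq_nonzero_iff[OF less.prems(1) \<nu> p] by simp
        from X[OF this] show "mk u \<nu> R (swap T p) m * Fac u b p * Xm p = sc b * (mk u \<nu> R (swap T p) m * Fac u b p)"
          by (simp add: m b_def del: o_apply)
      qed
      then show ?thesis using True Suc m r by (simp add: a_def b_def del: o_apply)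
    qed
  qed
qed

end

section \<open>Independence of the trace from the tableau\<close>

text \<open>Polynomial dependence on \<open>u\<close> along the sequence \<open>u + j h\<close>; it removes the assumption that
  \<open>2u\<close> is not an integer.\<close>
primrec polyseq :: "nat \<Rightarrow> (nat \<Rightarrow> 'a::ab_group_add) \<Rightarrow> bool" where
  "polyseq 0 f \<longleftrightarrow> (\<forall>j. f (Suc j) = f j)"
| "polyseq (Suc m) f \<longleftrightarrow> polyseq m (\<lambda>j. f (Suc j) - f j)"

lemma polyseq_const: "polyseq m (\<lambda>j. c)"
proof (induction m arbitrary: c)
  case (Suc m)
  then show ?case using Suc[of 0] by simp
qed simp

lemma polyseq_add: "polyseq m f \<Longrightarrow> polyseq m g \<Longrightarrow> polyseq m (\<lambda>j. f j + g j)"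
proof (induction m arbitrary: f g)
  case (Suc m)
  then have "polyseq m (\<lambda>j. (f (Suc j) - f j) + (g (Suc j) - g j))" by simp
  then show ?case by (simp add: algebra_simps)
qed simp

lemma polyseq_diff: "polyseq m f \<Longrightarrow> polyseq m g \<Longrightarrow> polyseq m (\<lambda>j. f j - g j)"
proof (induction m arbitrary: f g)
  case (Suc m)
  then have "polyseq m (\<lambda>j. (f (Suc j) - f j) - (g (Suc j) - g j))" by simp
  then show ?case by (simp add: algebra_simps)
qed simp

lemma polyseq_shift: "polyseq m f \<Longrightarrow> polyseq m (\<lambda>j. f (Suc j))"
  by (induction m arbitrary: f) simp_all

text \<open>Discrete Leibniz rule: in each summand the difference lowers the degree of one factor,
  or annihilates it if that degree is 0.\<close>

lemma polyseq_mult: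
  fixes f g :: "nat \<Rightarrow> 'a::ring"
  shows "polyseq m f \<Longrightarrow> polyseq k g \<Longrightarrow> polyseq (m + k) (\<lambda>j. f j * g j)"
proof (induction "m + k" arbitrary: m k f g)
  case 0
  then show ?case by simp
next
  case (Suc d)
  have diff: "f (Suc j) * g (Suc j) - f j * g j = (f (Suc j) - f j) * g (Suc j) + f j * (g (Suc j) - g j)" for j
    by (simp add: algebra_simps)
  have 1: "polyseq d (\<lambda>j. (f (Suc j) - f j) * g (Suc j))"
  proof (cases m)
    case 0
    then show ?thesis using Suc.prems(1) polyseq_const[of d 0] by simp
  next
    case (Suc m')
    then show ?thesis
      using Suc.hyps(1)[of m' k] Suc.hyps(2) Suc.prems polyseq_shift[of k g] by simp
  qed
  have 2: "polyseq d (\<lambda>j. f j * (g (Suc j) - g j))"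
  proof (cases k)
    case 0
    then show ?thesis using Suc.prems(2) polyseq_const[of d 0] by simp
  next
    case (Suc k')
    then show ?thesis
      using Suc.hyps(1)[of m k'] Suc.hyps(2) Suc.prems by simp
  qed
  show ?case
    unfolding Suc.hyps(2)[symmetric] polyseq.simps diff by (rule polyseq_add[OF 1 2])
qed

lemma polyseq_additive:
  assumes "\<And>x y. h (x - y) = h x - h y" "polyseq m f"
  shows "polyseq m (\<lambda>j. h (f j))"
  using assms(2) by (induction m arbitrary: f) (simp_all add: assms(1)[symmetric])

text \<open>Extrapolation backwards: the differences vanish from index 1 on as well, and the
  induction ends at a constant sequence. No division occurs, so it works in any abelian
  group.\<close>

lemma polyseq_vanish: "polyseq m f \<Longrightarrow> (\<And>j. 1 \<le> j \<Longrightarrow> f j = 0) \<Longrightarrow> f 0 = 0"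
proof (induction m arbitrary: f)
  case 0
  then show ?case by (metis One_nat_def order_refl polyseq.simps(1))
next
  case (Suc m)
  have "f (Suc 0) - f 0 = 0"
    by (rule Suc.IH[of "\<lambda>j. f (Suc j) - f j"]) (use Suc.prems in simp_all)
  then show ?case using Suc.prems(2)[of 1] by simp
qed

section \<open>The trace with values in U(g), and its invariance under swaps\<close>

context tensor_space
begin

definition lst :: "(nat \<Rightarrow> int) \<Rightarrow> int list" where
  "lst a = map a [1..<Suc n]"

lemma lst_nth [simp]: "i < n \<Longrightarrow> lst a ! i = a (Suc i)"
  by (simp add: lst_def)

lemma length_lst [simp]: "length (lst a) = n"
  by (simp add: lst_def)

lemma bij_lst: "bij_betw lst (Adx N n) (midx N n)"
proof (rule bij_betw_byWitness[where f' = "\<lambda>b p. if p \<in> {1..n} then b ! (p - 1) else 0"])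
  show "\<forall>a\<in>Adx N n. (\<lambda>p. if p \<in> {1..n} then lst a ! (p - 1) else 0) = a"
    by (auto simp: Adx_def fun_eq_iff)
  show "\<forall>b\<in>midx N n. lst (\<lambda>p. if p \<in> {1..n} then b ! (p - 1) else 0) = b"
  proof
    fix b assume "b \<in> midx N n"
    then have "length b = n" by (simp add: midx_def)
    then show "lst (\<lambda>p. if p \<in> {1..n} then b ! (p - 1) else 0) = b" by (intro nth_equalityI) simp_all
  qed
  show "lst ` Adx N n \<subseteq> midx N n"
    by (auto simp: midx_def lst_def Adx_def)
  show "(\<lambda>b p. if p \<in> {1..n} then b ! (p - 1) else 0) ` midx N n \<subseteq> Adx N n"
    by (auto simp: midx_def Adx_def intro!: subsetD[OF _ nth_mem])
qed

lemma finite_midx: "finite (midx N n)"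
proof -
  have "midx N n = {a. set a \<subseteq> Iset N \<and> length a = n}" by (auto simp: midx_def)
  then show ?thesis using finite_lists_length_eq[OF finite_Iset] by simp
qed

lemma finite_Adx [simp]: "finite (Adx N n)"
  using bij_betw_finite[OF bij_lst] finite_midx by blast

lemma sum_midx: "(\<Sum>b\<in>midx N n. h b) = (\<Sum>b\<in>Adx N n. h (lst b))"
  using sum.reindex_bij_betw[OF bij_lst, of h] by simp

lemma lst_eq_iff: "a \<in> Adx N n \<Longrightarrow> b \<in> Adx N n \<Longrightarrow> lst a = lst b \<longleftrightarrow> a = b"
  using bij_lst by (auto simp: bij_betw_def inj_on_eq_iff)

definition tr :: "oper \<Rightarrow> uea" where
  "tr A = (\<Sum>a\<in>Adx N n. app A (\<lambda>b. if b = a then 1 else 0) a)"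

lemma tr_add: "tr (A + B) = tr A + tr B"
  by (simp add: tr_def sum.distrib)

lemma tr_diff: "tr (A - B) = tr A - tr B"
  by (simp add: tr_def sum_subtractf)

lemma tr_scale: "tr (sc c * A) = uc c * tr A"
  by (simp add: tr_def sum_distrib_left)

lemma tr_sum: "tr (\<Sum>i\<in>K. A i) = (\<Sum>i\<in>K. tr (A i))"
  by (induction K rule: infinite_finite_induct) (simp_all add: tr_add, simp_all add: tr_def)

text \<open>Cyclicity holds here because \<open>Pm \<sigma>\<close> only relabels indices; it would
  fail for operators with noncommuting entries.\<close>

lemma tr_Pm_cyclic:
  assumes \<sigma>: "\<sigma> permutes {1..n}"
  shows "tr (Pm \<sigma> * A) = tr (A * Pm \<sigma>)"
proof -
  have "tr (A * Pm \<sigma>) = (\<Sum>a\<in>Adx N n. app A (\<lambda>b. if b \<circ> \<sigma> = a then 1 else 0) a)"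
  proof -
    have "app (Pm \<sigma>) (\<lambda>b. if b = a then 1 else 0) = (\<lambda>b. if b \<circ> \<sigma> = a then 1 else 0)" for a by auto
    then show ?thesis by (simp add: tr_def)
  qed
  also have "\<dots> = (\<Sum>a\<in>Adx N n. app A (\<lambda>b. if b \<circ> \<sigma> = a \<circ> \<sigma> then 1 else 0) (a \<circ> \<sigma>))"
    by (rule sum.reindex_bij_witness[of _ "\<lambda>a. a \<circ> \<sigma>" "\<lambda>a. a \<circ> inv \<sigma>"])
       (use \<sigma> permutes_inv[OF \<sigma>] in \<open>simp_all add: Adx_perm comp_assoc permutes_inv_o\<close>)
  also have "\<dots> = tr (Pm \<sigma> * A)"
  proof -
    have "b \<circ> \<sigma> = a \<circ> \<sigma> \<longleftrightarrow> b = a" for a b :: "nat \<Rightarrow> int"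
      using permutes_surj[OF \<sigma>] by (metis surj_fun_eq)
    then show ?thesis by (simp add: tr_def)
  qed
  finally show ?thesis by simp
qed

lemma tr_Xm_cyclic: "1 \<le> j \<Longrightarrow> j \<le> n \<Longrightarrow> tr (Xm j * A) = tr (A * Xm j)"
  unfolding Xm_def sum_distrib_left sum_distrib_right tr_sum
  by (intro sum.cong refl tr_Pm_cyclic permutes_swap_id) auto

lemma mk_left:
  assumes "is_partition \<nu> n" "1 \<le> j" "j < n" "std_tableau n \<nu> T" "std_tableau n \<nu> R"
  shows "S j * mk u \<nu> R T k = scr (yr j R) * mk u \<nu> R T k + scr (yq j R) * mk u \<nu> (swap R j) T k"
proof (induction k)
  case 0
  then show ?case using Em_left[OF assms] by (simp del: o_apply)
next
  case (Suc k)
  then show ?case by (simp add: mult.assoc[symmetric] distrib_right del: o_apply)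
qed

lemma tr_mk_swap:
  assumes \<nu>: "is_partition \<nu> n" and u: "\<And>z :: int. 2 * u \<noteq> of_int z"
    and T: "std_tableau n \<nu> T" and T': "std_tableau n \<nu> (swap T j)" and j: "1 \<le> j" "j < n"
  shows "tr (mk u \<nu> (swap T j) (swap T j) n) = tr (mk u \<nu> T T n)"
proof -
  let ?T = "swap T j" and ?m = "mk u \<nu> (swap T j) T n"
  have unit: "x = 0" if "uc z * x = 0" "z \<noteq> 0" for z x
  proof -
    have "uc (1 / z) * (uc z * x) = x" using that(2) by (simp add: mult.assoc[symmetric] uc_mult[symmetric])
    then show ?thesis using that(1) by simp
  qed
  \<comment> \<open>On the right \<open>Xm j\<close> sees the content of \<open>j\<close> in
    \<open>T\<close>, on the left its content in the swapped tableau, which is that of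
    \<open>Suc j\<close> in \<open>T\<close>; the two differ.\<close>
  have "?m * Xm j = sc (cont T j) * ?m"
    by (rule Xm_right[OF \<nu>, of n "\<lambda>R. mk u \<nu> (swap T j) R n"])
       (use j T mk_swap[OF \<nu> u] in auto)
  moreover have "Xm j * ?m = sc (cont ?T j) * ?m"
    by (rule Xm_left[OF \<nu>, of n "\<lambda>R. mk u \<nu> R T n"])
       (use j T T' mk_left[OF \<nu>] in auto)
  ultimately have "uc (cont ?T j) * tr ?m = uc (cont T j) * tr ?m"
    using tr_Xm_cyclic[of j ?m] j by (simp add: tr_scale)
  then have "uc (cont ?T j + - cont T j) * tr ?m = 0"
    by (simp only: uc_add uc_minus distrib_right) simp
  moreover have "cont ?T j + - cont T j \<noteq> 0"
    using content_neq[OF T \<nu>, of j "Suc j"] j by simp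
  ultimately have 0: "tr ?m = 0" by (rule unit)
  have "tr (?m * S j) = uc (of_real (yq j T)) * tr (mk u \<nu> ?T ?T n)"
    using mk_swap[OF \<nu> u T j] j 0 by (simp add: tr_add tr_scale)
  moreover have "tr (S j * ?m) = uc (of_real (yq j T)) * tr (mk u \<nu> T T n)"
    using mk_left[OF \<nu> j T T'] 0 by (simp add: tr_add tr_scale)
  moreover have "tr (S j * ?m) = tr (?m * S j)"
    using j by (intro tr_Pm_cyclic permutes_swap_id) auto
  ultimately have "uc (of_real (yq j T)) * (tr (mk u \<nu> ?T ?T n) - tr (mk u \<nu> T T n)) = 0"
    by (simp add: right_diff_distrib)
  moreover have "complex_of_real (yq j T) \<noteq> 0"
    using yq_nonzero_iff[OF T \<nu> j] T' by simp
  ultimately show ?thesis using unit by (metis right_minus_eq)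
qed

lemma mk_polyseq: "polyseq (2 * k) (\<lambda>j. mk (u + of_nat j * h) \<nu> R T k)"
proof (induction k)
  case 0
  then show ?case by simp
next
  case (Suc k)
  have lin: "polyseq 1 (\<lambda>j. sc (x + of_nat j * y))" for x y
    by (simp add: sc_diff[symmetric] algebra_simps)
  have 1: "polyseq 1 (\<lambda>j. sc (2 * (u + of_nat j * h) + c) + Jm p)" for c p
    using polyseq_add[OF lin[of "2 * u + c" "2 * h"] polyseq_const[of 1 "Jm p"]] by (simp add: algebra_simps)
  have 2: "polyseq 1 (\<lambda>j. F p - sc (u + of_nat j * h + c + eta G))" for c p
    using polyseq_diff[OF polyseq_const[of 1 "F p"] lin[of "u + c + eta G" h]] by (simp add: algebra_simps)
  have 3: "polyseq (1 + 1) (\<lambda>j. Fac (u + of_nat j * h) c p)" for c p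
    unfolding Fac_def by (rule polyseq_mult[OF 1 2])
  have "2 * Suc k = 2 * k + (1 + 1)" by simp
  then show ?case unfolding mk.simps by (metis polyseq_mult[OF Suc 3])
qed

lemma tr_mk_independent:
  assumes \<nu>: "is_partition \<nu> n" and T: "std_tableau n \<nu> T" and T': "std_tableau n \<nu> T'"
  shows "tr (mk u \<nu> T T n) = tr (mk u \<nu> T' T' n)"
proof -
  \<comment> \<open>Stepping away from the real axis keeps the imaginary part nonzero for all
    \<open>j \<ge> 1\<close>, so twice the parameter is never an integer.\<close>
  define h where "h = (if Im u \<ge> 0 then \<i> else - \<i>)"
  define f where "f = (\<lambda>j. tr (mk (u + of_nat j * h) \<nu> T T n) - tr (mk (u + of_nat j * h) \<nu> T' T' n))"
  have "polyseq (2 * n) f"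
    unfolding f_def
    by (intro polyseq_diff polyseq_additive[where h = tr] tr_diff mk_polyseq)
  moreover have "f j = 0" if j: "1 \<le> j" for j
  proof -
    have "2 * (u + of_nat j * h) \<noteq> of_int z" for z
    proof
      assume "2 * (u + of_nat j * h) = of_int z"
      then have "Im (2 * (u + of_nat j * h)) = 0" by simp
      then show False using j by (auto simp: h_def split: if_splits)
    qed
    then show ?thesis
      unfolding f_def using std_connected[OF \<nu> _ T T', of "\<lambda>T. tr (mk (u + of_nat j * h) \<nu> T T n)"] tr_mk_swap[OF \<nu>]
      by simp
  qed
  ultimately have "f 0 = 0" by (rule polyseq_vanish)
  then show ?thesis by (simp add: f_def)
qed

end

section \<open>From matrices over the free algebra to operators\<close>

context tensor_space
begin

text \<open>The link between matrices over the free algebra and operators over its quotient; finite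
  support of the entries is recorded because \<open>Ucls\<close> is multiplicative only
  there.\<close>

definition represents :: "opr \<Rightarrow> oper \<Rightarrow> bool" where
  "represents A X \<longleftrightarrow> (\<forall>a\<in>Adx N n. \<forall>b\<in>Adx N n. fa_fin (A (lst a) (lst b))) \<and>
    (\<forall>v. \<forall>a\<in>Adx N n. app X v a = (\<Sum>b\<in>Adx N n. Ucls G N (A (lst a) (lst b)) * v b))"

lemma represents_fin: "represents A X \<Longrightarrow> a \<in> Adx N n \<Longrightarrow> b \<in> Adx N n \<Longrightarrow> fa_fin (A (lst a) (lst b))"
  by (simp add: represents_def)

lemma represents_app: "represents A X \<Longrightarrow> a \<in> Adx N n \<Longrightarrow>
    app X v a = (\<Sum>b\<in>Adx N n. Ucls G N (A (lst a) (lst b)) * v b)"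
  by (simp add: represents_def)

lemma representsI:
  assumes "\<And>a b. a \<in> Adx N n \<Longrightarrow> b \<in> Adx N n \<Longrightarrow> fa_fin (A (lst a) (lst b))"
    and "\<And>v a. a \<in> Adx N n \<Longrightarrow> app X v a = (\<Sum>b\<in>Adx N n. Ucls G N (A (lst a) (lst b)) * v b)"
  shows "represents A X"
  using assms by (simp add: represents_def)

lemma represents_omul:
  assumes A: "represents A X" and B: "represents B Y"
  shows "represents (omul N n A B) (X * Y)"
proof (rule representsI)
  have omul: "omul N n A B (lst a) (lst c) = (\<lambda>w. \<Sum>b\<in>Adx N n. fa_mult (A (lst a) (lst b)) (B (lst b) (lst c)) w)" for a c
    by (simp add: omul_def sum_midx)
  show "fa_fin (omul N n A B (lst a) (lst c))" if "a \<in> Adx N n" "c \<in> Adx N n" for a c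
    unfolding omul using that A B by (intro fa_fin_sum fa_fin_mult) (auto simp: represents_fin)
  fix v a assume a: "a \<in> Adx N n"
  have "app (X * Y) v a = (\<Sum>b\<in>Adx N n. \<Sum>c\<in>Adx N n.
      Ucls G N (A (lst a) (lst b)) * Ucls G N (B (lst b) (lst c)) * v c)"
    using a by (simp add: represents_app[OF A] represents_app[OF B] sum_distrib_left mult.assoc)
  also have "\<dots> = (\<Sum>c\<in>Adx N n. \<Sum>b\<in>Adx N n.
      Ucls G N (A (lst a) (lst b)) * Ucls G N (B (lst b) (lst c)) * v c)"
    by (rule sum.swap)
  also have "\<dots> = (\<Sum>c\<in>Adx N n. Ucls G N (omul N n A B (lst a) (lst c)) * v c)"
  proof (rule sum.cong[OF refl])
    fix c assume c: "c \<in> Adx N n"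
    have "Ucls G N (omul N n A B (lst a) (lst c))
        = (\<Sum>b\<in>Adx N n. Ucls G N (fa_mult (A (lst a) (lst b)) (B (lst b) (lst c))))"
      unfolding omul using a c A B by (intro Ucls_sum fa_fin_mult) (auto simp: represents_fin)
    also have "\<dots> = (\<Sum>b\<in>Adx N n. Ucls G N (A (lst a) (lst b)) * Ucls G N (B (lst b) (lst c)))"
      using a c by (intro sum.cong refl Ucls_mult represents_fin[OF A] represents_fin[OF B])
    finally show "(\<Sum>b\<in>Adx N n. Ucls G N (A (lst a) (lst b)) * Ucls G N (B (lst b) (lst c)) * v c)
        = Ucls G N (omul N n A B (lst a) (lst c)) * v c"
      by (simp add: sum_distrib_right)
  qed
  finally show "app (X * Y) v a = (\<Sum>c\<in>Adx N n. Ucls G N (omul N n A B (lst a) (lst c)) * v c)" .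
qed

lemma represents_oid: "represents oid 1"
  by (rule representsI)
     (simp_all add: oid_def Ucls_const lst_eq_iff if_distrib[of uc] if_distrib[of "\<lambda>x. x * _"] cong: if_cong)

lemma represents_tr:
  assumes "represents A X"
  shows "Ucls G N (\<lambda>w. \<Sum>a\<in>midx N n. A a a w) = tr X" "fa_fin (\<lambda>w. \<Sum>a\<in>midx N n. A a a w)"
proof -
  have e: "(\<lambda>w. \<Sum>a\<in>midx N n. A a a w) = (\<lambda>w. \<Sum>a\<in>Adx N n. A (lst a) (lst a) w)"
    by (simp add: sum_midx)
  show "fa_fin (\<lambda>w. \<Sum>a\<in>midx N n. A a a w)"
    unfolding e using represents_fin[OF assms] by (intro fa_fin_sum)
  have "Ucls G N (\<lambda>w. \<Sum>a\<in>midx N n. A a a w) = (\<Sum>a\<in>Adx N n. Ucls G N (A (lst a) (lst a)))"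
    unfolding e using represents_fin[OF assms] by (intro Ucls_sum)
  also have "\<dots> = tr X"
    by (simp add: tr_def represents_app[OF assms] if_distrib[of "\<lambda>x. _ * x"] cong: if_cong)
  finally show "Ucls G N (\<lambda>w. \<Sum>a\<in>midx N n. A a a w) = tr X" .
qed

lemma sum_Adx_line:
  assumes a: "a \<in> Adx N n" and p: "p \<in> {1..n}"
  shows "(\<Sum>b\<in>Adx N n. if (\<forall>r<n. r \<noteq> p - 1 \<longrightarrow> lst a ! r = lst b ! r) then h b else 0)
    = (\<Sum>\<beta>\<in>Iset N. h (a(p := \<beta>)))" (is "_ = ?rhs")
proof -
  have iff: "(\<forall>r<n. r \<noteq> p - 1 \<longrightarrow> lst a ! r = lst b ! r) \<longleftrightarrow> (\<forall>r\<in>{1..n} - {p}. a r = b r)" (is "?l \<longleftrightarrow> ?r") for b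
  proof
    assume l: ?l
    show ?r
    proof
      fix r assume "r \<in> {1..n} - {p}"
      then have "r - 1 < n" "r - 1 \<noteq> p - 1" "Suc (r - 1) = r" using p by auto
      then show "a r = b r" using l by (metis lst_nth)
    qed
  qed (use p in auto)
  have "?rhs = (\<Sum>b\<in>{b \<in> Adx N n. \<forall>r\<in>{1..n} - {p}. a r = b r}. h b)"
  proof (rule sum.reindex_bij_witness[of _ "\<lambda>b. b p" "\<lambda>\<beta>. a(p := \<beta>)"])
    fix b assume b: "b \<in> {b \<in> Adx N n. \<forall>r\<in>{1..n} - {p}. a r = b r}"
    have "(a(p := b p)) r = b r" for r
      using a b by (cases "r \<in> {1..n}") (auto simp: Adx_def simp del: atLeastAtMost_iff)
    then show "a(p := b p) = b" by blast
    show "b p \<in> Iset N" using b p Adx_Iset by blast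
  qed (use a p in auto)
  also have "\<dots> = (\<Sum>b\<in>Adx N n. if (\<forall>r<n. r \<noteq> p - 1 \<longrightarrow> lst a ! r = lst b ! r) then h b else 0)"
    unfolding iff by (rule sum.inter_filter) simp
  finally show ?thesis by simp
qed

lemma sum_Adx_antidiagonal:
  assumes a: "a \<in> Adx N n" and p: "p \<in> {1..n}" "q \<in> {1..n}" "p \<noteq> q"
  shows "(\<Sum>b\<in>Adx N n. if (\<forall>r<n. r \<noteq> p - 1 \<and> r \<noteq> q - 1 \<longrightarrow> lst a ! r = lst b ! r) \<and> b q = - b p then h b else 0)
    = (\<Sum>\<beta>\<in>Iset N. h (a(p := \<beta>, q := - \<beta>)))" (is "_ = ?rhs")
proof -
  have iff: "(\<forall>r<n. r \<noteq> p - 1 \<and> r \<noteq> q - 1 \<longrightarrow> lst a ! r = lst b ! r) \<longleftrightarrow> (\<forall>r\<in>{1..n} - {p, q}. a r = b r)" (is "?l \<longleftrightarrow> ?r") for b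
  proof
    assume l: ?l
    show ?r
    proof
      fix r assume "r \<in> {1..n} - {p, q}"
      then have "r - 1 < n" "r - 1 \<noteq> p - 1 \<and> r - 1 \<noteq> q - 1" "Suc (r - 1) = r" using p by auto
      then show "a r = b r" using l by (metis lst_nth)
    qed
  qed (use p in auto)
  have "?rhs = (\<Sum>b\<in>{b \<in> Adx N n. (\<forall>r\<in>{1..n} - {p, q}. a r = b r) \<and> b q = - b p}. h b)"
  proof (rule sum.reindex_bij_witness[of _ "\<lambda>b. b p" "\<lambda>\<beta>. a(p := \<beta>, q := - \<beta>)"])
    fix b assume b: "b \<in> {b \<in> Adx N n. (\<forall>r\<in>{1..n} - {p, q}. a r = b r) \<and> b q = - b p}"
    have "(a(p := b p, q := - b p)) r = b r" for r
    proof (cases "r \<in> {p, q}")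
      case True
      have "b q = - b p" using b by blast
      then show ?thesis using True p by (simp only: fun_upd_def) auto
    next
      case False
      have "a r = b r"
      proof (cases "r \<in> {1..n}")
        case True
        then show ?thesis using b False by blast
      next
        case False
        then show ?thesis using a b unfolding Adx_def by simp
      qed
      then show ?thesis using False by simp
    qed
    then show "a(p := b p, q := - b p) = b" by blast
    show "b p \<in> Iset N" using b p Adx_Iset by blast
  qed (use a p in auto)
  also have "\<dots> = (\<Sum>b\<in>Adx N n. if (\<forall>r<n. r \<noteq> p - 1 \<and> r \<noteq> q - 1 \<longrightarrow> lst a ! r = lst b ! r) \<and> b q = - b p then h b else 0)"
    unfolding iff by (rule sum.inter_filter) simp
  finally show ?thesis by simp
qed

lemma lst_nth_pred [simp]: "p \<in> {1..n} \<Longrightarrow> lst a ! (p - 1) = a p"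
  by (auto simp: lst_def)

lemma represents_Fp:
  assumes p: "p \<in> {1..n}"
  shows "represents (Fp G n p x) (F p - sc (x + eta G))"
proof (rule representsI)
  let ?P = "\<lambda>a b. \<forall>q<n. q \<noteq> p - 1 \<longrightarrow> lst a ! q = lst b ! q"
  have Fp: "Fp G n p x (lst a) (lst b) = (\<lambda>w. (if a = b then fa_const (- x - eta G) else (\<lambda>w. 0)) w
      + (if ?P a b then fa_gen (b p, a p) else (\<lambda>w. 0)) w)" if "a \<in> Adx N n" "b \<in> Adx N n" for a b
    using that p by (auto simp: Fp_def lst_eq_iff fun_eq_iff)
  show "fa_fin (Fp G n p x (lst a) (lst b))" if "a \<in> Adx N n" "b \<in> Adx N n" for a b
    unfolding Fp[OF that] by (intro fa_fin_add) auto
  fix v a assume a: "a \<in> Adx N n"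
  have "Ucls G N (Fp G n p x (lst a) (lst b)) * v b
      = (if a = b then uc (- x - eta G) * v a else 0) + (if ?P a b then Ugen G N (b p) (a p) * v b else 0)"
    if "b \<in> Adx N n" for b
    unfolding Fp[OF a that] by (subst Ucls_add) (auto simp: Ucls_const Ugen_def distrib_right)
  then have "(\<Sum>b\<in>Adx N n. Ucls G N (Fp G n p x (lst a) (lst b)) * v b)
      = (\<Sum>b\<in>Adx N n. if a = b then uc (- x - eta G) * v a else 0)
      + (\<Sum>b\<in>Adx N n. if ?P a b then Ugen G N (b p) (a p) * v b else 0)"
    by (simp add: sum.distrib)
  also have "(\<Sum>b\<in>Adx N n. if ?P a b then Ugen G N (b p) (a p) * v b else 0) = app (F p) v a"
    using sum_Adx_line[OF a p, of "\<lambda>b. Ugen G N (b p) (a p) * v b"] a by (simp add: app_F)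
  also have "(\<Sum>b\<in>Adx N n. if a = b then uc (- x - eta G) * v a else 0) = - (uc (x + eta G) * v a)"
    using a by (simp add: uc_minus[of "x + eta G", simplified])
  finally show "app (F p - sc (x + eta G)) v a = (\<Sum>b\<in>Adx N n. Ucls G N (Fp G n p x (lst a) (lst b)) * v b)"
    by simp
qed

lemma sum_Qpq:
  assumes p: "p \<in> {1..n}" "q \<in> {1..n}" "p \<noteq> q" and a: "a \<in> Adx N n"
  shows "(\<Sum>b\<in>Adx N n. uc (Qpq G n p q (lst a) (lst b)) * v b) = app (Q p q) v a"
proof (cases "a q = - a p")
  case True
  let ?P = "\<lambda>b. (\<forall>r<n. r \<noteq> p - 1 \<and> r \<noteq> q - 1 \<longrightarrow> lst a ! r = lst b ! r) \<and> b q = - b p"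
  have "(\<Sum>b\<in>Adx N n. uc (Qpq G n p q (lst a) (lst b)) * v b)
      = (\<Sum>b\<in>Adx N n. if ?P b then uc (eps G (a p) (b p)) * v b else 0)"
    using True by (intro sum.cong refl)
      (simp only: Qpq_def lst_nth_pred[OF p(1)] lst_nth_pred[OF p(2)] simp_thms if_distrib[of "\<lambda>x. uc x * _"] uc_0 mult_zero_left)
  also have "\<dots> = app (Q p q) v a"
    using sum_Adx_antidiagonal[OF a p, of "\<lambda>b. uc (eps G (a p) (b p)) * v b"] True a p by (simp add: app_Q)
  finally show ?thesis .
next
  case False
  then show ?thesis using p a by (simp add: Qpq_def app_Q del: One_nat_def)
qed

lemma represents_factorT:
  assumes p: "p \<in> {1..n}" and z: "2 * u + cont T p \<noteq> 0"
  shows "represents (factorT G N n T u p) (sc (1 / (2 * u + cont T p)) * Fac u (cont T p) p)"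
proof -
  let ?z = "2 * u + cont T p"
  let ?A = "\<lambda>a b. fa_const ((if a = b then 1 else 0) + (\<Sum>q\<in>{1..<p}. Qpq G n q p a b) / ?z)"
  have "represents ?A (1 + sc (1 / ?z) * Jm p)"
  proof (rule representsI)
    fix v a assume a: "a \<in> Adx N n"
    have uc_sum: "uc (\<Sum>q\<in>K. g q) = (\<Sum>q\<in>K. uc (g q))" for K :: "nat set" and g
      by (induction K rule: infinite_finite_induct) (simp_all add: uc_add)
    have "Ucls G N (?A (lst a) (lst b)) * v b = (if a = b then v a else 0)
        + uc (1 / ?z) * (\<Sum>q\<in>{1..<p}. uc (Qpq G n q p (lst a) (lst b)) * v b)"
      if "b \<in> Adx N n" for b
    proof -
      have "(\<Sum>q\<in>{1..<p}. Qpq G n q p (lst a) (lst b)) / ?z = (1 / ?z) * (\<Sum>q\<in>{1..<p}. Qpq G n q p (lst a) (lst b))"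
        by simp
      then show ?thesis
        using a that by (simp only: Ucls_const uc_add uc_mult uc_sum lst_eq_iff distrib_right sum_distrib_right mult.assoc) simp
    qed
    then have "(\<Sum>b\<in>Adx N n. Ucls G N (?A (lst a) (lst b)) * v b) = (\<Sum>b\<in>Adx N n. if a = b then v a else 0)
        + uc (1 / ?z) * (\<Sum>b\<in>Adx N n. \<Sum>q\<in>{1..<p}. uc (Qpq G n q p (lst a) (lst b)) * v b)"
      by (simp add: sum.distrib sum_distrib_left)
    also have "(\<Sum>b\<in>Adx N n. \<Sum>q\<in>{1..<p}. uc (Qpq G n q p (lst a) (lst b)) * v b) = app (Jm p) v a"
      unfolding Jm_def app_sum
      using p a by (subst sum.swap) (auto intro!: sum.cong sum_Qpq)
    finally show "app (1 + sc (1 / ?z) * Jm p) v a = (\<Sum>b\<in>Adx N n. Ucls G N (?A (lst a) (lst b)) * v b)"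
      using a by simp
  qed simp
  from represents_omul[OF this represents_Fp[OF p]]
  have "represents (factorT G N n T u p) ((1 + sc (1 / ?z) * Jm p) * (F p - sc (u + cont T p + eta G)))"
    unfolding factorT_def .
  moreover have "1 + sc (1 / ?z) * Jm p = sc (1 / ?z) * (sc ?z + Jm p)"
    using sc_inverse_cancel[OF z, of 1] by (simp only: distrib_left mult_1_right)
  ultimately show ?thesis by (simp add: Fac_def mult.assoc)
qed

text \<open>In \<open>YT\<close> the entry for \<open>\<sigma>\<close> requires
  \<open>a p = b (\<sigma> p)\<close>, that is \<open>b = a \<circ> inv \<sigma>\<close>; this is
  the origin of \<open>Pm (inv \<sigma>)\<close> in \<open>Em\<close>.\<close>

lemma represents_YT:
  "represents (YT n \<nu> T) (sc (of_nat (card (std_tableaux n \<nu>)) / of_nat (fact n)) * Em n \<nu> T T)"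
proof (rule representsI)
  let ?c = "of_nat (card (std_tableaux n \<nu>)) / of_nat (fact n) :: complex"
  show "fa_fin (YT n \<nu> T (lst a) (lst b))" for a b by (simp add: YT_def)
  fix v a assume a: "a \<in> Adx N n"
  have uc_sum: "uc (\<Sum>\<sigma>\<in>K. g \<sigma>) = (\<Sum>\<sigma>\<in>K. uc (g \<sigma>))" for K :: "(nat \<Rightarrow> nat) set" and g
    by (induction K rule: infinite_finite_induct) (simp_all add: uc_add)
  have iff: "(\<forall>p\<in>{1..n}. lst a ! (p - 1) = lst b ! (\<sigma> p - 1)) \<longleftrightarrow> b = a \<circ> inv \<sigma>"
    if b: "b \<in> Adx N n" and \<sigma>: "\<sigma> permutes {1..n}" for b \<sigma>
  proof -
    have "(\<forall>p\<in>{1..n}. lst a ! (p - 1) = lst b ! (\<sigma> p - 1)) \<longleftrightarrow> (\<forall>p\<in>{1..n}. a p = b (\<sigma> p))"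
      by (rule ball_cong[OF refl]) (metis lst_nth_pred permutes_in_image[OF \<sigma>])
    also have "\<dots> \<longleftrightarrow> a = b \<circ> \<sigma>"
    proof
      assume eq: "\<forall>p\<in>{1..n}. a p = b (\<sigma> p)"
      have "a p = b (\<sigma> p)" if "p \<notin> {1..n}" for p
        using that a b permutes_not_in[OF \<sigma> that] unfolding Adx_def by simp
      then show "a = b \<circ> \<sigma>" using eq by (metis comp_apply ext)
    qed simp
    also have "\<dots> \<longleftrightarrow> b = a \<circ> inv \<sigma>"
      using permutes_inv_o[OF \<sigma>] by (metis comp_assoc comp_id)
    finally show ?thesis .
  qed
  have "Ucls G N (YT n \<nu> T (lst a) (lst b)) * v b
      = uc ?c * (\<Sum>\<sigma> | \<sigma> permutes {1..n}. if b = a \<circ> inv \<sigma> then uc (of_real (yrho n \<nu> \<sigma> T T)) * v b else 0)"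
    if b: "b \<in> Adx N n" for b
  proof -
    have "uc (of_real (yrho n \<nu> \<sigma> T T) * (if \<forall>p\<in>{1..n}. lst a ! (p - 1) = lst b ! (\<sigma> p - 1) then 1 else 0)) * v b
      = (if b = a \<circ> inv \<sigma> then uc (of_real (yrho n \<nu> \<sigma> T T)) * v b else 0)" if "\<sigma> permutes {1..n}" for \<sigma>
      unfolding iff[OF b that] by simp
    then show ?thesis
      unfolding YT_def Ucls_const uc_mult[of ?c] uc_sum mult.assoc[of "uc ?c"] sum_distrib_right
      by (intro arg_cong[of _ _ "(*) (uc ?c)"] sum.cong refl) simp
  qed
  then have "(\<Sum>b\<in>Adx N n. Ucls G N (YT n \<nu> T (lst a) (lst b)) * v b)
      = uc ?c * (\<Sum>b\<in>Adx N n. \<Sum>\<sigma> | \<sigma> permutes {1..n}. if b = a \<circ> inv \<sigma> then uc (of_real (yrho n \<nu> \<sigma> T T)) * v b else 0)"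
    by (simp add: sum_distrib_left)
  also have "\<dots> = uc ?c * (\<Sum>\<sigma> | \<sigma> permutes {1..n}. \<Sum>b\<in>Adx N n. if b = a \<circ> inv \<sigma> then uc (of_real (yrho n \<nu> \<sigma> T T)) * v b else 0)"
    by (subst sum.swap) (rule refl)
  also have "\<dots> = uc ?c * (\<Sum>\<sigma> | \<sigma> permutes {1..n}. uc (of_real (yrho n \<nu> \<sigma> T T)) * v (a \<circ> inv \<sigma>))"
  proof -
    have "a \<circ> inv \<sigma> \<in> Adx N n" if "\<sigma> permutes {1..n}" for \<sigma>
      using Adx_perm[OF permutes_inv[OF that]] a by blast
    then show ?thesis
      by (intro arg_cong[of _ _ "(*) (uc ?c)"] sum.cong refl) (simp del: o_apply)
  qed
  also have "\<dots> = app (sc ?c * Em n \<nu> T T) v a"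
    by (simp add: Em_def app_sum)
  finally show "app (sc ?c * Em n \<nu> T T) v a = (\<Sum>b\<in>Adx N n. Ucls G N (YT n \<nu> T (lst a) (lst b)) * v b)"
    by (rule sym)
qed

lemma represents_oprod:
  "list_all2 represents As Xs \<Longrightarrow> represents (oprod N n As) (prod_list Xs)"
  by (induction rule: list_all2_induct) (simp_all add: represents_oid represents_omul)

lemma prod_list_Fac:
  "Em n \<nu> T T * prod_list (map (\<lambda>p. sc (g p) * Fac u (cont T p) p) [1..<Suc k])
    = sc (\<Prod>p\<in>{1..k}. g p) * mk u \<nu> T T k"
proof (induction k)
  case (Suc k)
  let ?L = "prod_list (map (\<lambda>p. sc (g p) * Fac u (cont T p) p) [1..<Suc k])"
  have "Em n \<nu> T T * prod_list (map (\<lambda>p. sc (g p) * Fac u (cont T p) p) [1..<Suc (Suc k)])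
     = Em n \<nu> T T * ?L * (sc (g (Suc k)) * Fac u (cont T (Suc k)) (Suc k))"
  proof -
    have "[1..<Suc (Suc k)] = [1..<Suc k] @ [Suc k]" by (simp add: upt_Suc)
    then show ?thesis by (simp add: mult.assoc)
  qed
  also have "\<dots> = sc (g (Suc k)) * (Em n \<nu> T T * ?L) * Fac u (cont T (Suc k)) (Suc k)"
    unfolding sc_comm[of "Em n \<nu> T T * ?L" "g (Suc k)", symmetric] by (simp only: mult.assoc)
  also have "\<dots> = sc (\<Prod>p\<in>{1..Suc k}. g p) * mk u \<nu> T T (Suc k)"
    unfolding Suc.IH by (simp add: sc_mult[symmetric] mult.assoc[symmetric] mult.commute)
  finally show ?case .
qed simp

lemma ZT_trace:
  assumes "\<And>p. p \<in> {1..n} \<Longrightarrow> 2 * u + cont T p \<noteq> 0"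
  shows "Ucls G N (ZT G N n \<nu> T u) = uc (of_nat (card (std_tableaux n \<nu>)) / of_nat (fact n)
      * (\<Prod>p\<in>{1..n}. 1 / (2 * u + cont T p))) * tr (mk u \<nu> T T n)"
    and "fa_fin (ZT G N n \<nu> T u)"
proof -
  let ?c = "of_nat (card (std_tableaux n \<nu>)) / of_nat (fact n) :: complex"
  let ?Xs = "map (\<lambda>p. sc (1 / (2 * u + cont T p)) * Fac u (cont T p) p) [1..<Suc n]"
  have "represents (oprod N n (map (factorT G N n T u) [1..<n+1])) (prod_list ?Xs)"
    using assms by (intro represents_oprod) (auto simp: list_all2_map1 list_all2_map2 list_all2_same intro!: represents_factorT)
  from represents_omul[OF represents_YT[of \<nu> T] this]
  have rep: "represents (FT G N n \<nu> T u) (sc ?c * Em n \<nu> T T * prod_list ?Xs)"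
    unfolding FT_def .
  have "sc ?c * Em n \<nu> T T * prod_list ?Xs = sc (?c * (\<Prod>p\<in>{1..n}. 1 / (2 * u + cont T p))) * mk u \<nu> T T n"
    using prod_list_Fac[of \<nu> T "\<lambda>p. 1 / (2 * u + cont T p)" u n] by (simp only: mult.assoc sc_mult)
  then show "Ucls G N (ZT G N n \<nu> T u) = uc (?c * (\<Prod>p\<in>{1..n}. 1 / (2 * u + cont T p))) * tr (mk u \<nu> T T n)"
    unfolding ZT_def using represents_tr(1)[OF rep] by (simp add: tr_scale)
  show "fa_fin (ZT G N n \<nu> T u)"
    unfolding ZT_def using represents_tr(2)[OF rep] .
qed

end

text \<open>Equality of rational functions is read pointwise, at every \<open>u\<close> where no
  denominator of either side vanishes.\<close>

theorem theorem2p7: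
  fixes G :: grp and N n :: nat and \<nu> :: "nat list" and T T' :: tableau and u :: complex
  assumes "G = Sympl \<Longrightarrow> even N"
    and "is_partition \<nu> n" and "length \<nu> \<le> N"
    and "std_tableau n \<nu> T" and "std_tableau n \<nu> T'"
    and "\<forall>p\<in>{1..n}. 2 * u + of_int (content T p) \<noteq> 0 \<and> 2 * u + of_int (content T' p) \<noteq> 0"
  shows "U_eq G N (ZT G N n \<nu> T u) (ZT G N n \<nu> T' u)"
proof -
  interpret tensor_space G N n by standard (rule assms(1))
  \<comment> \<open>Reindexing along the bijection from entries to cells makes the cleared
    denominators depend on the shape only.\<close>
  have "(\<Prod>p\<in>{1..n}. 1 / (2 * u + cont T p)) = (\<Prod>x\<in>cells \<nu>. 1 / (2 * u + of_int (int (snd x) - int (fst x))))"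
    if "std_tableau n \<nu> T" for T
    using that unfolding std_tableau_def content_def
    by (intro prod.reindex_bij_betw[of T "{1..n}" "cells \<nu>"
        "\<lambda>x. 1 / (2 * u + of_int (int (snd x) - int (fst x)))", symmetric, THEN sym]) simp
  from this[OF assms(4)] this[OF assms(5)]
  have p: "(\<Prod>p\<in>{1..n}. 1 / (2 * u + cont T p)) = (\<Prod>p\<in>{1..n}. 1 / (2 * u + cont T' p))"
    by (rule trans[OF _ sym])
  have nz: "2 * u + cont T p \<noteq> 0" "2 * u + cont T' p \<noteq> 0" if "p \<in> {1..n}" for p
    using assms(6) that by blast+
  have "Ucls G N (ZT G N n \<nu> T u) = Ucls G N (ZT G N n \<nu> T' u)"
    using ZT_trace(1)[of u T \<nu>] ZT_trace(1)[of u T' \<nu>] nz p tr_mk_independent[OF assms(2,4,5), of u]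
    by metis
  then show ?thesis
    by (intro Ucls_eqD ZT_trace(2) nz)
qed

end
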